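(* Let $G$ be a non-abelian compact Lie group and let $\Omega(G)=H^1(S^1,G)$ be endowed with the $L^2$ weak Riemannian metric. Then the exponential map $\exp_e:T_e\Omega(G)\to\Omega(G)$ of the $L^2$ metric fails to be Fredholm.
   Context: $G$ carries a bi-invariant Riemannian metric $\langle\cdot,\cdot\rangle$, so that its Levi-Civita connection is $\nabla_XY=\frac12[X,Y]$ (on left-invariant fields) and its curvature tensor is $R(X,Y)Z=-\frac14[[X,Y],Z]$. $\Omega(G)$ is the Hilbert manifold of maps of Sobolev class $H^1$ from $S^1$ into $G$; $T_\sigma\Omega(G)$ consists of periodic $H^1$ vector fields along $\sigma$, and $e$ denotes the identity (the constant loop). The $L^2$ weak Riemannian metric is $\langle X,Y\rangle(\sigma)=\int_{S^1}\langle X(x),Y(x)\rangle dx$; it has a smooth Levi-Civita connection, given pointwise by that of $G$, and a smooth exponential map defined on the whole tangent space. A bounded linear operator between Banach spaces is Fredholm if it has closed range and finite dimensional kernel and cokernel. A smooth map $f$ between Banach manifolds is Fredholm if $df_q$ is a Fredholm operator for every point $q$ of the domain. Tangent spaces of $\Omega(G)$ carry their Hilbert ($H^1$) topology.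
   Formalization: "Non-abelian" is read as "the identity component of G is non-abelian" (the same for connected G); without this the claim fails, e.g. for O(2), whose identity component is abelian, so that every differential of exp_e is an isomorphism. *)

theory Defs
  imports "HOL-Analysis.Analysis" "HOL-Algebra.Group"
begin

section \<open>The Hilbert space of $H^1$ loops in a Euclidean space\<close>

text \<open>The circle is $\mathbb{R}/\mathbb{Z}$: loops are maps on the real line of period $1$. A map is of
  class $H^1$ on $[a,b]$ if it is the indefinite integral of a square integrable function.\<close>

definition weak_deriv_on :: "real \<Rightarrow> real \<Rightarrow> (real \<Rightarrow> 'a::euclidean_space) \<Rightarrow> (real \<Rightarrow> 'a) \<Rightarrow> bool" where
  "weak_deriv_on a b f g \<longleftrightarrow>
     g \<in> borel_measurable borel \<and>
     set_integrable lborel {a..b} (\<lambda>t. (norm (g t))\<^sup>2) \<and>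
     (\<forall>t\<in>{a..b}. f t = f a + (LINT s:{a..t}|lborel. g s))"

definition h1_on :: "real \<Rightarrow> real \<Rightarrow> (real \<Rightarrow> 'a::euclidean_space) \<Rightarrow> bool" where
  "h1_on a b f \<longleftrightarrow> (\<exists>g. weak_deriv_on a b f g)"

definition periodic1 :: "(real \<Rightarrow> 'a) \<Rightarrow> bool" where
  "periodic1 f \<longleftrightarrow> (\<forall>t. f (t + 1) = f t)"

lemma weak_deriv_integrable:
  assumes "weak_deriv_on a b f g"
  shows "set_integrable lborel {a..b} g"
  unfolding set_integrable_def
proof (rule Bochner_Integration.integrable_bound)
  have "set_integrable lborel {a..b} (\<lambda>t. 1 + (norm (g t))\<^sup>2)"
    using assms unfolding weak_deriv_on_def
    by (intro set_integral_add(1) borel_integrable_atLeastAtMost'[OF continuous_on_const]) auto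
  then show "integrable lborel (\<lambda>t. indicator {a..b} t *\<^sub>R (1 + (norm (g t))\<^sup>2))"
    by (simp add: set_integrable_def)
  show "(\<lambda>t. indicator {a..b} t *\<^sub>R g t) \<in> borel_measurable lborel"
  proof -
    have [measurable]: "g \<in> borel_measurable borel"
      using assms by (simp add: weak_deriv_on_def)
    show ?thesis by measurable
  qed
  have "norm x \<le> \<bar>1 + (norm x)\<^sup>2\<bar>" for x :: 'a
  proof -
    have "0 \<le> (norm x - 1/2)\<^sup>2" by simp
    then show ?thesis by (simp add: power2_eq_square algebra_simps)
  qed
  then show "AE t in lborel. norm (indicator {a..b} t *\<^sub>R g t) \<le> norm (indicator {a..b} t *\<^sub>R (1 + (norm (g t))\<^sup>2))"
    by (intro AE_I2) (auto simp: indicator_def)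
qed

lemma set_integrable_Icc_subset:
  fixes g :: "real \<Rightarrow> 'a::euclidean_space"
  assumes "set_integrable lborel {a..b} g" "t \<le> b"
  shows "set_integrable lborel {a..t} g"
  using assms by (intro set_integrable_subset[OF assms(1)]) auto

lemma square_integrable_add:
  fixes g h :: "real \<Rightarrow> 'a::euclidean_space"
  assumes "g \<in> borel_measurable borel" "h \<in> borel_measurable borel"
    and "set_integrable lborel {a..b} (\<lambda>t. (norm (g t))\<^sup>2)"
    and "set_integrable lborel {a..b} (\<lambda>t. (norm (h t))\<^sup>2)"
  shows "set_integrable lborel {a..b} (\<lambda>t. (norm (g t + h t))\<^sup>2)"
  unfolding set_integrable_def
proof (rule Bochner_Integration.integrable_bound)
  have "set_integrable lborel {a..b} (\<lambda>t. 2 * (norm (g t))\<^sup>2 + 2 * (norm (h t))\<^sup>2)"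
    using assms by (intro set_integral_add(1) set_integrable_mult_right) auto
  then show "integrable lborel (\<lambda>t. indicator {a..b} t *\<^sub>R (2 * (norm (g t))\<^sup>2 + 2 * (norm (h t))\<^sup>2))"
    by (simp add: set_integrable_def)
  show "(\<lambda>t. indicator {a..b} t *\<^sub>R (norm (g t + h t))\<^sup>2) \<in> borel_measurable lborel"
    using assms by simp
  have "(norm (x + y))\<^sup>2 \<le> 2 * (norm x)\<^sup>2 + 2 * (norm y)\<^sup>2" for x y :: 'a
  proof -
    have "0 \<le> (norm (x - y))\<^sup>2" by simp
    then show ?thesis
      unfolding power2_norm_eq_inner by (simp add: inner_add inner_diff inner_commute)
  qed
  then show "AE t in lborel. norm (indicator {a..b} t *\<^sub>R (norm (g t + h t))\<^sup>2)
      \<le> norm (indicator {a..b} t *\<^sub>R (2 * (norm (g t))\<^sup>2 + 2 * (norm (h t))\<^sup>2))"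
    by (intro AE_I2) (auto simp: indicator_def)
qed

lemma weak_deriv_add:
  assumes "weak_deriv_on a b f g" "weak_deriv_on a b f' g'"
  shows "weak_deriv_on a b (\<lambda>t. f t + f' t) (\<lambda>t. g t + g' t)"
proof -
  have "f t + f' t = f a + f' a + (LINT s:{a..t}|lborel. g s + g' s)" if t: "t \<in> {a..b}" for t
  proof -
    have "f t = f a + (LINT s:{a..t}|lborel. g s)" "f' t = f' a + (LINT s:{a..t}|lborel. g' s)"
      using assms t unfolding weak_deriv_on_def by blast+
    moreover have "(LINT s:{a..t}|lborel. g s + g' s) =
        (LINT s:{a..t}|lborel. g s) + (LINT s:{a..t}|lborel. g' s)"
      using t assms by (intro set_integral_add(2) set_integrable_Icc_subset[OF weak_deriv_integrable]) auto
    ultimately show ?thesis by (simp add: algebra_simps)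
  qed
  then show ?thesis
    using assms unfolding weak_deriv_on_def
    by (intro conjI ballI square_integrable_add borel_measurable_add) blast+
qed

lemma weak_deriv_scale:
  assumes "weak_deriv_on a b f g"
  shows "weak_deriv_on a b (\<lambda>t. r *\<^sub>R f t) (\<lambda>t. r *\<^sub>R g t)"
proof -
  have "r *\<^sub>R f t = r *\<^sub>R f a + (LINT s:{a..t}|lborel. r *\<^sub>R g s)" if t: "t \<in> {a..b}" for t
  proof -
    have "f t = f a + (LINT s:{a..t}|lborel. g s)"
      using assms t unfolding weak_deriv_on_def by blast
    from arg_cong[OF this, of "scaleR r"] show ?thesis
      by (simp only: scaleR_add_right set_integral_scaleR_right)
  qed
  moreover have "set_integrable lborel {a..b} (\<lambda>t. r\<^sup>2 * (norm (g t))\<^sup>2)"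
    using assms unfolding weak_deriv_on_def by (intro set_integrable_mult_right) auto
  ultimately show ?thesis
    using assms unfolding weak_deriv_on_def
    by (intro conjI ballI) (simp_all only: norm_scaleR power_mult_distrib power2_abs borel_measurable_scaleR borel_measurable_const)
qed

lemma weak_deriv_zero: "weak_deriv_on a b (\<lambda>_. 0) (\<lambda>_. 0)"
  by (auto simp: weak_deriv_on_def set_integrable_def)

lemma weak_deriv_zero_AE:
  assumes w: "weak_deriv_on a b (\<lambda>_. 0) g"
  shows "AE t in lborel. indicator {a..b} t *\<^sub>R g t = 0"
proof (rule sigma_finite_measure.density_zero[OF sigma_finite_lborel])
  define h where "h = (\<lambda>t. indicator {a..b} t *\<^sub>R g t)"
  have int: "integrable lborel h"
    using weak_deriv_integrable[OF w] by (simp add: set_integrable_def h_def)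
  then show "integrable lborel (\<lambda>t. indicator {a..b} t *\<^sub>R g t)" by (simp add: h_def)
  have setint: "set_integrable lborel A h" if "A \<in> sets borel" for A
    using that int unfolding set_integrable_def
    by (intro integrable_mult_indicator) auto
  have prim: "(LINT s:{a..t}|lborel. g s) = 0" if "t \<in> {a..b}" for t
    using w that unfolding weak_deriv_on_def by auto
  have eq: "set_lebesgue_integral lborel {..t} h = 0" for t
  proof -
    consider "t < a" | "t \<in> {a..b}" | "a \<le> t" "b < t" by force
    then show ?thesis
    proof cases
      case 1
      have "set_lebesgue_integral lborel {..t} h = (LINT s|(lborel::real measure). (0::'a))"
        unfolding set_lebesgue_integral_def h_def
        by (intro Bochner_Integration.integral_cong) (use 1 in \<open>auto simp: indicator_def\<close>)
      then show ?thesis by simp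
    next
      case 2
      have "set_lebesgue_integral lborel {..t} h = (LINT s:{a..t}|lborel. g s)"
        unfolding set_lebesgue_integral_def h_def
        by (intro Bochner_Integration.integral_cong) (use 2 in \<open>auto simp: indicator_def\<close>)
      then show ?thesis using prim[OF 2] by simp
    next
      case 3
      have eq: "set_lebesgue_integral lborel {..t} h = (LINT s:{a..b}|lborel. g s)"
        unfolding set_lebesgue_integral_def h_def
        by (intro Bochner_Integration.integral_cong) (use 3 in \<open>auto simp: indicator_def\<close>)
      show ?thesis
      proof (cases "a \<le> b")
        case True
        then show ?thesis using prim[of b] eq by simp
      next
        case False
        then show ?thesis using eq by (simp add: set_lebesgue_integral_def)
      qed
    qed
  qed
  have total: "set_lebesgue_integral lborel UNIV h = 0"
  proof -
    have "set_lebesgue_integral lborel UNIV h = set_lebesgue_integral lborel {..max a b} h"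
      unfolding set_lebesgue_integral_def h_def
      by (intro Bochner_Integration.integral_cong) (auto simp: indicator_def)
    then show ?thesis using eq by simp
  qed
  have "set_lebesgue_integral lborel A h = 0" if A: "A \<in> sets borel" for A
  proof -
    have "Int_stable (range (\<lambda>t::real. {..t}))"
      by (auto simp: Int_stable_def)
    moreover have "range (\<lambda>t::real. {..t}) \<subseteq> Pow UNIV" by simp
    moreover have "A \<in> sigma_sets UNIV (range (\<lambda>t::real. {..t}))"
      using A by (simp add: borel_eq_atMost)
    ultimately show ?thesis
    proof (induction rule: sigma_sets_induct_disjoint)
      case (basic B)
      then show ?case using eq by auto
    next
      case empty
      then show ?case by (simp add: set_lebesgue_integral_def)
    next
      case (compl B)
      then have B: "B \<in> sets borel" by (simp add: borel_eq_atMost)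
      have "set_lebesgue_integral lborel (B \<union> (UNIV - B)) h =
          set_lebesgue_integral lborel B h + set_lebesgue_integral lborel (UNIV - B) h"
        using B by (intro set_integral_Un setint) auto
      then show ?case using compl total by simp
    next
      case (union B)
      then have B: "\<And>i. B i \<in> sets borel" by (auto simp: borel_eq_atMost)
      have "set_lebesgue_integral lborel (\<Union>i. B i) h = (\<Sum>i. set_lebesgue_integral lborel (B i) h)"
        using B union(1)
        by (intro lebesgue_integral_countable_add setint) (auto simp: disjoint_family_on_def)
      then show ?case using union by simp
    qed
  qed
  then show "\<And>A. A \<in> sets lborel \<Longrightarrow>
      set_lebesgue_integral lborel A (\<lambda>t. indicator {a..b} t *\<^sub>R g t) = 0"
    by (simp add: h_def)
qed

lemma weak_deriv_unique_AE:
  assumes "weak_deriv_on a b f g" "weak_deriv_on a b f h"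
  shows "AE t in lborel. t \<in> {a..b} \<longrightarrow> g t = h t"
proof -
  have "weak_deriv_on a b (\<lambda>t. f t + (-1) *\<^sub>R f t) (\<lambda>t. g t + (-1) *\<^sub>R h t)"
    by (intro weak_deriv_add weak_deriv_scale assms)
  then have "weak_deriv_on a b (\<lambda>_. 0) (\<lambda>t. g t - h t)" by simp
  from weak_deriv_zero_AE[OF this] show ?thesis
    by eventually_elim (auto simp: indicator_def)
qed

lemma weak_deriv_continuous:
  assumes w: "weak_deriv_on a b f g"
  shows "continuous_on {a..b} f"
proof -
  have "continuous_on {a..b} (\<lambda>t. f a + integral {a..t} g)"
    using weak_deriv_integrable[OF w]
    by (intro continuous_intros indefinite_integral_continuous_1 set_borel_integral_eq_integral(1))
  moreover have "f a + integral {a..t} g = f t" if t: "t \<in> {a..b}" for t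
  proof -
    have "(LINT s:{a..t}|lborel. g s) = integral {a..t} g"
      using t by (intro set_borel_integral_eq_integral(2)
          set_integrable_Icc_subset[OF weak_deriv_integrable[OF w]]) auto
    moreover have "f t = f a + (LINT s:{a..t}|lborel. g s)"
      using w t unfolding weak_deriv_on_def by blast
    ultimately show ?thesis by simp
  qed
  ultimately show ?thesis by (rule continuous_on_eq)
qed

typedef (overloaded) ('a::euclidean_space) h1 = "{f :: real \<Rightarrow> 'a. periodic1 f \<and> h1_on 0 1 f}"
  morphisms loop_of Abs_h1
  by (rule exI[of _ "\<lambda>_. 0"]) (auto simp: periodic1_def h1_on_def intro: weak_deriv_zero)

setup_lifting type_definition_h1

text \<open>The weak derivative is unique up to null sets, so the inner product below does not depend on
  the choice.\<close>

definition wderiv :: "'a::euclidean_space h1 \<Rightarrow> real \<Rightarrow> 'a" where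
  "wderiv f = (SOME g. weak_deriv_on 0 1 (loop_of f) g)"

lemma wderiv: "weak_deriv_on 0 1 (loop_of f) (wderiv f)"
  using loop_of[of f] someI_ex[of "weak_deriv_on 0 1 (loop_of f)"]
  unfolding wderiv_def h1_on_def by auto

lemma loop_of_continuous: "continuous_on {0..1} (loop_of f)"
  by (rule weak_deriv_continuous[OF wderiv])

instantiation h1 :: (euclidean_space) real_vector
begin

lift_definition zero_h1 :: "'a h1" is "\<lambda>_. 0"
  by (auto simp: periodic1_def h1_on_def intro: weak_deriv_zero)

lift_definition plus_h1 :: "'a h1 \<Rightarrow> 'a h1 \<Rightarrow> 'a h1" is "\<lambda>f g t. f t + g t"
  by (auto simp: periodic1_def h1_on_def intro: weak_deriv_add)

lift_definition scaleR_h1 :: "real \<Rightarrow> 'a h1 \<Rightarrow> 'a h1" is "\<lambda>r f t. r *\<^sub>R f t"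
  by (auto simp: periodic1_def h1_on_def intro: weak_deriv_scale)

definition uminus_h1 :: "'a h1 \<Rightarrow> 'a h1" where "uminus_h1 f = (-1) *\<^sub>R f"

definition minus_h1 :: "'a h1 \<Rightarrow> 'a h1 \<Rightarrow> 'a h1" where "minus_h1 f g = f + (-1) *\<^sub>R g"

instance
  by standard
    (auto simp: uminus_h1_def minus_h1_def algebra_simps loop_of_inject[symmetric] fun_eq_iff
      plus_h1.rep_eq scaleR_h1.rep_eq zero_h1.rep_eq)

end

lemma wderiv_add_AE: "AE t in lborel. t \<in> {0..1} \<longrightarrow> wderiv (f + g) t = wderiv f t + wderiv g t"
  by (rule weak_deriv_unique_AE[OF wderiv])
    (simp add: plus_h1.rep_eq weak_deriv_add[OF wderiv wderiv])

lemma wderiv_scale_AE: "AE t in lborel. t \<in> {0..1} \<longrightarrow> wderiv (r *\<^sub>R f) t = r *\<^sub>R wderiv f t"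
  by (rule weak_deriv_unique_AE[OF wderiv])
    (simp add: scaleR_h1.rep_eq weak_deriv_scale[OF wderiv])

lemma square_integrable_inner:
  fixes g h :: "real \<Rightarrow> 'a::euclidean_space"
  assumes "g \<in> borel_measurable borel" "h \<in> borel_measurable borel"
    and "set_integrable lborel {a..b} (\<lambda>t. (norm (g t))\<^sup>2)"
    and "set_integrable lborel {a..b} (\<lambda>t. (norm (h t))\<^sup>2)"
  shows "set_integrable lborel {a..b} (\<lambda>t. inner (g t) (h t))"
proof -
  have "set_integrable lborel {a..b}
      (\<lambda>t. (1/2) * ((norm (g t + h t))\<^sup>2 - (norm (g t))\<^sup>2 - (norm (h t))\<^sup>2))"
    using assms by (intro set_integrable_mult_right set_integral_diff(1) square_integrable_add) auto
  moreover have "(1/2) * ((norm (x + y))\<^sup>2 - (norm x)\<^sup>2 - (norm y)\<^sup>2) = inner x y" for x y :: 'a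
    unfolding power2_norm_eq_inner by (simp add: inner_add inner_commute)
  ultimately show ?thesis by simp
qed

lemma wderiv_measurable: "wderiv f \<in> borel_measurable borel"
  using wderiv[of f] by (simp add: weak_deriv_on_def)

lemma integrable_wderiv_inner: "set_integrable lborel {0..1} (\<lambda>t. inner (wderiv f t) (wderiv g t))"
  using wderiv[of f] wderiv[of g] by (intro square_integrable_inner) (auto simp: weak_deriv_on_def)

lemma integrable_loop_inner: "set_integrable lborel {0..1} (\<lambda>t. inner (loop_of f t) (loop_of g t))"
  by (intro borel_integrable_atLeastAtMost' continuous_intros loop_of_continuous)

lemma loop_of_eqI:
  assumes "\<And>t. t \<in> {0..1} \<Longrightarrow> loop_of f t = loop_of g t"
  shows "f = g"
proof -
  have per: "loop_of h (t + of_int n) = loop_of h t" for h :: "'a h1" and t n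
  proof -
    have p: "\<And>t. loop_of h (t + 1) = loop_of h t"
      using loop_of[of h] by (simp add: periodic1_def)
    have pn: "loop_of h (t + real n) = loop_of h t" for t n
    proof (induction n)
      case (Suc n)
      then show ?case using p[of "t + real n"] by (simp add: algebra_simps)
    qed simp
    show ?thesis
    proof (cases "0 \<le> n")
      case True
      then show ?thesis using pn[of t "nat n"] by simp
    next
      case False
      then show ?thesis using pn[of "t + of_int n" "nat (- n)"] by simp
    qed
  qed
  have "loop_of f t = loop_of g t" for t
  proof -
    have "frac t \<in> {0..1}" using frac_ge_0[of t] frac_lt_1[of t] by auto
    then have "loop_of f (frac t) = loop_of g (frac t)" by (rule assms)
    moreover have "t = frac t + of_int \<lfloor>t\<rfloor>" by (simp add: frac_def)
    ultimately show ?thesis by (metis per)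
  qed
  then show ?thesis by (simp add: loop_of_inject[symmetric] fun_eq_iff)
qed

instantiation h1 :: (euclidean_space) real_inner
begin

definition inner_h1 :: "'a h1 \<Rightarrow> 'a h1 \<Rightarrow> real" where
  "inner_h1 f g = (LINT t:{0..1}|lborel. inner (loop_of f t) (loop_of g t))
     + (LINT t:{0..1}|lborel. inner (wderiv f t) (wderiv g t))"

definition norm_h1 :: "'a h1 \<Rightarrow> real" where "norm_h1 f = sqrt (inner f f)"

definition sgn_h1 :: "'a h1 \<Rightarrow> 'a h1" where "sgn_h1 f = f /\<^sub>R norm f"

definition dist_h1 :: "'a h1 \<Rightarrow> 'a h1 \<Rightarrow> real" where "dist_h1 f g = norm (f - g)"

definition uniformity_h1 :: "('a h1 \<times> 'a h1) filter" where
  "uniformity_h1 = (INF e\<in>{0<..}. principal {(x, y). dist x y < e})"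

definition open_h1 :: "'a h1 set \<Rightarrow> bool" where
  "open_h1 S \<longleftrightarrow> (\<forall>x\<in>S. \<forall>\<^sub>F (x', y) in uniformity. x' = x \<longrightarrow> y \<in> S)"

instance
proof
  fix f g h :: "'a h1" and r :: real and S :: "'a h1 set"
  show "dist f g = norm (f - g)" by (rule dist_h1_def)
  show "sgn f = f /\<^sub>R norm f" by (rule sgn_h1_def)
  show "uniformity = (INF e\<in>{0<..}. principal {(x, y). dist (x::'a h1) y < e})"
    by (rule uniformity_h1_def)
  show "open S \<longleftrightarrow> (\<forall>x\<in>S. \<forall>\<^sub>F (x', y) in uniformity. x' = x \<longrightarrow> y \<in> S)"
    by (rule open_h1_def)
  show "inner f g = inner g f" by (simp add: inner_h1_def inner_commute)
  show "norm f = sqrt (inner f f)" by (rule norm_h1_def)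
  have "(LINT t:{0..1}|lborel. inner (wderiv (f + g) t) (wderiv h t)) =
      (LINT t:{0..1}|lborel. inner (wderiv f t) (wderiv h t) + inner (wderiv g t) (wderiv h t))"
    using wderiv_add_AE[of f g]
    by (intro set_lebesgue_integral_cong_AE)
      (auto simp: inner_add_left intro!: borel_measurable_inner borel_measurable_add wderiv_measurable)
  also have "\<dots> = (LINT t:{0..1}|lborel. inner (wderiv f t) (wderiv h t))
      + (LINT t:{0..1}|lborel. inner (wderiv g t) (wderiv h t))"
    by (intro set_integral_add(2) integrable_wderiv_inner)
  finally show "inner (f + g) h = inner f h + inner g h"
    by (simp add: inner_h1_def plus_h1.rep_eq inner_add_left
        set_integral_add(2)[OF integrable_loop_inner integrable_loop_inner])
  have "(LINT t:{0..1}|lborel. inner (wderiv (r *\<^sub>R f) t) (wderiv g t)) =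
      (LINT t:{0..1}|lborel. r * inner (wderiv f t) (wderiv g t))"
    using wderiv_scale_AE[of r f]
    by (intro set_lebesgue_integral_cong_AE)
      (auto intro!: borel_measurable_inner borel_measurable_times wderiv_measurable)
  then show "inner (r *\<^sub>R f) g = r * inner f g"
    by (simp add: inner_h1_def scaleR_h1.rep_eq algebra_simps)
  have pos1: "0 \<le> (LINT t:{0..1}|lborel. inner (loop_of f t) (loop_of f t))"
    unfolding set_lebesgue_integral_def by (intro Bochner_Integration.integral_nonneg) auto
  have pos2: "0 \<le> (LINT t:{0..1}|lborel. inner (wderiv f t) (wderiv f t))"
    unfolding set_lebesgue_integral_def by (intro Bochner_Integration.integral_nonneg) auto
  show "0 \<le> inner f f" using pos1 pos2 by (simp add: inner_h1_def)
  show "inner f f = 0 \<longleftrightarrow> f = 0"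
  proof
    assume "inner f f = 0"
    then have 0: "(LINT t:{0..1}|lborel. inner (loop_of f t) (loop_of f t)) = 0"
      using pos1 pos2 by (simp add: inner_h1_def)
    have cont: "continuous_on {0..1} (\<lambda>t. inner (loop_of f t) (loop_of f t))"
      by (intro continuous_intros loop_of_continuous)
    have "integral {0..1} (\<lambda>t. inner (loop_of f t) (loop_of f t)) = 0"
      using 0 set_borel_integral_eq_integral(2)[OF integrable_loop_inner[of f f]] by simp
    then have "\<forall>t\<in>{0..1}. inner (loop_of f t) (loop_of f t) = 0"
      using integral_eq_0_iff[OF cont] by simp
    then show "f = 0" by (intro loop_of_eqI) (auto simp: zero_h1.rep_eq)
  next
    assume f: "f = 0"
    have "AE t in lborel. t \<in> {0..1} \<longrightarrow> wderiv (0 :: 'a h1) t = 0"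
      by (rule weak_deriv_unique_AE[OF wderiv]) (simp add: zero_h1.rep_eq weak_deriv_zero)
    then have "(LINT t:{0..1}|lborel. inner (wderiv (0::'a h1) t) (wderiv (0::'a h1) t)) =
        (LINT t:{0..1::real}|lborel. (0::real))"
      by (intro set_lebesgue_integral_cong_AE)
        (auto intro!: borel_measurable_inner wderiv_measurable)
    then show "inner f f = 0"
      unfolding f inner_h1_def by (simp add: zero_h1.rep_eq set_lebesgue_integral_def)
  qed
qed

end

section \<open>Smooth manifolds, Lie groups and bi-invariant metrics\<close>

text \<open>On an open subset of a finite dimensional space, continuity of all iterated directional
  derivatives is the usual notion of a map of class $C^k$.\<close>

primrec Ck_on :: "nat \<Rightarrow> 'a::euclidean_space set \<Rightarrow> ('a \<Rightarrow> 'b::real_normed_vector) \<Rightarrow> bool" where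
  "Ck_on 0 S f \<longleftrightarrow> continuous_on S f"
| "Ck_on (Suc k) S f \<longleftrightarrow> (\<forall>x\<in>S. f differentiable (at x)) \<and>
     (\<forall>v. Ck_on k S (\<lambda>x. frechet_derivative f (at x) v))"

definition smooth_on :: "'a::euclidean_space set \<Rightarrow> ('a \<Rightarrow> 'b::real_normed_vector) \<Rightarrow> bool" where
  "smooth_on S f \<longleftrightarrow> (\<forall>k. Ck_on k S f)"

text \<open>A chart is a pair of its domain and its coordinate map.\<close>

type_synonym ('p, 'm) chart = "'p set \<times> ('p \<Rightarrow> 'm)"

definition in_charts :: "('p, 'm) chart \<Rightarrow> ('q, 'n) chart \<Rightarrow> ('p \<Rightarrow> 'q) \<Rightarrow> 'm \<Rightarrow> 'n" where
  "in_charts c d f = snd d \<circ> f \<circ> inv_into (fst c) (snd c)"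

definition chart_on :: "'p topology \<Rightarrow> ('p, 'm::real_normed_vector) chart \<Rightarrow> bool" where
  "chart_on T c \<longleftrightarrow> openin T (fst c) \<and> open (snd c ` fst c) \<and>
     homeomorphic_map (subtopology T (fst c)) (top_of_set (snd c ` fst c)) (snd c)"

definition smooth_map ::
  "'p topology \<Rightarrow> ('p, 'm::euclidean_space) chart set \<Rightarrow>
   'q topology \<Rightarrow> ('q, 'n::euclidean_space) chart set \<Rightarrow> ('p \<Rightarrow> 'q) \<Rightarrow> bool" where
  "smooth_map S A T B f \<longleftrightarrow> continuous_map S T f \<and>
     (\<forall>c\<in>A. \<forall>d\<in>B. smooth_on (snd c ` {p \<in> fst c. f p \<in> fst d}) (in_charts c d f))"

definition smooth_manifold :: "'p topology \<Rightarrow> ('p, 'm::euclidean_space) chart set \<Rightarrow> bool" where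
  "smooth_manifold T A \<longleftrightarrow> Hausdorff_space T \<and> second_countable T \<and>
     (\<forall>c\<in>A. chart_on T c) \<and> \<Union> (fst ` A) = topspace T \<and> smooth_map T A T A (\<lambda>p. p)"

definition prod_atlas :: "('p, 'm) chart set \<Rightarrow> ('q, 'n) chart set \<Rightarrow> ('p \<times> 'q, 'm \<times> 'n) chart set" where
  "prod_atlas A B = {(fst c \<times> fst d, map_prod (snd c) (snd d)) | c d. c \<in> A \<and> d \<in> B}"

record ('g, 'e) lie_group = "'g monoid" +
  topol :: "'g topology"
  atlas :: "('g, 'e) chart set"

definition is_lie_group :: "('g, 'e::euclidean_space) lie_group \<Rightarrow> bool" where
  "is_lie_group G \<longleftrightarrow> group G \<and> topspace (topol G) = carrier G \<and>
     smooth_manifold (topol G) (atlas G) \<and>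
     smooth_map (prod_topology (topol G) (topol G)) (prod_atlas (atlas G) (atlas G))
       (topol G) (atlas G) (\<lambda>(p, q). p \<otimes>\<^bsub>G\<^esub> q) \<and>
     smooth_map (topol G) (atlas G) (topol G) (atlas G) (\<lambda>p. inv\<^bsub>G\<^esub> p)"

text \<open>A tangent vector at \<open>p\<close> is given by its components in a chart around \<open>p\<close>. The differential of
  \<open>f\<close> at \<open>p\<close>, in the charts \<open>c\<close> around \<open>p\<close> and \<open>d\<close> around \<open>f p\<close>:\<close>

definition differential ::
  "('p, 'm::real_normed_vector) chart \<Rightarrow> ('q, 'n::real_normed_vector) chart \<Rightarrow>
   ('p \<Rightarrow> 'q) \<Rightarrow> 'p \<Rightarrow> 'm \<Rightarrow> 'n" where
  "differential c d f p = frechet_derivative (in_charts c d f) (at (snd c p))"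

text \<open>A Riemannian metric is given by \<open>g c p u v\<close>, the inner product of the tangent vectors at \<open>p\<close>
  with components \<open>u\<close> and \<open>v\<close> in the chart \<open>c\<close>. Independence of the chart is the statement that the
  identity map is an isometry.\<close>

type_synonym ('g, 'e) metric = "('g, 'e) chart \<Rightarrow> 'g \<Rightarrow> 'e \<Rightarrow> 'e \<Rightarrow> real"

definition is_isometry :: "('g, 'e::euclidean_space) chart set \<Rightarrow> ('g, 'e) metric \<Rightarrow> ('g \<Rightarrow> 'g) \<Rightarrow> bool" where
  "is_isometry A g f \<longleftrightarrow> (\<forall>c\<in>A. \<forall>d\<in>A. \<forall>p\<in>fst c. f p \<in> fst d \<longrightarrow>
     (\<forall>u v. g d (f p) (differential c d f p u) (differential c d f p v) = g c p u v))"

definition riemannian_metric :: "('g, 'e::euclidean_space) chart set \<Rightarrow> ('g, 'e) metric \<Rightarrow> bool" where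
  "riemannian_metric A g \<longleftrightarrow>
     (\<forall>c\<in>A. \<forall>p\<in>fst c. bilinear (g c p) \<and> (\<forall>u v. g c p u v = g c p v u) \<and>
        (\<forall>u. u \<noteq> 0 \<longrightarrow> 0 < g c p u u)) \<and>
     (\<forall>c\<in>A. \<forall>u v. smooth_on (snd c ` fst c) (\<lambda>x. g c (inv_into (fst c) (snd c) x) u v)) \<and>
     is_isometry A g (\<lambda>p. p)"

definition bi_invariant_metric :: "('g, 'e::euclidean_space) lie_group \<Rightarrow> ('g, 'e) metric \<Rightarrow> bool" where
  "bi_invariant_metric G g \<longleftrightarrow> riemannian_metric (atlas G) g \<and>
     (\<forall>h\<in>carrier G. is_isometry (atlas G) g (\<lambda>p. h \<otimes>\<^bsub>G\<^esub> p) \<and>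
                     is_isometry (atlas G) g (\<lambda>p. p \<otimes>\<^bsub>G\<^esub> h))"

text \<open>From here on \<open>c\<close> is a chart around the unit, which identifies the Lie algebra $T_eG$ with the
  model space. \<open>left_field G c u\<close> is the left invariant vector field with value \<open>u\<close> at the unit,
  written in the chart \<open>c\<close>.\<close>

definition left_field :: "('g, 'e::euclidean_space) lie_group \<Rightarrow> ('g, 'e) chart \<Rightarrow> 'e \<Rightarrow> 'e \<Rightarrow> 'e" where
  "left_field G c u x =
     differential c c (\<lambda>q. inv_into (fst c) (snd c) x \<otimes>\<^bsub>G\<^esub> q) \<one>\<^bsub>G\<^esub> u"

definition lie_bracket :: "('g, 'e::euclidean_space) lie_group \<Rightarrow> ('g, 'e) chart \<Rightarrow> 'e \<Rightarrow> 'e \<Rightarrow> 'e" where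
  "lie_bracket G c u v =
     frechet_derivative (left_field G c v) (at (snd c \<one>\<^bsub>G\<^esub>)) u
     - frechet_derivative (left_field G c u) (at (snd c \<one>\<^bsub>G\<^esub>)) v"

section \<open>The loop group $H^1(S^1,G)$ as a Hilbert manifold\<close>

definition H1_loops :: "('g, 'e::euclidean_space) lie_group \<Rightarrow> (real \<Rightarrow> 'g) set" where
  "H1_loops G = {\<sigma>. (\<forall>t. \<sigma> t \<in> carrier G) \<and> periodic1 \<sigma> \<and>
     continuous_map euclidean (topol G) \<sigma> \<and>
     (\<forall>c\<in>atlas G. \<forall>a b. \<sigma> ` {a..b} \<subseteq> fst c \<longrightarrow> h1_on a b (snd c \<circ> \<sigma>))}"

text \<open>The chart centred at \<open>\<sigma>\<close> sends a loop \<open>\<tau>\<close> that is pointwise close to \<open>\<sigma>\<close> to the loop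
  $\sigma^{-1}\tau$ read in the chart \<open>c\<close> around the unit of \<open>G\<close>. A tangent vector at \<open>\<sigma>\<close> with component
  \<open>\<xi>\<close> in this chart is the $H^1$ vector field along \<open>\<sigma>\<close> that takes the value
  $dL_{\sigma(x)}\,\xi(x)$ at \<open>x\<close>.\<close>

definition loop_chart ::
  "('g, 'e::euclidean_space) lie_group \<Rightarrow> ('g, 'e) chart \<Rightarrow> (real \<Rightarrow> 'g) \<Rightarrow> (real \<Rightarrow> 'g, 'e h1) chart" where
  "loop_chart G c \<sigma> =
     ({\<tau> \<in> H1_loops G. \<forall>x. inv\<^bsub>G\<^esub> (\<sigma> x) \<otimes>\<^bsub>G\<^esub> \<tau> x \<in> fst c},
      \<lambda>\<tau>. Abs_h1 (\<lambda>x. snd c (inv\<^bsub>G\<^esub> (\<sigma> x) \<otimes>\<^bsub>G\<^esub> \<tau> x)))"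

definition loop_atlas :: "('g, 'e::euclidean_space) lie_group \<Rightarrow> (real \<Rightarrow> 'g, 'e h1) chart set" where
  "loop_atlas G = {loop_chart G c \<sigma> | c \<sigma>. c \<in> atlas G \<and> \<one>\<^bsub>G\<^esub> \<in> fst c \<and> \<sigma> \<in> H1_loops G}"

definition constant_loop :: "('g, 'e::euclidean_space) lie_group \<Rightarrow> real \<Rightarrow> 'g" where
  "constant_loop G = (\<lambda>_. \<one>\<^bsub>G\<^esub>)"

section \<open>Fredholm maps\<close>

definition fredholm_operator :: "('a::real_normed_vector \<Rightarrow> 'b::real_normed_vector) \<Rightarrow> bool" where
  "fredholm_operator L \<longleftrightarrow> bounded_linear L \<and> closed (range L) \<and>
     (\<exists>K. finite K \<and> span K = {x. L x = 0}) \<and>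
     (\<exists>C. finite C \<and> span (range L \<union> C) = UNIV)"

definition has_mderivative ::
  "('p, 'm::real_normed_vector) chart \<Rightarrow> ('q, 'n::real_normed_vector) chart \<Rightarrow>
   ('p \<Rightarrow> 'q) \<Rightarrow> 'p \<Rightarrow> ('m \<Rightarrow> 'n) \<Rightarrow> bool" where
  "has_mderivative c d f p D \<longleftrightarrow> p \<in> fst c \<and> f p \<in> fst d \<and>
     (\<forall>\<^sub>F x in nhds (snd c p). f (inv_into (fst c) (snd c) x) \<in> fst d) \<and>
     (in_charts c d f has_derivative D) (at (snd c p))"

text \<open>The definition requires the differential to be Fredholm wherever it exists. A map is therefore
  never non-Fredholm merely for lack of differentiability: failing to be Fredholm means having a
  differential that is not a Fredholm operator.\<close>

definition fredholm_map ::
  "('p, 'm::real_normed_vector) chart set \<Rightarrow> ('q, 'n::real_normed_vector) chart set \<Rightarrow>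
   ('p \<Rightarrow> 'q) \<Rightarrow> bool" where
  "fredholm_map A B f \<longleftrightarrow>
     (\<forall>c\<in>A. \<forall>d\<in>B. \<forall>p D. has_mderivative c d f p D \<longrightarrow> fredholm_operator D)"

section \<open>The $L^2$ metric and its exponential map\<close>

text \<open>$\langle X,Y\rangle(\sigma)=\int_{S^1}\langle X(x),Y(x)\rangle\,dx$ for
  $X(x)=dL_{\sigma(x)}\,\xi(x)$ and $Y(x)=dL_{\sigma(x)}\,\eta(x)$. The chart around
  \<open>\<sigma> x\<close> in which the integrand is computed is irrelevant.\<close>

definition l2_metric ::
  "('g, 'e::euclidean_space) lie_group \<Rightarrow> ('g, 'e) metric \<Rightarrow> ('g, 'e) chart \<Rightarrow>
   (real \<Rightarrow> 'g) \<Rightarrow> 'e h1 \<Rightarrow> 'e h1 \<Rightarrow> real" where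
  "l2_metric G g c \<sigma> \<xi> \<eta> = (LINT x:{0..1}|lborel.
     (let d = (SOME d. d \<in> atlas G \<and> \<sigma> x \<in> fst d);
          L = differential c d (\<lambda>q. \<sigma> x \<otimes>\<^bsub>G\<^esub> q) \<one>\<^bsub>G\<^esub>
      in g d (\<sigma> x) (L (loop_of \<xi> x)) (L (loop_of \<eta> x))))"

text \<open>The Lie algebra of the loop group carries the pointwise bracket.\<close>

definition loop_bracket ::
  "('g, 'e::euclidean_space) lie_group \<Rightarrow> ('g, 'e) chart \<Rightarrow> 'e h1 \<Rightarrow> 'e h1 \<Rightarrow> 'e h1" where
  "loop_bracket G c \<xi> \<eta> = Abs_h1 (\<lambda>x. lie_bracket G c (loop_of \<xi> x) (loop_of \<eta> x))"

text \<open>The Levi-Civita connection $\nabla_XY$ of the $L^2$ metric on left invariant fields, at the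
  constant loop, from the Koszul formula. For a left invariant metric the inner products of left
  invariant fields are constant, so that the derivative terms of the formula vanish. The metric being
  weak, the formula determines the connection at most uniquely; existence is a property of the metric
  at hand.\<close>

definition l2_levi_civita ::
  "('g, 'e::euclidean_space) lie_group \<Rightarrow> ('g, 'e) metric \<Rightarrow> ('g, 'e) chart \<Rightarrow>
   'e h1 \<Rightarrow> 'e h1 \<Rightarrow> 'e h1" where
  "l2_levi_civita G g c \<xi> \<eta> = (THE \<nu>. \<forall>\<theta>.
     2 * l2_metric G g c (constant_loop G) \<nu> \<theta> =
       l2_metric G g c (constant_loop G) (loop_bracket G c \<xi> \<eta>) \<theta>
       - l2_metric G g c (constant_loop G) (loop_bracket G c \<eta> \<theta>) \<xi>
       + l2_metric G g c (constant_loop G) (loop_bracket G c \<theta> \<xi>) \<eta>)"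

text \<open>\<open>\<xi> t\<close> is the velocity of the curve \<open>\<gamma>\<close> at time \<open>t\<close>, translated to the constant loop. In the left
  invariant frame the geodesic equation $\nabla_{\dot\gamma}\dot\gamma=0$ reads
  $\dot\xi+\nabla_\xi\xi=0$.\<close>

definition l2_geodesic ::
  "('g, 'e::euclidean_space) lie_group \<Rightarrow> ('g, 'e) metric \<Rightarrow> ('g, 'e) chart \<Rightarrow>
   (real \<Rightarrow> real \<Rightarrow> 'g) \<Rightarrow> (real \<Rightarrow> 'e h1) \<Rightarrow> bool" where
  "l2_geodesic G g c \<gamma> \<xi> \<longleftrightarrow> (\<forall>t. \<gamma> t \<in> H1_loops G \<and>
     has_mderivative (UNIV, id) (loop_chart G c (\<gamma> t)) \<gamma> t (\<lambda>h. h *\<^sub>R \<xi> t) \<and>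
     (\<xi> has_vector_derivative - l2_levi_civita G g c (\<xi> t) (\<xi> t)) (at t))"

definition l2_exp ::
  "('g, 'e::euclidean_space) lie_group \<Rightarrow> ('g, 'e) metric \<Rightarrow> ('g, 'e) chart \<Rightarrow>
   'e h1 \<Rightarrow> real \<Rightarrow> 'g" where
  "l2_exp G g c X = (THE \<tau>. \<exists>\<gamma> \<xi>. l2_geodesic G g c \<gamma> \<xi> \<and>
     \<gamma> 0 = constant_loop G \<and> \<xi> 0 = X \<and> \<gamma> 1 = \<tau>)"

end

theory Submission
  imports Defs
begin

text \<open>Geodesics of the $L^2$ metric are pointwise geodesics of \<open>G\<close>, so its exponential map is
  $X \mapsto \exp_G \circ X$. At a constant loop \<open>u\<close> its differential is therefore the superposition
  operator $\xi \mapsto A \circ \xi$ with $A = d(\exp_G)_u$; if $A v = 0$ with $v \neq 0$, then the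
  kernel contains all loops $\varphi v$ and is infinite dimensional.

  Such a \<open>u\<close> exists because $\mathrm{ad}\,u_0$ is skew: an eigenvector \<open>w\<close> of $(\mathrm{ad}\,u_0)^2$
  with eigenvalue $-\kappa^2 < 0$ is rotated by $\mathrm{Ad}(\exp_G(t u_0))$ with angular velocity
  $\kappa$, so that $\exp_G u$ with $u = (2\pi/\kappa) u_0$ commutes with all $\exp_G(s w)$. Hence
  $\exp_G$ is constant along the curve $\mathrm{Ad}(\exp_G(s w)) u$, whose velocity $[w, u]$ at $s = 0$
  does not vanish.

  The map $\exp_G$ is obtained without differential equations: squaring, read in a chart
  around the unit, expands by the factor 2, and $\exp_G$ is the map that linearises it.\<close>

section \<open>Maps of class $C^1$ near a point\<close>

text \<open>Class C^1 is the regularity carried through the proof. At a constant loop u the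
  remainder of a superposition operator with kernel function F has weak derivative (F'(Y) - F'(u))
  Y', which is small relative to Y' as soon as F' is continuous, because the sup norm is dominated
  by the H^1 norm. So exp_G only has to be C^1, and the C^0 convergence of its approximants has to
  be raised by a single derivative.

  Two uniqueness principles take the place of the one for differential equations. A curve obeying
  the doubling equation is determined by its velocity at 0 if the error is O(t^2): halving t divides
  such an error by 4, while squaring expands by at most 3; an error o(t) would not be beaten in this
  way. Geodesics of the loop group are merely differentiable and obey no doubling equation a priori.
  For them, beta(t) exp_G(-t X) is shown to have zero velocity and hence to be constant.

  Bi-invariance enters twice through skewness of ad: it removes all terms of the Koszul formula for
  nabla_xi xi, so that geodesics have constant left velocity, and it yields the rotating
  plane.\<close>

lemma has_derivative_eventually_cong:
  assumes "(f has_derivative D) (at x)" "\<forall>\<^sub>F y in nhds x. f y = h y"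
  shows "(h has_derivative D) (at x)"
proof -
  obtain S where "open S" "x \<in> S" "\<And>y. y \<in> S \<Longrightarrow> f y = h y"
    using assms(2) unfolding eventually_nhds by blast
  then show ?thesis using has_derivative_transform_within_open[OF assms(1)] by metis
qed

text \<open>The derivative is a map into bounded operators, so that its continuity is meant in the
  operator norm. Asking for it on a whole neighbourhood makes the property open in \<open>x\<close>
  and allows the mean value inequality around \<open>x\<close>.\<close>

definition C1_at :: "('a::real_normed_vector \<Rightarrow> 'b::real_normed_vector) \<Rightarrow> 'a \<Rightarrow> bool" where
  "C1_at f x \<longleftrightarrow> (\<exists>U f'. open U \<and> x \<in> U \<and>
     (\<forall>y\<in>U. (f has_derivative blinfun_apply (f' y)) (at y)) \<and> continuous_on U f')"

lemma C1_atI: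
  assumes "open U" "x \<in> U" "\<And>y. y \<in> U \<Longrightarrow> (f has_derivative blinfun_apply (f' y)) (at y)"
    and "continuous_on U f'"
  shows "C1_at f x"
  using assms unfolding C1_at_def by blast

lemma C1_at_eventually: "C1_at f x \<Longrightarrow> \<forall>\<^sub>F y in nhds x. C1_at f y"
  unfolding C1_at_def eventually_nhds by blast

lemma C1_at_differentiable: "C1_at f x \<Longrightarrow> f differentiable (at x)"
  unfolding C1_at_def differentiable_def by blast

lemma C1_at_has_derivative: "C1_at f x \<Longrightarrow> (f has_derivative frechet_derivative f (at x)) (at x)"
  using C1_at_differentiable frechet_derivative_works by blast

lemma C1_at_isCont: "C1_at f x \<Longrightarrow> isCont f x"
  using C1_at_has_derivative has_derivative_continuous by blast

lemma isCont_tendsto_nhds: "isCont f x \<Longrightarrow> f x = y \<Longrightarrow> (f \<longlongrightarrow> y) (nhds x)"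
  using tendsto_at_iff_tendsto_nhds[of f x] by (auto simp: isCont_def)

lemma C1_at_tendsto: "C1_at f x \<Longrightarrow> (f \<longlongrightarrow> f x) (nhds x)"
  using C1_at_isCont isCont_tendsto_nhds by blast

lemma C1_at_cong:
  assumes "C1_at f x" "\<forall>\<^sub>F y in nhds x. f y = g y"
  shows "C1_at g x"
proof -
  obtain U f' where U: "open U" "x \<in> U" "\<And>y. y \<in> U \<Longrightarrow> (f has_derivative blinfun_apply (f' y)) (at y)"
    "continuous_on U f'"
    using assms(1) unfolding C1_at_def by blast
  obtain V where V: "open V" "x \<in> V" "\<And>y. y \<in> V \<Longrightarrow> f y = g y"
    using assms(2) unfolding eventually_nhds by blast
  show ?thesis
  proof (rule C1_atI[of "U \<inter> V" x g f'])
    show "(g has_derivative blinfun_apply (f' y)) (at y)" if "y \<in> U \<inter> V" for y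
      using that U V by (intro has_derivative_transform_within_open[OF U(3) V(1)]) auto
  qed (use U V in \<open>auto intro: continuous_on_subset\<close>)
qed

lemma C1_at_compose:
  assumes f: "C1_at f x" and g: "C1_at g (f x)"
  shows "C1_at (\<lambda>y. g (f y)) x"
proof -
  obtain U f' where U: "open U" "x \<in> U" "\<And>y. y \<in> U \<Longrightarrow> (f has_derivative blinfun_apply (f' y)) (at y)"
    "continuous_on U f'"
    using f unfolding C1_at_def by blast
  obtain V g' where V: "open V" "f x \<in> V" "\<And>y. y \<in> V \<Longrightarrow> (g has_derivative blinfun_apply (g' y)) (at y)"
    "continuous_on V g'"
    using g unfolding C1_at_def by blast
  have cf: "continuous_on U f"
    using has_derivative_at_withinI[OF U(3)] by (rule has_derivative_continuous_on)
  let ?W = "U \<inter> f -` V"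
  have oW: "open ?W"
    by (rule continuous_open_preimage[OF cf U(1) V(1)])
  show ?thesis
  proof (rule C1_atI[of ?W x _ "\<lambda>y. g' (f y) o\<^sub>L f' y"])
    show "((\<lambda>y. g (f y)) has_derivative blinfun_apply (g' (f y) o\<^sub>L f' y)) (at y)" if "y \<in> ?W" for y
      using has_derivative_compose[of f "f' y" y UNIV g "g' (f y)"] U(3)[of y] V(3)[of "f y"] that
      by (simp add: o_def blinfun_compose.rep_eq)
    have "continuous_on ?W (\<lambda>y. g' (f y))"
      using cf by (intro continuous_on_compose2[OF V(4)]) (auto intro: continuous_on_subset)
    moreover have "continuous_on ?W f'" using U(4) by (auto intro: continuous_on_subset)
    ultimately show "continuous_on ?W (\<lambda>y. g' (f y) o\<^sub>L f' y)"
      by (rule bounded_bilinear.continuous_on[OF bounded_bilinear_blinfun_compose])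
  qed (use U V oW in auto)
qed

lemma C1_at_bounded_linear:
  assumes "bounded_linear f" shows "C1_at f x"
  using assms by (intro C1_atI[of UNIV x f "\<lambda>_. Blinfun f"])
    (auto simp: bounded_linear_Blinfun_apply intro: bounded_linear_imp_has_derivative)

lemma C1_at_const: "C1_at (\<lambda>_. k) x"
  by (rule C1_atI[of UNIV x _ "\<lambda>_. 0"]) (auto intro!: derivative_eq_intros)

lemma C1_at_ident: "C1_at (\<lambda>y. y) x"
  by (intro C1_at_bounded_linear bounded_linear_ident)

lemma C1_at_Pair:
  assumes f: "C1_at f x" and g: "C1_at g x"
  shows "C1_at (\<lambda>y. (f y, g y)) x"
proof -
  obtain U f' where U: "open U" "x \<in> U" "\<And>y. y \<in> U \<Longrightarrow> (f has_derivative blinfun_apply (f' y)) (at y)"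
    "continuous_on U f'"
    using f unfolding C1_at_def by blast
  obtain V g' where V: "open V" "x \<in> V" "\<And>y. y \<in> V \<Longrightarrow> (g has_derivative blinfun_apply (g' y)) (at y)"
    "continuous_on V g'"
    using g unfolding C1_at_def by blast
  define i1 where "i1 = Blinfun (\<lambda>x::'b. (x, 0::'c))"
  define i2 where "i2 = Blinfun (\<lambda>y::'c. (0::'b, y))"
  have i1: "blinfun_apply i1 = (\<lambda>x. (x, 0))" and i2: "blinfun_apply i2 = (\<lambda>y. (0, y))"
    unfolding i1_def i2_def
    by (intro bounded_linear_Blinfun_apply bounded_linear_intros)+
  show ?thesis
  proof (rule C1_atI[of "U \<inter> V" x _ "\<lambda>y. (i1 o\<^sub>L f' y) + (i2 o\<^sub>L g' y)"])
    show "((\<lambda>y. (f y, g y)) has_derivative blinfun_apply ((i1 o\<^sub>L f' y) + (i2 o\<^sub>L g' y))) (at y)"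
      if "y \<in> U \<inter> V" for y
    proof -
      have "blinfun_apply ((i1 o\<^sub>L f' y) + (i2 o\<^sub>L g' y)) = (\<lambda>h. (f' y h, g' y h))"
        by (auto simp: blinfun.add_left i1 i2)
      then show ?thesis using has_derivative_Pair[OF U(3) V(3), of y] that by auto
    qed
    show "continuous_on (U \<inter> V) (\<lambda>y. (i1 o\<^sub>L f' y) + (i2 o\<^sub>L g' y))"
      using U(4) V(4)
      by (intro continuous_on_add bounded_bilinear.continuous_on[OF bounded_bilinear_blinfun_compose]
          continuous_on_const) (auto intro: continuous_on_subset)
  qed (use U V in auto)
qed

lemma C1_at_isCont_derivative:
  assumes "C1_at f x"
  shows "isCont (\<lambda>y. frechet_derivative f (at y) v) x"
proof -
  obtain U f' where U: "open U" "x \<in> U" "\<And>y. y \<in> U \<Longrightarrow> (f has_derivative blinfun_apply (f' y)) (at y)"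
    "continuous_on U f'"
    using assms unfolding C1_at_def by blast
  have eq: "frechet_derivative f (at y) v = f' y v" if "y \<in> U" for y
    using frechet_derivative_at[OF U(3)[OF that]] by simp
  have "continuous_on U (\<lambda>y. f' y v)"
    using U(4) by (intro continuous_intros)
  then have "continuous_on U (\<lambda>y. frechet_derivative f (at y) v)"
    by (rule continuous_on_eq) (simp add: eq)
  then show ?thesis using U by (simp add: continuous_on_eq_continuous_at)
qed

text \<open>Strict differentiability: the mean value inequality for \<open>f\<close> minus its
  linear part at \<open>x\<close>, on a ball where the derivative varies by at most
  \<open>e\<close>. The increment bound controls values and the \<open>onorm\<close> bound controls
  weak derivatives when \<open>f\<close> is composed with an H^1 loop.\<close>

lemma C1_at_strict:
  assumes "C1_at f x" "e > 0"
  obtains d where "d > 0" "\<And>y. y \<in> ball x d \<Longrightarrow> C1_at f y"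
    "\<And>y. y \<in> ball x d \<Longrightarrow> onorm (\<lambda>h. frechet_derivative f (at y) h - frechet_derivative f (at x) h) \<le> e"
    "\<And>y z. \<lbrakk>y \<in> ball x d; z \<in> ball x d\<rbrakk> \<Longrightarrow>
       norm (f y - f z - frechet_derivative f (at x) (y - z)) \<le> e * norm (y - z)"
proof -
  obtain U f' where U: "open U" "x \<in> U" "\<And>y. y \<in> U \<Longrightarrow> (f has_derivative blinfun_apply (f' y)) (at y)"
    "continuous_on U f'"
    using assms unfolding C1_at_def by blast
  have "isCont f' x" using U by (simp add: continuous_on_eq_continuous_at)
  then obtain d1 where d1: "d1 > 0" "\<And>y. dist y x < d1 \<Longrightarrow> dist (f' y) (f' x) < e"
    using assms(2) unfolding continuous_at_eps_delta by metis
  obtain d2 where d2: "d2 > 0" "ball x d2 \<subseteq> U" using U openE by blast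
  define d where "d = min d1 d2"
  have sub: "ball x d \<subseteq> U" using d2 by (auto simp: d_def)
  have D: "frechet_derivative f (at y) = f' y" if "y \<in> U" for y
    using frechet_derivative_at[OF U(3)[OF that]] by simp
  have on: "onorm (\<lambda>h. f' y h - f' x h) \<le> e" if "y \<in> ball x d" for y
  proof -
    have "onorm (\<lambda>h. f' y h - f' x h) = norm (f' y - f' x)"
      by (simp add: norm_blinfun.rep_eq minus_blinfun.rep_eq)
    also have "\<dots> \<le> e" using d1(2)[of y] that by (simp add: d_def dist_norm norm_minus_commute)
    finally show ?thesis .
  qed
  show thesis
  proof (rule that[of d])
    show "d > 0" using d1 d2 by (simp add: d_def)
    show "C1_at f y" if "y \<in> ball x d" for y
      using that sub U by (intro C1_atI[of U y f f']) auto
    show "onorm (\<lambda>h. frechet_derivative f (at y) h - frechet_derivative f (at x) h) \<le> e" if "y \<in> ball x d" for y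
      using on[OF that] D[of y] D[of x] that sub U(2) by (auto simp: subset_iff)
    show "norm (f y - f z - frechet_derivative f (at x) (y - z)) \<le> e * norm (y - z)"
      if "y \<in> ball x d" "z \<in> ball x d" for y z
    proof -
      have "norm ((f y - f' x y) - (f z - f' x z)) \<le> e * norm (y - z)"
      proof (rule differentiable_bound[of "ball x d" _ "\<lambda>y h. f' y h - f' x h"])
        show "((\<lambda>y. f y - f' x y) has_derivative (\<lambda>h. f' w h - f' x h)) (at w within ball x d)" if "w \<in> ball x d" for w
        proof (intro has_derivative_diff bounded_linear_imp_has_derivative blinfun.bounded_linear_right)
          show "(f has_derivative blinfun_apply (f' w)) (at w within ball x d)"
            using has_derivative_at_withinI[OF U(3)] sub that by blast
        qed
      qed (use that on in auto)
      then show ?thesis using D[OF U(2)] by (simp add: blinfun.diff_right algebra_simps)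
    qed
  qed
qed

lemma C1_at_lipschitz:
  assumes "C1_at f x"
  obtains d K where "d > 0" "K \<ge> 0"
    "\<And>y z. \<lbrakk>y \<in> ball x d; z \<in> ball x d\<rbrakk> \<Longrightarrow> norm (f y - f z) \<le> K * norm (y - z)"
proof -
  obtain d where d: "d > 0" "\<And>y z. \<lbrakk>y \<in> ball x d; z \<in> ball x d\<rbrakk> \<Longrightarrow>
       norm (f y - f z - frechet_derivative f (at x) (y - z)) \<le> 1 * norm (y - z)"
    by (rule C1_at_strict[OF assms zero_less_one]) blast
  let ?L = "frechet_derivative f (at x)"
  have bl: "bounded_linear ?L"
    using C1_at_has_derivative[OF assms] has_derivative_bounded_linear by blast
  show thesis
  proof (rule that[of d "onorm ?L + 1"])
    show "norm (f y - f z) \<le> (onorm ?L + 1) * norm (y - z)" if "y \<in> ball x d" "z \<in> ball x d" for y z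
      using d(2)[OF that] onorm[OF bl, of "y - z"] norm_triangle_sub[of "f y - f z" "?L (y - z)"]
      by (simp add: algebra_simps)
  qed (use d onorm_pos_le[OF bl] in auto)
qed

text \<open>In finite dimension, continuity of each directional derivative already gives continuity
  in the operator norm.\<close>

lemma Ck_on_1_C1_at:
  fixes f :: "'a::euclidean_space \<Rightarrow> 'b::real_normed_vector"
  assumes "open S" "Ck_on (Suc 0) S f" "x \<in> S"
  shows "C1_at f x"
proof (rule C1_atI[OF assms(1,3)])
  let ?f' = "\<lambda>y. Blinfun (frechet_derivative f (at y))"
  have d: "(f has_derivative frechet_derivative f (at y)) (at y)" if "y \<in> S" for y
    using assms(2) that frechet_derivative_works by auto
  have ap: "blinfun_apply (?f' y) = frechet_derivative f (at y)" if "y \<in> S" for y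
    using d[OF that] has_derivative_bounded_linear bounded_linear_Blinfun_apply by blast
  show "(f has_derivative blinfun_apply (?f' y)) (at y)" if "y \<in> S" for y
    using d ap that by simp
  show "continuous_on S ?f'"
  proof (rule continuous_on_blinfun_componentwise)
    fix i :: 'a
    have "continuous_on S (\<lambda>y. frechet_derivative f (at y) i)" using assms(2) by simp
    then show "continuous_on S (\<lambda>y. blinfun_apply (?f' y) i)"
      by (rule continuous_on_eq) (simp add: ap)
  qed
qed

lemma smooth_on_C1_at: "\<lbrakk>open S; smooth_on S f; x \<in> S\<rbrakk> \<Longrightarrow> C1_at f x"
  unfolding smooth_on_def by (blast intro: Ck_on_1_C1_at)

lemma smooth_on_derivative_C1_at:
  assumes "open S" "smooth_on S f" "x \<in> S"
  shows "C1_at (\<lambda>y. frechet_derivative f (at y) v) x"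
proof -
  have "Ck_on (Suc (Suc 0)) S f" using assms(2) unfolding smooth_on_def by blast
  then show ?thesis by (intro Ck_on_1_C1_at[OF assms(1) _ assms(3)]) (unfold Ck_on.simps(2), blast)
qed

text \<open>Each directional derivative along a basis vector is C^1 and hence locally Lipschitz; the
  operator norm is at most the sum over the basis. This supplies the quadratic estimates for
  multiplication read in a chart.\<close>

lemma smooth_on_lipschitz_derivative:
  fixes f :: "'a::euclidean_space \<Rightarrow> 'b::real_normed_vector"
  assumes "open S" "smooth_on S f" "x \<in> S"
  obtains r K f' where "r > 0" "K \<ge> 0" "ball x r \<subseteq> S"
    "\<And>y. y \<in> ball x r \<Longrightarrow> (f has_derivative blinfun_apply (f' y)) (at y)"
    "\<And>y z. \<lbrakk>y \<in> ball x r; z \<in> ball x r\<rbrakk> \<Longrightarrow> norm (f' y - f' z) \<le> K * norm (y - z)"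
proof -
  let ?D = "\<lambda>y. frechet_derivative f (at y)"
  have "\<exists>d K. d > 0 \<and> K \<ge> 0 \<and> (\<forall>y\<in>ball x d. \<forall>z\<in>ball x d. norm (?D y i - ?D z i) \<le> K * norm (y - z))" for i
    by (rule C1_at_lipschitz[OF smooth_on_derivative_C1_at[OF assms, of i]]) blast
  then obtain d K where dK: "\<And>i. d i > 0" "\<And>i. K i \<ge> 0"
    "\<And>i y z. \<lbrakk>y\<in>ball x (d i); z\<in>ball x (d i)\<rbrakk> \<Longrightarrow> norm (?D y i - ?D z i) \<le> K i * norm (y - z)"
    by metis
  obtain r0 where r0: "r0 > 0" "ball x r0 \<subseteq> S" using assms openE by blast
  define r where "r = Min (insert r0 (d ` Basis))"
  have r: "r > 0" "r \<le> r0" "\<And>i. i \<in> Basis \<Longrightarrow> r \<le> d i"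
  proof -
    have fin: "finite (insert r0 (d ` Basis))" by simp
    show "r > 0" using dK r0 by (simp add: r_def)
    show "r \<le> r0" "\<And>i. i \<in> Basis \<Longrightarrow> r \<le> d i"
      unfolding r_def by (rule Min_le[OF fin], simp)+
  qed
  let ?f' = "\<lambda>y. Blinfun (?D y)"
  have dd: "(f has_derivative ?D y) (at y)" if "y \<in> S" for y
    using C1_at_has_derivative[OF smooth_on_C1_at[OF assms(1,2) that]] .
  have ap: "blinfun_apply (?f' y) = ?D y" if "y \<in> S" for y
    using dd[OF that] has_derivative_bounded_linear bounded_linear_Blinfun_apply by blast
  show thesis
  proof (rule that[of r "\<Sum>i\<in>Basis. K i" ?f'])
    show "(\<Sum>i\<in>Basis. K i) \<ge> 0" using dK by (simp add: sum_nonneg)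
    show rS: "ball x r \<subseteq> S" using r r0 by auto
    show "(f has_derivative blinfun_apply (?f' y)) (at y)" if "y \<in> ball x r" for y
      using that rS dd ap by (metis subset_iff)
    show "norm (?f' y - ?f' z) \<le> (\<Sum>i\<in>Basis. K i) * norm (y - z)" if yz: "y \<in> ball x r" "z \<in> ball x r" for y z
    proof -
      have "norm (?f' y - ?f' z) \<le> (\<Sum>i\<in>Basis. norm ((?f' y - ?f' z) i))"
        by (rule norm_blinfun_euclidean_le)
      also have "\<dots> \<le> (\<Sum>i\<in>Basis. K i * norm (y - z))"
      proof (rule sum_mono)
        fix i :: 'a assume "i \<in> Basis"
        then have "y \<in> ball x (d i)" "z \<in> ball x (d i)" using yz r(3)[of i] by auto
        moreover have "y \<in> S" "z \<in> S" using yz rS by auto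
        ultimately show "norm ((?f' y - ?f' z) i) \<le> K i * norm (y - z)"
          using dK(3) by (simp add: blinfun.diff_left ap)
      qed
      finally show ?thesis by (simp add: sum_distrib_right)
    qed
  qed (use r in auto)
qed

lemma onorm_scaleR_le:
  assumes "norm w \<le> b" shows "onorm (\<lambda>h::real. h *\<^sub>R w) \<le> b"
proof (rule onorm_bound)
  show "0 \<le> b" using assms norm_ge_zero order_trans by blast
  show "norm (h *\<^sub>R w) \<le> b * norm h" for h :: real
    using mult_left_mono[OF assms, of "\<bar>h\<bar>"] by (simp add: mult.commute)
qed

text \<open>The second difference of \<open>f\<close> over the parallelogram with sides
  \<open>t *\<^sub>R u\<close> and \<open>t *\<^sub>R v\<close> does not change when
  \<open>u\<close> and \<open>v\<close> are exchanged, and divided by t^2 it tends to the iterated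
  derivative in either order. The Lie bracket needs this to express left and right invariant fields
  by one bilinear map.\<close>

lemma smooth_on_second_derivative_symmetric:
  fixes f :: "'a::euclidean_space \<Rightarrow> 'b::real_normed_vector"
  assumes "open S" "smooth_on S f" "z \<in> S"
  shows "frechet_derivative (\<lambda>x. frechet_derivative f (at x) u) (at z) v =
         frechet_derivative (\<lambda>x. frechet_derivative f (at x) v) (at z) u"
proof -
  let ?D = "\<lambda>w x. frechet_derivative f (at x) w"
  let ?D2 = "\<lambda>u v. frechet_derivative (?D u) (at z) v"
  have key: "\<exists>d>0. \<forall>t. 0 < t \<and> t < d \<longrightarrow>
      norm (f (z + t *\<^sub>R u + t *\<^sub>R v) - f (z + t *\<^sub>R v) - f (z + t *\<^sub>R u) + f z - (t*t) *\<^sub>R ?D2 u v)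
        \<le> e * (t * t) * norm v" if e: "e > 0" for e u v
  proof -
    obtain d0 where d0: "d0 > 0" "\<And>y w. \<lbrakk>y \<in> ball z d0; w \<in> ball z d0\<rbrakk> \<Longrightarrow>
       norm (?D u y - ?D u w - ?D2 u (y - w)) \<le> e * norm (y - w)"
      by (rule C1_at_strict[OF smooth_on_derivative_C1_at[OF assms, of u] e]) blast
    obtain r0 where r0: "r0 > 0" "ball z r0 \<subseteq> S" using assms openE by blast
    \<comment> \<open>Small enough that every corner and side of the parallelogram lies in both
      balls; the summand 1 covers \<open>u = v = 0\<close>.\<close>
    define d where "d = min d0 r0 / (norm u + norm v + 1)"
    have pos: "norm u + norm v + 1 > 0" by (smt (verit) norm_ge_zero)
    have dpos: "d > 0" using d0 r0 pos by (simp add: d_def)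
    have in_ball: "z + s *\<^sub>R u + t *\<^sub>R v \<in> ball z d0 \<inter> S" if "0 \<le> s" "s < d" "0 \<le> t" "t < d" for s t
    proof -
      have "norm (s *\<^sub>R u + t *\<^sub>R v) \<le> s * norm u + t * norm v"
        using norm_triangle_ineq[of "s *\<^sub>R u" "t *\<^sub>R v"] that by simp
      also have "\<dots> \<le> d * norm u + d * norm v"
        using that by (intro add_mono mult_right_mono) auto
      also have "\<dots> < d * (norm u + norm v + 1)" using dpos by (simp add: algebra_simps)
      also have "\<dots> = min d0 r0" using pos by (simp add: d_def)
      finally have "dist z (z + s *\<^sub>R u + t *\<^sub>R v) < min d0 r0"
        by (metis add.assoc add_diff_cancel_left' dist_commute dist_norm)
      then show ?thesis using r0 by auto
    qed
    have D: "(f has_derivative (\<lambda>h. ?D h y)) (at y)" if "y \<in> S" for y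
      using C1_at_has_derivative[OF smooth_on_C1_at[OF assms(1,2) that]] .
    have lin2: "linear (\<lambda>v. ?D2 u v)"
      using C1_at_has_derivative[OF smooth_on_derivative_C1_at[OF assms, of u]] has_derivative_linear by blast
    have "norm (f (z + t *\<^sub>R u + t *\<^sub>R v) - f (z + t *\<^sub>R v) - f (z + t *\<^sub>R u) + f z - (t*t) *\<^sub>R ?D2 u v)
        \<le> e * (t * t) * norm v" if t: "0 < t" "t < d" for t
    proof -
      \<comment> \<open>The error of the second difference with the side along \<open>u\<close>
        shortened to \<open>s\<close>. Its derivative in \<open>s\<close> is a first difference of a
        C^1 function minus its linear part, so the mean value inequality finishes.\<close>
      define p where "p s = f (z + s *\<^sub>R u + t *\<^sub>R v) - f (z + s *\<^sub>R u + 0 *\<^sub>R v) - s *\<^sub>R (t *\<^sub>R ?D2 u v)" for s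
      have "norm (p t - p 0) \<le> (e * t * norm v) * norm (t - 0)"
      proof (rule differentiable_bound[of "{0..t}" p "\<lambda>s h. h *\<^sub>R (?D u (z + s *\<^sub>R u + t *\<^sub>R v) - ?D u (z + s *\<^sub>R u + 0 *\<^sub>R v) - t *\<^sub>R ?D2 u v)"])
        fix s assume s: "s \<in> {0..t}"
        have 1: "((\<lambda>s. f (z + s *\<^sub>R u + k *\<^sub>R v)) has_derivative (\<lambda>h. h *\<^sub>R ?D u (z + s *\<^sub>R u + k *\<^sub>R v))) (at s within {0..t})"
          if "z + s *\<^sub>R u + k *\<^sub>R v \<in> S" for k
        proof -
          have "((\<lambda>s. z + s *\<^sub>R u + k *\<^sub>R v) has_derivative (\<lambda>h. h *\<^sub>R u)) (at s within {0..t})"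
            by (auto intro!: derivative_eq_intros)
          from has_derivative_compose[OF this D[OF that]]
          show ?thesis
            using linear_scale[OF has_derivative_linear[OF D[OF that]]] by simp
        qed
        show "(p has_derivative (\<lambda>h. h *\<^sub>R (?D u (z + s *\<^sub>R u + t *\<^sub>R v) - ?D u (z + s *\<^sub>R u + 0 *\<^sub>R v) - t *\<^sub>R ?D2 u v))) (at s within {0..t})"
          unfolding p_def scaleR_diff_right
          using 1[of t] 1[of 0] in_ball[of s t] in_ball[of s 0] s t
          by (intro has_derivative_diff has_derivative_scaleR_left has_derivative_ident) auto
        have "norm (?D u (z + s *\<^sub>R u + t *\<^sub>R v) - ?D u (z + s *\<^sub>R u + 0 *\<^sub>R v) - t *\<^sub>R ?D2 u v) \<le> e * (t * norm v)"
          using d0(2)[of "z + s *\<^sub>R u + t *\<^sub>R v" "z + s *\<^sub>R u + 0 *\<^sub>R v"] in_ball[of s t] in_ball[of s 0] s t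
          by (simp add: linear_scale[OF lin2])
        then show "onorm (\<lambda>h. h *\<^sub>R (?D u (z + s *\<^sub>R u + t *\<^sub>R v) - ?D u (z + s *\<^sub>R u + 0 *\<^sub>R v) - t *\<^sub>R ?D2 u v)) \<le> e * t * norm v"
          unfolding mult.assoc by (rule onorm_scaleR_le)
      qed (use t in auto)
      then show ?thesis using t by (simp add: p_def algebra_simps)
    qed
    then show ?thesis using dpos by blast
  qed
  have "norm (?D2 u v - ?D2 v u) \<le> 0"
  proof (rule field_le_epsilon)
    fix e0 :: real assume "e0 > 0"
    define e where "e = e0 / (norm u + norm v + 1)"
    have pos: "norm u + norm v + 1 > 0" by (smt (verit) norm_ge_zero)
    then have e: "e > 0" using \<open>e0 > 0\<close> by (simp add: e_def)
    obtain d1 where d1: "d1 > 0" "\<And>t. 0 < t \<Longrightarrow> t < d1 \<Longrightarrow>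
      norm (f (z + t *\<^sub>R u + t *\<^sub>R v) - f (z + t *\<^sub>R v) - f (z + t *\<^sub>R u) + f z - (t*t) *\<^sub>R ?D2 u v) \<le> e * (t * t) * norm v"
      using key[OF e, of u v] by blast
    obtain d2 where d2: "d2 > 0" "\<And>t. 0 < t \<Longrightarrow> t < d2 \<Longrightarrow>
      norm (f (z + t *\<^sub>R v + t *\<^sub>R u) - f (z + t *\<^sub>R u) - f (z + t *\<^sub>R v) + f z - (t*t) *\<^sub>R ?D2 v u) \<le> e * (t * t) * norm u"
      using key[OF e, of v u] by blast
    define t where "t = min d1 d2 / 2"
    have t: "0 < t" "t < d1" "t < d2" using d1 d2 by (auto simp: t_def)
    let ?\<Delta> = "f (z + t *\<^sub>R u + t *\<^sub>R v) - f (z + t *\<^sub>R v) - f (z + t *\<^sub>R u) + f z"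
    have sw: "f (z + t *\<^sub>R v + t *\<^sub>R u) - f (z + t *\<^sub>R u) - f (z + t *\<^sub>R v) + f z = ?\<Delta>"
      by (simp add: algebra_simps)
    have "norm ((t*t) *\<^sub>R (?D2 u v - ?D2 v u)) = norm ((?\<Delta> - (t*t) *\<^sub>R ?D2 v u) - (?\<Delta> - (t*t) *\<^sub>R ?D2 u v))"
      by (simp add: algebra_simps)
    also have "\<dots> \<le> e * (t*t) * norm u + e * (t*t) * norm v"
      using norm_triangle_ineq4[of "?\<Delta> - (t*t) *\<^sub>R ?D2 v u" "?\<Delta> - (t*t) *\<^sub>R ?D2 u v"]
        d1(2)[of t] d2(2)[of t] t unfolding sw by linarith
    also have "\<dots> = (t*t) * (e * (norm u + norm v))" by (simp add: algebra_simps)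
    finally have "(t*t) * norm (?D2 u v - ?D2 v u) \<le> (t*t) * (e * (norm u + norm v))"
      using t by (simp only: norm_scaleR) simp
    then have "norm (?D2 u v - ?D2 v u) \<le> e * (norm u + norm v)" using t by simp
    also have "\<dots> \<le> e0" using e pos by (simp add: e_def field_simps)
    finally show "norm (?D2 u v - ?D2 v u) \<le> 0 + e0" by simp
  qed
  then show ?thesis by simp
qed

section \<open>Linearisation of an expanding map\<close>

lemma geometric_tendsto_0: "(\<lambda>n. c * (3/4)^n) \<longlonglongrightarrow> (0::real)"
  by (auto intro!: tendsto_mult_right_zero LIMSEQ_power_zero)

lemma norm_fst_snd_le: "norm (fst z) \<le> norm z" "norm (snd z) \<le> norm z"
  by (metis norm_fst_le prod.collapse) (metis norm_snd_le prod.collapse)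

text \<open>The factor 3 is any bound below 4: an error quadratic in z shrinks by 4 when z is
  halved, which leaves the ratio 3/4. The conditions on \<open>\<rho>\<close> keep the approximants
  within twice the norm of z and therefore inside the ball of radius \<open>r\<close>.\<close>

locale expanding_map =
  fixes T :: "'a::euclidean_space \<Rightarrow> 'a" and K r \<rho> :: real
  assumes K: "0 \<le> K" and rho: "0 < \<rho>" "2 * \<rho> \<le> r" "2 * K * \<rho> \<le> 1"
    and quad: "\<And>z. norm z < r \<Longrightarrow> norm (T z - 2 *\<^sub>R z) \<le> K * (norm z)\<^sup>2"
    and lip: "\<And>z w. norm z < r \<Longrightarrow> norm w < r \<Longrightarrow> norm (T z - T w) \<le> 3 * norm (z - w)"
begin

text \<open>Koenigs linearisation, read backwards: the limit conjugates multiplication by 2 to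
  \<open>T\<close>. For squaring in a Lie group this is the 2^n-th power of the point with
  coordinate z / 2^n, the analogue of (1 + z/m)^m.\<close>

definition iter :: "nat \<Rightarrow> 'a \<Rightarrow> 'a" where
  "iter n z = (T ^^ n) ((1/2) ^ n *\<^sub>R z)"

definition linz :: "'a \<Rightarrow> 'a" where
  "linz z = lim (\<lambda>n. iter n z)"

lemma iter_0: "iter 0 z = z"
  by (simp add: iter_def)

lemma iter_Suc: "iter (Suc n) z = T (iter n ((1/2) *\<^sub>R z))"
  by (simp add: iter_def mult.commute)

text \<open>The constant 2K is the fixed point of the recursion: one application of \<open>T\<close>
  adds K, and doubling the error at z/2 contributes 2 (2K/4). Both bounds run in one induction,
  since the norm bound at z/2 is what makes \<open>quad\<close> applicable.\<close>

lemma iter_near: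
  assumes "norm z < \<rho>"
  shows "norm (iter n z - z) \<le> 2 * K * (norm z)\<^sup>2 \<and> norm (iter n z) \<le> 2 * norm z"
  using assms
proof (induction n arbitrary: z)
  case 0 then show ?case using K by (simp add: iter_0)
next
  case (Suc n)
  define y where "y = iter n ((1/2) *\<^sub>R z)"
  have h: "norm ((1/2) *\<^sub>R z) < \<rho>" using Suc.prems rho by simp
  have y: "norm (y - (1/2) *\<^sub>R z) \<le> 2 * K * (norm z / 2)\<^sup>2" "norm y \<le> norm z"
    using Suc.IH[OF h] by (auto simp: y_def)
  have yr: "norm y < r" using y(2) Suc.prems rho by linarith
  have "iter (Suc n) z - z = (T y - 2 *\<^sub>R y) + 2 *\<^sub>R (y - (1/2) *\<^sub>R z)"
    by (simp add: iter_Suc y_def algebra_simps)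
  then have "norm (iter (Suc n) z - z) \<le> norm (T y - 2 *\<^sub>R y) + norm (2 *\<^sub>R (y - (1/2) *\<^sub>R z))"
    using norm_triangle_ineq by metis
  also have "\<dots> \<le> K * (norm y)\<^sup>2 + 2 * (2 * K * (norm z / 2)\<^sup>2)"
    using quad[OF yr] y(1) by simp
  also have "\<dots> \<le> K * (norm z)\<^sup>2 + 2 * (2 * K * (norm z / 2)\<^sup>2)"
    using y(2) K by (intro add_mono mult_left_mono power_mono) auto
  also have "\<dots> = 2 * K * (norm z)\<^sup>2" by (simp add: power2_eq_square)
  finally have 1: "norm (iter (Suc n) z - z) \<le> 2 * K * (norm z)\<^sup>2" .
  have "2 * K * norm z * norm z \<le> 1 * norm z"
  proof (rule mult_right_mono)
    have "2 * K * norm z \<le> 2 * K * \<rho>" using Suc.prems K by (intro mult_left_mono) auto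
    then show "2 * K * norm z \<le> 1" using rho by linarith
  qed simp
  then have "norm (iter (Suc n) z) \<le> 2 * norm z"
    using 1 norm_triangle_sub[of "iter (Suc n) z" z] by (simp add: power2_eq_square)
  with 1 show ?case by blast
qed

lemma iter_in_ball: "norm z < \<rho> \<Longrightarrow> norm (iter n z) < r"
  using iter_near[of z n] rho by auto

text \<open>Passing to z/2 divides the quadratic bound by 4 and \<open>T\<close> multiplies it by at
  most 3, hence the ratio 3/4.\<close>

lemma iter_step:
  assumes "norm z < \<rho>"
  shows "norm (iter (Suc n) z - iter n z) \<le> (3/4)^n * (2 * K * (norm z)\<^sup>2)"
  using assms
proof (induction n arbitrary: z)
  case 0 then show ?case using iter_near[of z "Suc 0"] by (simp add: iter_0)
next
  case (Suc n)
  let ?h = "(1/2) *\<^sub>R z"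
  have h: "norm ?h < \<rho>" using Suc.prems rho by simp
  have "norm (iter (Suc (Suc n)) z - iter (Suc n) z) \<le> 3 * norm (iter (Suc n) ?h - iter n ?h)"
    unfolding iter_Suc[of "Suc n" z] iter_Suc[of n z] by (intro lip iter_in_ball h)
  also have "\<dots> \<le> 3 * ((3/4)^n * (2 * K * (norm ?h)\<^sup>2))"
    using Suc.IH[OF h] by (intro mult_left_mono) auto
  also have "\<dots> = (3/4)^Suc n * (2 * K * (norm z)\<^sup>2)"
    by (simp add: power2_eq_square)
  finally show ?case .
qed

text \<open>The partial geometric sum in closed form, with 8K = 2K / (1 - 3/4); keeping the
  subtracted power lets the induction on \<open>k\<close> close.\<close>

lemma iter_diff:
  assumes "norm z < \<rho>"
  shows "norm (iter (n + k) z - iter n z) \<le> 8 * K * (norm z)\<^sup>2 * ((3/4)^n - (3/4)^(n+k))"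
proof (induction k)
  case (Suc k)
  have "norm (iter (n + Suc k) z - iter n z) \<le> norm (iter (Suc (n+k)) z - iter (n+k) z) + norm (iter (n+k) z - iter n z)"
    using norm_triangle_ineq[of "iter (Suc (n+k)) z - iter (n+k) z" "iter (n+k) z - iter n z"] by simp
  also have "\<dots> \<le> (3/4)^(n+k) * (2 * K * (norm z)\<^sup>2) + 8 * K * (norm z)\<^sup>2 * ((3/4)^n - (3/4)^(n+k))"
    using iter_step[OF assms, of "n+k"] Suc by simp
  also have "\<dots> = 8 * K * (norm z)\<^sup>2 * ((3/4)^n - (3/4)^(n + Suc k))"
    by (simp add: algebra_simps)
  finally show ?case .
qed simp

lemma iter_diff_le:
  assumes "norm z < \<rho>" "n \<le> m"
  shows "norm (iter m z - iter n z) \<le> 8 * K * (norm z)\<^sup>2 * (3/4)^n"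
proof -
  have "norm (iter (n + (m - n)) z - iter n z) \<le> 8 * K * (norm z)\<^sup>2 * ((3/4)^n - (3/4)^(n+(m-n)))"
    by (rule iter_diff[OF assms(1)])
  also have "\<dots> \<le> 8 * K * (norm z)\<^sup>2 * (3/4)^n"
    using K by (intro mult_left_mono) auto
  finally show ?thesis using assms(2) by simp
qed

lemma iter_tendsto:
  assumes z: "norm z < \<rho>"
  shows "(\<lambda>n. iter n z) \<longlonglongrightarrow> linz z"
proof -
  have "Cauchy (\<lambda>n. iter n z)"
  proof (rule metric_CauchyI)
    fix e :: real assume "e > 0"
    have "\<forall>\<^sub>F n in sequentially. 8 * K * (norm z)\<^sup>2 * (3/4)^n < e/2"
      by (rule order_tendstoD(2)[OF geometric_tendsto_0]) (use \<open>e > 0\<close> in simp)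
    then obtain N where N: "8 * K * (norm z)\<^sup>2 * (3/4)^N < e/2"
      unfolding eventually_sequentially by blast
    have "dist (iter m z) (iter N z) < e/2" if "m \<ge> N" for m
      using iter_diff_le[OF z that] N by (simp add: dist_norm)
    then have "\<forall>m\<ge>N. \<forall>n\<ge>N. dist (iter m z) (iter n z) < e"
      by (metis dist_triangle_half_l)
    then show "\<exists>M. \<forall>m\<ge>M. \<forall>n\<ge>M. dist (iter m z) (iter n z) < e" by blast
  qed
  then show ?thesis
    unfolding linz_def by (simp add: Cauchy_convergent convergent_LIMSEQ_iff[symmetric])
qed

lemma iter_linz_le:
  assumes z: "norm z < \<rho>"
  shows "norm (iter n z - linz z) \<le> 8 * K * (norm z)\<^sup>2 * (3/4)^n"
proof -
  have "(\<lambda>m. norm (iter m z - iter n z)) \<longlonglongrightarrow> norm (linz z - iter n z)"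
    by (intro tendsto_intros iter_tendsto z)
  then have "norm (linz z - iter n z) \<le> 8 * K * (norm z)\<^sup>2 * (3/4)^n"
    by (rule Lim_bounded) (use iter_diff_le[OF z] in auto)
  then show ?thesis by (simp add: norm_minus_commute)
qed

lemma linz_near:
  assumes z: "norm z < \<rho>"
  shows "norm (linz z - z) \<le> 2 * K * (norm z)\<^sup>2" "norm (linz z) \<le> 2 * norm z" "norm (linz z) < r"
proof -
  have "(\<lambda>m. norm (iter m z - z)) \<longlonglongrightarrow> norm (linz z - z)"
    by (intro tendsto_intros iter_tendsto z)
  then show "norm (linz z - z) \<le> 2 * K * (norm z)\<^sup>2"
    by (rule Lim_bounded) (use iter_near[OF z] in auto)
  have "(\<lambda>m. norm (iter m z)) \<longlonglongrightarrow> norm (linz z)"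
    by (intro tendsto_intros iter_tendsto z)
  then show 2: "norm (linz z) \<le> 2 * norm z"
    by (rule Lim_bounded) (use iter_near[OF z] in auto)
  show "norm (linz z) < r" using 2 z rho by linarith
qed

lemma continuous_T: "continuous_on (ball 0 r) T"
proof (rule lipschitz_on_continuous_on[of 3])
  show "3-lipschitz_on (ball 0 r) T"
    using lip by (intro lipschitz_onI) (auto simp: dist_norm)
qed

lemma linz_double:
  assumes z: "norm z < \<rho>"
  shows "linz z = T (linz ((1/2) *\<^sub>R z))"
proof (rule LIMSEQ_unique)
  have h: "norm ((1/2) *\<^sub>R z) < \<rho>" using z rho by simp
  show "(\<lambda>n. iter (Suc n) z) \<longlonglongrightarrow> linz z"
    using iter_tendsto[OF z] LIMSEQ_Suc by blast
  have "(\<lambda>n. T (iter n ((1/2) *\<^sub>R z))) \<longlonglongrightarrow> T (linz ((1/2) *\<^sub>R z))"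
    using linz_near(3)[OF h] iter_in_ball[OF h]
    by (intro continuous_on_tendsto_compose[OF continuous_T] iter_tendsto h) auto
  then show "(\<lambda>n. iter (Suc n) z) \<longlonglongrightarrow> T (linz ((1/2) *\<^sub>R z))"
    by (simp add: iter_Suc)
qed

lemma continuous_iter: "continuous_on (ball 0 \<rho>) (iter n)"
proof (induction n)
  case 0 show ?case unfolding iter_0 by (rule continuous_on_id)
next
  case (Suc n)
  have "continuous_on (ball 0 \<rho>) (\<lambda>z. iter n ((1/2) *\<^sub>R z))"
    using rho by (intro continuous_on_compose2[OF Suc] continuous_intros) auto
  then show ?case unfolding iter_Suc
    using iter_in_ball rho by (intro continuous_on_compose2[OF continuous_T]) auto
qed

lemma continuous_linz: "continuous_on (ball 0 \<rho>) linz"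
proof (rule uniform_limit_theorem)
  show "uniform_limit (ball 0 \<rho>) iter linz sequentially"
  proof (rule uniform_limitI)
    fix e :: real assume "e > 0"
    have "\<forall>\<^sub>F n in sequentially. 8 * K * \<rho>\<^sup>2 * (3/4)^n < e"
      by (rule order_tendstoD(2)[OF geometric_tendsto_0 \<open>e > 0\<close>])
    then show "\<forall>\<^sub>F n in sequentially. \<forall>x\<in>ball 0 \<rho>. dist (iter n x) (linz x) < e"
    proof eventually_elim
      case (elim n)
      show ?case
      proof
        fix x :: 'a assume x: "x \<in> ball 0 \<rho>"
        have "norm (iter n x - linz x) \<le> 8 * K * (norm x)\<^sup>2 * (3/4)^n"
          using x by (intro iter_linz_le) auto
        also have "\<dots> \<le> 8 * K * \<rho>\<^sup>2 * (3/4)^n"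
          using x K by (intro mult_right_mono mult_left_mono power_mono) auto
        finally show "dist (iter n x) (linz x) < e" using elim by (simp add: dist_norm)
      qed
    qed
  qed
qed (auto simp: continuous_iter)

text \<open>A curve doubled by \<open>T\<close> is determined by its velocity at \<open>0\<close>, since the difference of two
  such curves is of second order while \<open>T\<close> expands by less than \<open>4\<close>.\<close>

lemma linz_unique:
  fixes y :: "real \<Rightarrow> 'a"
  assumes eps: "0 < \<epsilon>"
    and yr: "\<And>t. \<bar>t\<bar> < \<epsilon> \<Longrightarrow> norm (y t) < r"
    and dbl: "\<And>t. \<bar>t\<bar> < \<epsilon> \<Longrightarrow> y t = T (y (t/2))"
    and near: "\<And>t. \<bar>t\<bar> < \<epsilon> \<Longrightarrow> norm (y t - t *\<^sub>R X) \<le> C * t\<^sup>2"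
    and t: "\<bar>t\<bar> < \<epsilon>" "norm (t *\<^sub>R X) < \<rho>"
  shows "y t = linz (t *\<^sub>R X)"
proof -
  \<comment> \<open>The quadratic error of \<open>y\<close> plus that of \<open>linz\<close>, the
    latter from \<open>linz_near\<close>.\<close>
  define C' where "C' = C + 2 * K * (norm X)\<^sup>2"
  have d: "norm (y t - linz (t *\<^sub>R X)) \<le> (3/4)^n * (C' * t\<^sup>2)"
    if "\<bar>t\<bar> < \<epsilon>" "norm (t *\<^sub>R X) < \<rho>" for t n
    using that
  proof (induction n arbitrary: t)
    case 0
    have "norm (y t - linz (t *\<^sub>R X)) \<le> norm (y t - t *\<^sub>R X) + norm (linz (t *\<^sub>R X) - t *\<^sub>R X)"
      using norm_triangle_ineq4[of "y t - t *\<^sub>R X" "linz (t *\<^sub>R X) - t *\<^sub>R X"] by simp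
    also have "\<dots> \<le> C * t\<^sup>2 + 2 * K * (norm (t *\<^sub>R X))\<^sup>2"
      by (intro add_mono near linz_near(1) 0)
    finally show ?case by (simp add: C'_def algebra_simps power_mult_distrib)
  next
    case (Suc n)
    have h: "\<bar>t/2\<bar> < \<epsilon>" "norm ((t/2) *\<^sub>R X) < \<rho>" using Suc.prems rho by auto
    have e: "(1/2) *\<^sub>R (t *\<^sub>R X) = (t/2) *\<^sub>R X" by simp
    have "norm (y t - linz (t *\<^sub>R X)) \<le> 3 * norm (y (t/2) - linz ((t/2) *\<^sub>R X))"
      unfolding linz_double[OF Suc.prems(2)] e dbl[OF Suc.prems(1)]
      by (intro lip yr h linz_near(3))
    also have "\<dots> \<le> 3 * ((3/4)^n * (C' * (t/2)\<^sup>2))" using Suc.IH[OF h] by simp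
    also have "\<dots> = (3/4)^Suc n * (C' * t\<^sup>2)" by (simp add: power2_eq_square)
    finally show ?case .
  qed
  have "(\<lambda>n. (3/4)^n * (C' * t\<^sup>2)) \<longlonglongrightarrow> 0"
    using geometric_tendsto_0[of "C' * t\<^sup>2"] by (simp add: mult.commute)
  then have "norm (y t - linz (t *\<^sub>R X)) \<le> 0"
    using d[OF t] by (intro LIMSEQ_le_const) auto
  then show ?thesis by simp
qed

lemma linz_0: "linz 0 = 0"
  using linz_near(2)[of 0] rho by simp

lemma linz_has_derivative_0: "(linz has_derivative (\<lambda>h. h)) (at 0)"
proof (rule has_derivativeI_sandwich[of \<rho>])
  show "norm (linz y - linz 0 - (y - 0)) / norm (y - 0) \<le> 2 * K * norm y"
    if "y \<noteq> 0" "dist y 0 < \<rho>" for y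
    using linz_near(1)[of y] that by (simp add: linz_0 power2_eq_square divide_le_eq)
  show "((\<lambda>y. 2 * K * norm y) \<longlongrightarrow> 0) (at 0)"
    by (auto intro!: tendsto_eq_intros)
qed (use rho in auto)

end

text \<open>The derivatives of the iterates are the iterates of the tangent map of \<open>T\<close>, so that the
  convergence of the linearisation in $C^0$, applied to the tangent map, gives its convergence in
  $C^1$.\<close>

locale smooth_expanding_map =
  fixes T :: "'a::euclidean_space \<Rightarrow> 'a" and T' :: "'a \<Rightarrow> 'a \<Rightarrow>\<^sub>L 'a" and M R :: real
  assumes M: "0 \<le> M" and R: "0 < R" "3 * M * R \<le> 1"
    and T0: "T 0 = 0" and T'0: "\<And>v. T' 0 v = 2 *\<^sub>R v"
    and deriv: "\<And>x. norm x < R \<Longrightarrow> (T has_derivative T' x) (at x)"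
    and deriv_lip: "\<And>x y. norm x < R \<Longrightarrow> norm y < R \<Longrightarrow> norm (T' x - T' y) \<le> M * norm (x - y)"
begin

definition tangent :: "'a \<times> 'a \<Rightarrow> 'a \<times> 'a" where
  "tangent = (\<lambda>(x, v). (T x, T' x v))"

lemma T'_near: "norm x < R \<Longrightarrow> norm (T' x v - 2 *\<^sub>R v) \<le> M * norm x * norm v"
  using deriv_lip[of x 0] norm_blinfun[of "T' x - T' 0" v] R
  by (simp add: blinfun.diff_left T'0 order_trans[OF _ mult_right_mono])

text \<open>The radius \<open>s\<close> is left free: with \<open>s = R\<close> this is a Lipschitz
  bound, and with \<open>s\<close> close to the norm of x and \<open>y = 0\<close> it becomes the
  quadratic bound.\<close>

lemma T_near:
  assumes "norm x < s" "norm y < s" "s \<le> R"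
  shows "norm ((T x - 2 *\<^sub>R x) - (T y - 2 *\<^sub>R y)) \<le> M * s * norm (x - y)"
proof (rule differentiable_bound[of "ball 0 s" _ "\<lambda>w h. T' w h - 2 *\<^sub>R h"])
  show "((\<lambda>x. T x - 2 *\<^sub>R x) has_derivative (\<lambda>h. T' w h - 2 *\<^sub>R h)) (at w within ball 0 s)" if "w \<in> ball 0 s" for w
    using that assms
    by (intro has_derivative_diff has_derivative_at_withinI[OF deriv] has_derivative_scaleR_right has_derivative_ident) auto
  show "onorm (\<lambda>h. T' w h - 2 *\<^sub>R h) \<le> M * s" if "w \<in> ball 0 s" for w
  proof (rule onorm_bound)
    show "0 \<le> M * s" using M assms(1) norm_ge_zero[of x] by (intro mult_nonneg_nonneg) linarith+
    show "norm (T' w h - 2 *\<^sub>R h) \<le> M * s * norm h" for h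
    proof -
      have "norm (T' w h - 2 *\<^sub>R h) \<le> M * norm w * norm h" using that assms by (intro T'_near) auto
      also have "\<dots> \<le> M * s * norm h" using that M by (intro mult_right_mono mult_left_mono) auto
      finally show ?thesis .
    qed
  qed
qed (use assms in auto)

text \<open>The deviation of \<open>tangent\<close> from doubling has three parts, each Lipschitz
  with constant M R: that of \<open>T\<close>, that of \<open>T' x\<close> on the vector, and the
  change of \<open>T'\<close> with the base point. So the assumption 3 M R \<le> 1 gives the
  expansion factor 2 + 1. The quadratic constant 2M adds up the two components.\<close>

lemma tangent_expanding: 
  assumes "0 < \<rho>" "2 * \<rho> \<le> R" "4 * M * \<rho> \<le> 1"
  shows "expanding_map tangent (2 * M) R \<rho>"
proof
  fix z :: "'a \<times> 'a" assume z: "norm z < R"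
  obtain x v where zx: "z = (x, v)" by (cases z)
  have xv: "norm x \<le> norm z" "norm v \<le> norm z" using norm_fst_snd_le[of z] by (auto simp: zx)
  have Tx: "norm (T x - 2 *\<^sub>R x) \<le> M * (norm z)\<^sup>2"
  proof (rule field_le_epsilon)
    fix e :: real assume e: "e > 0"
    \<comment> \<open>\<open>T_near\<close> needs a strict bound on the norm of x; the excess is
      chosen so that it costs at most \<open>e\<close>.\<close>
    define s where "s = min R (norm x + e / (M * norm x + 1))"
    have p: "M * norm x + 1 > 0" using M by (smt (verit) mult_nonneg_nonneg norm_ge_zero)
    have s: "norm x < s" "s \<le> R" "0 < s" using e p xv z R by (auto simp: s_def add_nonneg_pos)
    have "norm (T x - 2 *\<^sub>R x) \<le> M * s * norm x" using T_near[of x s 0] s by (simp add: T0)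
    also have "\<dots> \<le> M * (norm x + e / (M * norm x + 1)) * norm x"
      using M by (intro mult_right_mono mult_left_mono) (auto simp: s_def)
    also have "\<dots> = M * (norm x)\<^sup>2 + e * ((M * norm x) / (M * norm x + 1))"
      by (simp add: power2_eq_square algebra_simps)
    also have "\<dots> \<le> M * (norm z)\<^sup>2 + e * 1"
      using M xv p e by (intro add_mono mult_left_mono power_mono) (auto simp: divide_le_eq)
    finally show "norm (T x - 2 *\<^sub>R x) \<le> M * (norm z)\<^sup>2 + e" by simp
  qed
  have "norm (T' x v - 2 *\<^sub>R v) \<le> M * norm x * norm v" using T'_near xv z by auto
  also have "\<dots> \<le> M * (norm z)\<^sup>2"
    using M xv unfolding power2_eq_square mult.assoc by (intro mult_left_mono mult_mono) auto
  finally have T'x: "norm (T' x v - 2 *\<^sub>R v) \<le> M * (norm z)\<^sup>2" .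
  have "norm (tangent z - 2 *\<^sub>R z) \<le> norm (T x - 2 *\<^sub>R x) + norm (T' x v - 2 *\<^sub>R v)"
    using norm_Pair_le[of "T x - 2 *\<^sub>R x" "T' x v - 2 *\<^sub>R v"] by (simp add: tangent_def zx)
  then show "norm (tangent z - 2 *\<^sub>R z) \<le> 2 * M * (norm z)\<^sup>2" using Tx T'x by simp
next
  fix z w :: "'a \<times> 'a" assume zw: "norm z < R" "norm w < R"
  obtain x v y u where zx: "z = (x, v)" "w = (y, u)" by (cases z, cases w)
  have xv: "norm x \<le> norm z" "norm v \<le> norm z" "norm y \<le> norm w" "norm u \<le> norm w"
    "norm (x - y) \<le> norm (z - w)" "norm (v - u) \<le> norm (z - w)"
    using norm_fst_snd_le[of z] norm_fst_snd_le[of w] norm_fst_snd_le[of "z - w"] by (auto simp: zx)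
  have 1: "norm ((T x - 2 *\<^sub>R x) - (T y - 2 *\<^sub>R y)) \<le> M * R * norm (z - w)"
    using T_near[of x R y] xv zw M R by (intro order_trans[OF T_near[of x R y]] mult_left_mono) auto
  have 2: "norm (T' x (v - u) - 2 *\<^sub>R (v - u)) \<le> M * R * norm (z - w)"
  proof -
    have "norm (T' x (v - u) - 2 *\<^sub>R (v - u)) \<le> M * norm x * norm (v - u)"
      using xv zw by (intro T'_near) auto
    also have "\<dots> \<le> M * R * norm (z - w)"
      using xv zw M R by (intro mult_mono mult_left_mono) auto
    finally show ?thesis .
  qed
  have 3: "norm ((T' x - T' y) u) \<le> M * R * norm (z - w)"
  proof -
    have "norm ((T' x - T' y) u) \<le> norm (T' x - T' y) * norm u" by (rule norm_blinfun)
    also have "\<dots> \<le> (M * norm (x - y)) * norm u"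
      using xv zw by (intro mult_right_mono deriv_lip) auto
    also have "\<dots> \<le> (M * norm (z - w)) * R"
      using xv zw M R by (intro mult_mono mult_left_mono) auto
    finally show ?thesis by (simp add: mult_ac)
  qed
  have "tangent z - tangent w = 2 *\<^sub>R (z - w) + ((T x - 2 *\<^sub>R x) - (T y - 2 *\<^sub>R y),
      (T' x (v - u) - 2 *\<^sub>R (v - u)) + (T' x - T' y) u)"
    by (simp add: tangent_def zx blinfun.bilinear_simps algebra_simps)
  then have "norm (tangent z - tangent w) \<le> norm (2 *\<^sub>R (z - w)) + norm ((T x - 2 *\<^sub>R x) - (T y - 2 *\<^sub>R y),
      (T' x (v - u) - 2 *\<^sub>R (v - u)) + (T' x - T' y) u)"
    by (simp only: norm_triangle_ineq)
  also have "\<dots> \<le> 2 * norm (z - w) + (norm ((T x - 2 *\<^sub>R x) - (T y - 2 *\<^sub>R y))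
      + norm ((T' x (v - u) - 2 *\<^sub>R (v - u)) + (T' x - T' y) u))"
    by (intro add_mono norm_Pair_le) simp
  also have "\<dots> \<le> 2 * norm (z - w) + (M * R * norm (z - w) + (M * R * norm (z - w) + M * R * norm (z - w)))"
    by (intro add_mono order_refl 1 order_trans[OF norm_triangle_ineq add_mono[OF 2 3]])
  also have "\<dots> = (2 + 3 * M * R) * norm (z - w)" by (simp add: algebra_simps)
  also have "\<dots> \<le> 3 * norm (z - w)" using R by (intro mult_right_mono) auto
  finally show "norm (tangent z - tangent w) \<le> 3 * norm (z - w)" .
qed (use M assms in auto)

text \<open>\<open>T\<close> is the restriction of \<open>tangent\<close> to the zero vectors (x,
  0), where the norms agree.\<close>

lemma T_expanding:
  assumes "0 < \<rho>" "2 * \<rho> \<le> R" "4 * M * \<rho> \<le> 1"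
  shows "expanding_map T (2 * M) R \<rho>"
proof -
  interpret t: expanding_map tangent "2 * M" R \<rho> by (rule tangent_expanding[OF assms])
  have n0: "norm ((x, 0) :: 'a \<times> 'a) = norm x" for x :: 'a by (simp add: norm_Pair)
  show ?thesis
  proof
    show "norm (T x - 2 *\<^sub>R x) \<le> 2 * M * (norm x)\<^sup>2" if "norm x < R" for x
      using t.quad[of "(x, 0)"] that by (simp add: tangent_def n0)
    show "norm (T x - T y) \<le> 3 * norm (x - y)" if "norm x < R" "norm y < R" for x y
      using t.lip[of "(x, 0)" "(y, 0)"] that by (simp add: tangent_def n0)
  qed (use M assms in auto)
qed

text \<open>By the chain rule the derivative of the n-th iterate of \<open>T\<close> is the vector
  component of the n-th iterate of \<open>tangent\<close>. That converges uniformly for small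
  vectors, linearity in the vector extends this to a bound relative to its norm, and the theorem on
  sequences of derivatives applies. Continuity of the limit derivative is continuity of the
  linearised \<open>tangent\<close>.\<close>

lemma linz_C1:
  assumes rho: "0 < \<rho>" "2 * \<rho> \<le> R" "4 * M * \<rho> \<le> 1" and x: "norm x < \<rho> / 2"
  shows "C1_at (expanding_map.linz T) x"
proof -
  interpret t: expanding_map tangent "2 * M" R \<rho> by (rule tangent_expanding[OF rho])
  interpret m: expanding_map T "2 * M" R \<rho> by (rule T_expanding[OF rho])
  define D where "D n x v = snd (t.iter n (x, v))" for n x v
  have D_Suc: "D (Suc n) x v = T' (fst (t.iter n ((1/2) *\<^sub>R x, (1/2) *\<^sub>R v))) (D n ((1/2) *\<^sub>R x) ((1/2) *\<^sub>R v))" for n x v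
    by (simp add: D_def t.iter_Suc) (simp add: tangent_def case_prod_unfold)
  have fst_iter: "fst (t.iter n (x, v)) = m.iter n x" for n x v
  proof (induction n arbitrary: x v)
    case 0 then show ?case by (simp add: t.iter_0 m.iter_0)
  next
    case (Suc n) then show ?case
      by (simp add: t.iter_Suc m.iter_Suc) (simp add: tangent_def case_prod_unfold)
  qed
  have der: "(m.iter n has_derivative D n x) (at x)" if "norm x < \<rho>" for n x
    using that
  proof (induction n arbitrary: x)
    case 0
    have "m.iter 0 = (\<lambda>x. x)" "D 0 x = (\<lambda>v. v)" by (auto simp: m.iter_0 D_def t.iter_0)
    then show ?case by simp
  next
    case (Suc n)
    have h: "norm ((1/2) *\<^sub>R x) < \<rho>" using Suc.prems rho by simp
    have 1: "((\<lambda>x. (1/2) *\<^sub>R x) has_derivative (\<lambda>v. (1/2) *\<^sub>R v)) (at x)"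
      by (intro derivative_intros)
    have 2: "((\<lambda>x. m.iter n ((1/2) *\<^sub>R x)) has_derivative (\<lambda>v. D n ((1/2) *\<^sub>R x) ((1/2) *\<^sub>R v))) (at x)"
      using has_derivative_compose[OF 1 Suc.IH[OF h]] .
    have "(T has_derivative T' (m.iter n ((1/2) *\<^sub>R x))) (at (m.iter n ((1/2) *\<^sub>R x)))"
      by (intro deriv m.iter_in_ball h)
    from has_derivative_compose[OF 2 this] show ?case
      by (simp add: m.iter_Suc[abs_def] D_Suc[abs_def] fst_iter)
  qed
  \<comment> \<open>Half of \<open>\<rho>\<close>, so that a point and a vector of this size
    together form a pair of norm below \<open>\<rho>\<close>.\<close>
  define \<sigma> where "\<sigma> = \<rho> / 2"
  have sig: "\<sigma> > 0" "\<sigma> < \<rho>" using rho by (auto simp: \<sigma>_def)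
  have pair_small: "norm (x, v) < \<rho>" if "norm x < \<sigma>" "norm v \<le> \<sigma>" for x v :: 'a
    using norm_Pair_le[of x v] that by (simp add: \<sigma>_def)
  define G where "G x v = lim (\<lambda>n. D n x v)" for x v
  define c where "c = 8 * (2 * M) * \<rho>\<^sup>2"
  have small: "(\<lambda>n. D n x v) \<longlonglongrightarrow> snd (t.linz (x, v))"
    "norm (D n x v - snd (t.linz (x, v))) \<le> c * (3/4)^n" if "norm x < \<sigma>" "norm v \<le> \<sigma>" for x v n
  proof -
    note p = pair_small[OF that]
    show "(\<lambda>n. D n x v) \<longlonglongrightarrow> snd (t.linz (x, v))"
      unfolding D_def by (intro tendsto_snd t.iter_tendsto p)
    have "norm (D n x v - snd (t.linz (x, v))) \<le> norm (t.iter n (x, v) - t.linz (x, v))"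
      using norm_fst_snd_le(2)[of "t.iter n (x, v) - t.linz (x, v)"] by (simp add: D_def)
    also have "\<dots> \<le> 8 * (2 * M) * (norm (x, v))\<^sup>2 * (3/4)^n" by (rule t.iter_linz_le[OF p])
    also have "\<dots> \<le> c * (3/4)^n"
      unfolding c_def using p M by (intro mult_right_mono mult_left_mono power_mono) auto
    finally show "norm (D n x v - snd (t.linz (x, v))) \<le> c * (3/4)^n" .
  qed
  have G_small: "G x v = snd (t.linz (x, v))" if "norm x < \<sigma>" "norm v \<le> \<sigma>" for x v
    unfolding G_def using small(1)[OF that] by (rule limI)
  have linD: "linear (D n x)" if "norm x < \<sigma>" for x n
    using der[of x n] that sig has_derivative_linear by force
  have conv: "(\<lambda>n. D n x v) \<longlonglongrightarrow> G x v" if x: "norm x < \<sigma>" for x v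
  proof -
    \<comment> \<open>Scales an arbitrary vector into the range in which the linearisation of
      \<open>tangent\<close> converges.\<close>
    define s where "s = \<sigma> / (norm v + 1)"
    have s: "s > 0" using sig by (auto simp: s_def intro!: divide_pos_pos add_nonneg_pos)
    have "norm (s *\<^sub>R v) \<le> \<sigma>"
      using sig by (simp add: s_def divide_le_eq add_nonneg_pos mult_left_mono)
    from small(1)[OF x this] have "convergent (\<lambda>n. D n x (s *\<^sub>R v))" by (rule convergentI)
    then have "convergent (\<lambda>n. (1/s) *\<^sub>R D n x (s *\<^sub>R v))" unfolding convergent_def by (elim exE) (rule exI, erule tendsto_scaleR[OF tendsto_const])
    then have "convergent (\<lambda>n. D n x v)" using s by (simp add: linear_scale[OF linD[OF x]])
    then show ?thesis unfolding G_def by (simp add: convergent_LIMSEQ_iff)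
  qed
  have G_scale: "G x (s *\<^sub>R v) = s *\<^sub>R G x v" if x: "norm x < \<sigma>" for x s v
    by (rule LIMSEQ_unique[OF conv[OF x]])
      (use linear_scale[OF linD[OF x]] in \<open>auto intro!: tendsto_scaleR conv x\<close>)
  have unif: "norm (D n x v - G x v) \<le> (c / \<sigma>) * (3/4)^n * norm v" if x: "norm x < \<sigma>" for x v n
  proof (cases "v = 0")
    case True
    have "D n x 0 = 0" "G x 0 = 0" using linear_0[OF linD[OF x]] G_scale[OF x, of 0 0] by auto
    then show ?thesis using True by simp
  next
    case False
    define w where "w = (\<sigma> / norm v) *\<^sub>R v"
    have w: "norm w \<le> \<sigma>" "(norm v / \<sigma>) *\<^sub>R w = v" using False sig by (auto simp: w_def)
    have e: "D n x v = (norm v / \<sigma>) *\<^sub>R D n x w" "G x v = (norm v / \<sigma>) *\<^sub>R G x w"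
      using linear_scale[OF linD[OF x, of n], of "norm v / \<sigma>" w] G_scale[OF x, of "norm v / \<sigma>" w]
      unfolding w(2) by blast+
    have "norm (D n x v - G x v) = norm ((norm v / \<sigma>) *\<^sub>R (D n x w - G x w))"
      unfolding scaleR_diff_right e[symmetric] ..
    then have "norm (D n x v - G x v) = (norm v / \<sigma>) * norm (D n x w - G x w)"
      using sig by simp
    also have "\<dots> \<le> (norm v / \<sigma>) * (c * (3/4)^n)"
      using small(2)[OF x w(1)] G_small[OF x w(1)] sig by (intro mult_left_mono) auto
    finally show ?thesis by (simp add: mult_ac)
  qed
  have "\<exists>g. \<forall>x\<in>ball 0 \<sigma>. (\<lambda>n. m.iter n x) \<longlonglongrightarrow> g x \<and> (g has_derivative G x) (at x within ball 0 \<sigma>)"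
  proof (rule has_derivative_sequence[where f' = D])
    show "(m.iter n has_derivative D n x) (at x within ball 0 \<sigma>)" if "x \<in> ball 0 \<sigma>" for n x
      by (rule has_derivative_at_withinI[OF der]) (use that sig in simp)
    show "\<forall>\<^sub>F n in sequentially. \<forall>x\<in>ball 0 \<sigma>. \<forall>h. norm (D n x h - G x h) \<le> e * norm h" if "e > 0" for e
    proof -
      have "\<forall>\<^sub>F n in sequentially. (c / \<sigma>) * (3/4)^n < e"
        by (rule order_tendstoD(2)[OF geometric_tendsto_0 that])
      then show ?thesis
      proof eventually_elim
        case (elim n)
        show ?case
        proof (intro ballI allI)
          fix x h :: 'a assume "x \<in> ball 0 \<sigma>"
          then have "norm (D n x h - G x h) \<le> (c / \<sigma>) * (3/4)^n * norm h" by (intro unif) auto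
          also have "\<dots> \<le> e * norm h" using elim by (intro mult_right_mono) auto
          finally show "norm (D n x h - G x h) \<le> e * norm h" .
        qed
      qed
    qed
    show "(\<lambda>n. m.iter n 0) \<longlonglongrightarrow> m.linz 0" using rho by (intro m.iter_tendsto) auto
    show "0 \<in> ball 0 \<sigma>" using sig by simp
  qed (rule convex_ball)
  then obtain g where g: "\<And>x. x \<in> ball 0 \<sigma> \<Longrightarrow> (\<lambda>n. m.iter n x) \<longlonglongrightarrow> g x"
    "\<And>x. x \<in> ball 0 \<sigma> \<Longrightarrow> (g has_derivative G x) (at x within ball 0 \<sigma>)" by blast
  have gl: "g x = m.linz x" if "x \<in> ball 0 \<sigma>" for x
    using g(1)[OF that] m.iter_tendsto[of x] that sig by (auto intro: LIMSEQ_unique)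
  have dl: "(m.linz has_derivative G x) (at x)" if "x \<in> ball 0 \<sigma>" for x
  proof -
    have "(g has_derivative G x) (at x)" using g(2)[OF that] that by (simp add: at_within_open[OF that])
    then show ?thesis
      by (rule has_derivative_transform_within_open[OF _ open_ball that]) (rule gl)
  qed
  have ap: "blinfun_apply (Blinfun (G x)) = G x" if "x \<in> ball 0 \<sigma>" for x
    using dl[OF that] has_derivative_bounded_linear bounded_linear_Blinfun_apply by blast
  show ?thesis
  proof (rule C1_atI[of "ball 0 \<sigma>" x _ "\<lambda>x. Blinfun (G x)"])
    show "continuous_on (ball 0 \<sigma>) (\<lambda>x. Blinfun (G x))"
    proof (rule continuous_on_blinfun_componentwise)
      fix i :: 'a assume i: "i \<in> Basis"
      have "continuous_on (ball 0 \<sigma>) (\<lambda>x. (1/\<sigma>) *\<^sub>R snd (t.linz (x, \<sigma> *\<^sub>R i)))"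
      proof (intro continuous_on_scaleR continuous_on_const continuous_on_snd
          continuous_on_compose2[OF t.continuous_linz] continuous_on_Pair continuous_on_id)
        show "(\<lambda>x::'a. (x, \<sigma> *\<^sub>R i)) ` ball 0 \<sigma> \<subseteq> ball 0 \<rho>"
          using pair_small[of _ "\<sigma> *\<^sub>R i"] sig i by (simp add: image_subset_iff mem_ball_0 del: mem_ball)
      qed
      then show "continuous_on (ball 0 \<sigma>) (\<lambda>x. blinfun_apply (Blinfun (G x)) i)"
      proof (rule continuous_on_eq)
        fix x :: 'a assume x: "x \<in> ball 0 \<sigma>"
        have "G x (\<sigma> *\<^sub>R i) = snd (t.linz (x, \<sigma> *\<^sub>R i))" using x sig i by (intro G_small) auto
        then show "(1/\<sigma>) *\<^sub>R snd (t.linz (x, \<sigma> *\<^sub>R i)) = blinfun_apply (Blinfun (G x)) i"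
          using G_scale[of x \<sigma> i] x sig by (simp add: ap[OF x])
      qed
    qed
  qed (use x dl ap in \<open>auto simp: \<sigma>_def\<close>)
qed

end

section \<open>Group valued maps of class $C^1$\<close>

lemma chart_on_Times:
  assumes "chart_on S c" "chart_on T d"
  shows "chart_on (prod_topology S T) (fst c \<times> fst d, map_prod (snd c) (snd d))"
proof -
  let ?f = "map_prod (snd c) (snd d)"
  obtain c' where c': "homeomorphic_maps (subtopology S (fst c)) (top_of_set (snd c ` fst c)) (snd c) c'"
    using assms(1) unfolding chart_on_def homeomorphic_map_maps by blast
  obtain d' where d': "homeomorphic_maps (subtopology T (fst d)) (top_of_set (snd d ` fst d)) (snd d) d'"
    using assms(2) unfolding chart_on_def homeomorphic_map_maps by blast
  have "homeomorphic_maps (prod_topology (subtopology S (fst c)) (subtopology T (fst d)))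
      (prod_topology (top_of_set (snd c ` fst c)) (top_of_set (snd d ` fst d)))
      (\<lambda>(x, y). (snd c x, snd d y)) (\<lambda>(x, y). (c' x, d' y))"
    using c' d' unfolding homeomorphic_maps_prod by blast
  moreover have "prod_topology (top_of_set (snd c ` fst c)) (top_of_set (snd d ` fst d)) =
      top_of_set (?f ` (fst c \<times> fst d))"
    by (simp add: subtopology_Times[symmetric] map_prod_surj_on)
  moreover have "(\<lambda>(x, y). (snd c x, snd d y)) = ?f" by (auto simp: map_prod_def)
  ultimately have "homeomorphic_map (subtopology (prod_topology S T) (fst c \<times> fst d))
      (top_of_set (?f ` (fst c \<times> fst d))) ?f"
    by (metis homeomorphic_maps_imp_map subtopology_Times)
  moreover have "openin (prod_topology S T) (fst c \<times> fst d)"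
    using assms by (simp add: chart_on_def openin_prod_Times_iff)
  moreover have "open (?f ` (fst c \<times> fst d))"
    using assms by (simp add: map_prod_surj_on chart_on_def open_Times)
  ultimately show ?thesis by (simp add: chart_on_def)
qed

lemma chart_on_inj: 
  assumes "chart_on T c" shows "inj_on (snd c) (fst c)"
proof -
  have "inj_on (snd c) (topspace (subtopology T (fst c)))"
    using assms homeomorphic_imp_injective_map unfolding chart_on_def by blast
  moreover have "topspace (subtopology T (fst c)) = fst c"
    using assms openin_subset unfolding chart_on_def by fastforce
  ultimately show ?thesis by simp
qed

lemma chart_on_open_image:
  assumes c: "chart_on T c" and U: "openin T U" "U \<subseteq> fst c"
  shows "open (snd c ` U)"
proof -
  have "open_map (subtopology T (fst c)) (top_of_set (snd c ` fst c)) (snd c)"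
    using c homeomorphic_imp_open_map unfolding chart_on_def by blast
  moreover have "openin (subtopology T (fst c)) U"
    using U by (simp add: openin_subtopology) (metis inf.absorb1)
  ultimately have "openin (top_of_set (snd c ` fst c)) (snd c ` U)"
    unfolding open_map_def by blast
  then show ?thesis using c openin_open_trans unfolding chart_on_def by blast
qed

lemma chart_on_open_preimage:
  assumes c: "chart_on T c" and V: "open V"
  shows "openin T {p \<in> fst c. snd c p \<in> V}"
proof -
  have op: "openin T (fst c)" using c by (simp add: chart_on_def)
  have "continuous_map (subtopology T (fst c)) (top_of_set (snd c ` fst c)) (snd c)"
    using c homeomorphic_imp_continuous_map unfolding chart_on_def by blast
  then have "continuous_map (subtopology T (fst c)) euclidean (snd c)"
    using continuous_map_into_fulltopology by blast
  then have "openin (subtopology T (fst c)) {p \<in> topspace (subtopology T (fst c)). snd c p \<in> V}"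
    using V by (intro openin_continuous_map_preimage) auto
  moreover have "topspace (subtopology T (fst c)) = fst c"
    using openin_subset[OF op] by auto
  ultimately show ?thesis using op openin_trans_full by fastforce
qed

text \<open>\<open>smooth_on\<close> yields genuine C^1 information only on open sets; this covers
  the coordinate domains that occur in \<open>smooth_map\<close>.\<close>

lemma chart_on_open_domain:
  assumes c: "chart_on S c" and f: "continuous_map S T f" and U: "openin T U"
  shows "open (snd c ` {p \<in> fst c. f p \<in> U})"
proof (rule chart_on_open_image[OF c])
  have op: "openin S (fst c)" using c by (simp add: chart_on_def)
  have "{p \<in> fst c. f p \<in> U} = {p \<in> topspace S. f p \<in> U} \<inter> fst c"
    using openin_subset[OF op] by auto
  then show "openin S {p \<in> fst c. f p \<in> U}"
    using openin_continuous_map_preimage[OF f U] op by (simp add: openin_Int)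
qed auto

abbreviation cinv :: "('p, 'm) chart \<Rightarrow> 'm \<Rightarrow> 'p" where
  "cinv d \<equiv> inv_into (fst d) (snd d)"

locale lie_group_on = group G for G :: "('g, 'e::euclidean_space) lie_group" (structure) +
  assumes lie: "is_lie_group G"
begin

lemma chart: "d \<in> atlas G \<Longrightarrow> chart_on (topol G) d"
  using lie by (simp add: is_lie_group_def smooth_manifold_def)

lemma topspace_G: "topspace (topol G) = carrier G"
  using lie by (simp add: is_lie_group_def)

lemma Hausdorff_G: "Hausdorff_space (topol G)"
  using lie by (simp add: is_lie_group_def smooth_manifold_def)

lemma chart_openin: "d \<in> atlas G \<Longrightarrow> openin (topol G) (fst d)"
  using chart by (simp add: chart_on_def)

lemma chart_carrier: "d \<in> atlas G \<Longrightarrow> p \<in> fst d \<Longrightarrow> p \<in> carrier G"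
  using chart_openin openin_subset topspace_G by blast

lemma chart_at: "p \<in> carrier G \<Longrightarrow> \<exists>d\<in>atlas G. p \<in> fst d"
  using lie unfolding is_lie_group_def smooth_manifold_def by auto

lemma cinv_chart: "d \<in> atlas G \<Longrightarrow> p \<in> fst d \<Longrightarrow> cinv d (snd d p) = p"
  using chart_on_inj[OF chart] by simp

lemma open_chart: "d \<in> atlas G \<Longrightarrow> open (snd d ` fst d)"
  using chart by (simp add: chart_on_def)

lemma smooth_mult:
  "smooth_map (prod_topology (topol G) (topol G)) (prod_atlas (atlas G) (atlas G))
       (topol G) (atlas G) (\<lambda>(p, q). p \<otimes> q)"
  using lie by (simp add: is_lie_group_def)

lemma smooth_inv: "smooth_map (topol G) (atlas G) (topol G) (atlas G) (\<lambda>p. inv p)"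
  using lie by (simp add: is_lie_group_def)

lemma smooth_id: "smooth_map (topol G) (atlas G) (topol G) (atlas G) (\<lambda>p. p)"
  using lie by (simp add: is_lie_group_def smooth_manifold_def)

definition mult_dom :: "('g, 'e) chart \<Rightarrow> ('g, 'e) chart \<Rightarrow> ('g, 'e) chart \<Rightarrow> ('e \<times> 'e) set" where
  "mult_dom d1 d2 d3 = map_prod (snd d1) (snd d2) ` {(p, q). p \<in> fst d1 \<and> q \<in> fst d2 \<and> p \<otimes> q \<in> fst d3}"

lemma mult_in_charts:
  assumes d: "d1 \<in> atlas G" "d2 \<in> atlas G" "d3 \<in> atlas G"
  shows "open (mult_dom d1 d2 d3)"
    and "smooth_on (mult_dom d1 d2 d3)
      (in_charts (fst d1 \<times> fst d2, map_prod (snd d1) (snd d2)) d3 (\<lambda>(p, q). p \<otimes> q))"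
    and "z \<in> mult_dom d1 d2 d3 \<Longrightarrow>
      in_charts (fst d1 \<times> fst d2, map_prod (snd d1) (snd d2)) d3 (\<lambda>(p, q). p \<otimes> q) z =
      snd d3 (cinv d1 (fst z) \<otimes> cinv d2 (snd z))"
proof -
  let ?c = "(fst d1 \<times> fst d2, map_prod (snd d1) (snd d2))"
  have eq: "mult_dom d1 d2 d3 = snd ?c ` {p \<in> fst ?c. (\<lambda>(p, q). p \<otimes> q) p \<in> fst d3}"
    unfolding mult_dom_def by auto
  have c: "?c \<in> prod_atlas (atlas G) (atlas G)" using d unfolding prod_atlas_def by blast
  show "smooth_on (mult_dom d1 d2 d3) (in_charts ?c d3 (\<lambda>(p, q). p \<otimes> q))"
    using smooth_mult c d(3) unfolding smooth_map_def eq by blast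
  show "open (mult_dom d1 d2 d3)"
    unfolding eq using smooth_mult d
    by (intro chart_on_open_domain[OF chart_on_Times[OF chart chart] _ chart_openin]) (auto simp: smooth_map_def)
  assume "z \<in> mult_dom d1 d2 d3"
  then obtain p q where pq: "p \<in> fst d1" "q \<in> fst d2" "z = (snd d1 p, snd d2 q)"
    unfolding mult_dom_def by auto
  have "inj_on (snd ?c) (fst ?c)" using chart_on_inj[OF chart_on_Times[OF chart chart]] d by blast
  then have "inv_into (fst ?c) (snd ?c) (snd ?c (p, q)) = (p, q)" using pq by (intro inv_into_f_f) auto
  then show "in_charts ?c d3 (\<lambda>(p, q). p \<otimes> q) z = snd d3 (cinv d1 (fst z) \<otimes> cinv d2 (snd z))"
    using pq d by (simp add: in_charts_def cinv_chart)
qed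

lemma mult_domI:
  "\<lbrakk>p \<in> fst d1; q \<in> fst d2; p \<otimes> q \<in> fst d3\<rbrakk> \<Longrightarrow> (snd d1 p, snd d2 q) \<in> mult_dom d1 d2 d3"
  unfolding mult_dom_def by (rule image_eqI[of _ _ "(p, q)"]) auto

lemma mult_domD:
  "\<lbrakk>(snd d1 p, snd d2 q) \<in> mult_dom d1 d2 d3; d1 \<in> atlas G; d2 \<in> atlas G; p \<in> fst d1; q \<in> fst d2\<rbrakk>
     \<Longrightarrow> p \<otimes> q \<in> fst d3"
  unfolding mult_dom_def by (clarsimp simp: map_prod_def) (metis cinv_chart)

text \<open>One chart is enough by \<open>gC1_chart\<close>. Membership of nearby values in the
  chart domain is demanded explicitly because coordinate maps are total functions with arbitrary
  values elsewhere.\<close>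

definition gC1 :: "('a::real_normed_vector \<Rightarrow> 'g) \<Rightarrow> 'a \<Rightarrow> bool" where
  "gC1 f x \<longleftrightarrow> (\<exists>d\<in>atlas G. f x \<in> fst d \<and> (\<forall>\<^sub>F y in nhds x. f y \<in> fst d) \<and> C1_at (\<lambda>y. snd d (f y)) x)"

lemma gC1_carrier: "gC1 f x \<Longrightarrow> f x \<in> carrier G"
  unfolding gC1_def using chart_carrier by blast

text \<open>The common pattern of change of chart, product and inverse: \<open>\<phi>\<close> is the
  known coordinate expression, \<open>h\<close> the smooth operation in coordinates on the open set
  \<open>W\<close>. Continuity of \<open>\<phi>\<close> keeps it in \<open>W\<close>, which yields
  membership in the target chart.\<close>

lemma gC1_intro:
  assumes d: "d \<in> atlas G" and \<phi>: "C1_at \<phi> x" and W: "open W" "\<phi> x \<in> W" and h: "C1_at h (\<phi> x)"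
    and ev: "\<forall>\<^sub>F y in nhds x. \<phi> y \<in> W \<longrightarrow> f y \<in> fst d \<and> snd d (f y) = h (\<phi> y)"
  shows "f x \<in> fst d \<and> (\<forall>\<^sub>F y in nhds x. f y \<in> fst d) \<and> C1_at (\<lambda>y. snd d (f y)) x"
proof -
  have "\<forall>\<^sub>F y in nhds x. \<phi> y \<in> W"
    using C1_at_isCont[OF \<phi>] W topological_tendstoD[of \<phi> "\<phi> x" "nhds x" W]
    by (simp add: isCont_def tendsto_at_iff_tendsto_nhds)
  with ev have e: "\<forall>\<^sub>F y in nhds x. f y \<in> fst d \<and> snd d (f y) = h (\<phi> y)"
    by eventually_elim auto
  then have "f x \<in> fst d" using eventually_nhds_x_imp_x by blast
  moreover have "C1_at (\<lambda>y. snd d (f y)) x"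
    by (rule C1_at_cong[OF C1_at_compose[OF \<phi> h]]) (use e in eventually_elim, simp)
  ultimately show ?thesis using e by (auto elim: eventually_mono)
qed

lemma gC1_chart:
  assumes f: "gC1 f x" and d: "d \<in> atlas G" "f x \<in> fst d"
  shows "\<forall>\<^sub>F y in nhds x. f y \<in> fst d" "C1_at (\<lambda>y. snd d (f y)) x"
proof -
  obtain d0 where d0: "d0 \<in> atlas G" "f x \<in> fst d0" "\<forall>\<^sub>F y in nhds x. f y \<in> fst d0" "C1_at (\<lambda>y. snd d0 (f y)) x"
    using f unfolding gC1_def by blast
  let ?S = "snd d0 ` {p \<in> fst d0. p \<in> fst d}"
  have S: "open ?S" "smooth_on ?S (in_charts d0 d (\<lambda>p. p))"
    using smooth_id d d0 by (auto simp: smooth_map_def intro!: chart_on_open_domain[OF chart _ chart_openin])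
  have x: "snd d0 (f x) \<in> ?S" using d d0 by auto
  have "f x \<in> fst d \<and> (\<forall>\<^sub>F y in nhds x. f y \<in> fst d) \<and> C1_at (\<lambda>y. snd d (f y)) x"
  proof (rule gC1_intro[OF d(1) d0(4) S(1) x smooth_on_C1_at[OF S x]])
    show "\<forall>\<^sub>F y in nhds x. snd d0 (f y) \<in> ?S \<longrightarrow> f y \<in> fst d \<and> snd d (f y) = in_charts d0 d (\<lambda>p. p) (snd d0 (f y))"
      using d0(3)
    proof eventually_elim
      case (elim y)
      then show ?case
        using cinv_chart[OF d0(1)] by (auto simp: in_charts_def) metis
    qed
  qed
  then show "\<forall>\<^sub>F y in nhds x. f y \<in> fst d" "C1_at (\<lambda>y. snd d (f y)) x" by auto
qed

lemma gC1_mult: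
  assumes f: "gC1 f x" and h: "gC1 h x"
  shows "gC1 (\<lambda>y. f y \<otimes> h y) x"
proof -
  obtain d1 where d1: "d1 \<in> atlas G" "f x \<in> fst d1" "\<forall>\<^sub>F y in nhds x. f y \<in> fst d1" "C1_at (\<lambda>y. snd d1 (f y)) x"
    using f unfolding gC1_def by blast
  obtain d2 where d2: "d2 \<in> atlas G" "h x \<in> fst d2" "\<forall>\<^sub>F y in nhds x. h y \<in> fst d2" "C1_at (\<lambda>y. snd d2 (h y)) x"
    using h unfolding gC1_def by blast
  obtain d3 where d3: "d3 \<in> atlas G" "f x \<otimes> h x \<in> fst d3"
    using chart_at f h gC1_carrier by (metis m_closed)
  note M = mult_in_charts[OF d1(1) d2(1) d3(1)]
  have x: "(snd d1 (f x), snd d2 (h x)) \<in> mult_dom d1 d2 d3"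
    using d1 d2 d3 by (intro mult_domI)
  have "f x \<otimes> h x \<in> fst d3 \<and> (\<forall>\<^sub>F y in nhds x. f y \<otimes> h y \<in> fst d3) \<and> C1_at (\<lambda>y. snd d3 (f y \<otimes> h y)) x"
  proof (rule gC1_intro[OF d3(1) C1_at_Pair[OF d1(4) d2(4)] M(1) x smooth_on_C1_at[OF M(1,2) x]])
    show "\<forall>\<^sub>F y in nhds x. (snd d1 (f y), snd d2 (h y)) \<in> mult_dom d1 d2 d3 \<longrightarrow> f y \<otimes> h y \<in> fst d3 \<and>
        snd d3 (f y \<otimes> h y) = in_charts (fst d1 \<times> fst d2, map_prod (snd d1) (snd d2)) d3 (\<lambda>(p, q). p \<otimes> q) (snd d1 (f y), snd d2 (h y))"
      using d1(3) d2(3)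
    proof eventually_elim
      case (elim y)
      then show ?case using M(3) cinv_chart d1 d2 mult_domD by auto
    qed
  qed
  then show ?thesis unfolding gC1_def using d3 by blast
qed

lemma gC1_inv:
  assumes f: "gC1 f x"
  shows "gC1 (\<lambda>y. inv (f y)) x"
proof -
  obtain d0 where d0: "d0 \<in> atlas G" "f x \<in> fst d0" "\<forall>\<^sub>F y in nhds x. f y \<in> fst d0" "C1_at (\<lambda>y. snd d0 (f y)) x"
    using f unfolding gC1_def by blast
  obtain d where d: "d \<in> atlas G" "inv (f x) \<in> fst d"
    using chart_at f gC1_carrier by (metis inv_closed)
  let ?S = "snd d0 ` {p \<in> fst d0. inv p \<in> fst d}"
  have S: "open ?S" "smooth_on ?S (in_charts d0 d (\<lambda>p. inv p))"
    using smooth_inv d d0 by (auto simp: smooth_map_def intro!: chart_on_open_domain[OF chart _ chart_openin])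
  have x: "snd d0 (f x) \<in> ?S" using d d0 by auto
  have "inv (f x) \<in> fst d \<and> (\<forall>\<^sub>F y in nhds x. inv (f y) \<in> fst d) \<and> C1_at (\<lambda>y. snd d (inv (f y))) x"
  proof (rule gC1_intro[OF d(1) d0(4) S(1) x smooth_on_C1_at[OF S x]])
    show "\<forall>\<^sub>F y in nhds x. snd d0 (f y) \<in> ?S \<longrightarrow> inv (f y) \<in> fst d \<and>
        snd d (inv (f y)) = in_charts d0 d (\<lambda>p. inv p) (snd d0 (f y))"
      using d0(3)
    proof eventually_elim
      case (elim y)
      then show ?case
        using cinv_chart[OF d0(1)] by (auto simp: in_charts_def) metis
    qed
  qed
  then show ?thesis unfolding gC1_def using d by blast
qed

lemma gC1_const: "p \<in> carrier G \<Longrightarrow> gC1 (\<lambda>_. p) x"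
  unfolding gC1_def using chart_at by (auto intro: C1_at_const)

lemma gC1_cinv:
  assumes d: "d \<in> atlas G" "x \<in> snd d ` fst d"
  shows "gC1 (cinv d) x"
proof -
  have ev: "\<forall>\<^sub>F y in nhds x. y \<in> snd d ` fst d"
    using open_chart[OF d(1)] d(2) by (rule eventually_nhds_in_open)
  have "\<forall>\<^sub>F y in nhds x. cinv d y \<in> fst d" "\<forall>\<^sub>F y in nhds x. y = snd d (cinv d y)"
    using ev by (eventually_elim, auto intro: inv_into_into simp: f_inv_into_f)+
  then show ?thesis
    unfolding gC1_def using d C1_at_cong[OF C1_at_ident] by (auto intro!: bexI[of _ d] inv_into_into)
qed

lemma gC1_compose:
  assumes f: "gC1 f (h x)" and h: "C1_at h x"
  shows "gC1 (\<lambda>y. f (h y)) x"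
proof -
  obtain d where d: "d \<in> atlas G" "f (h x) \<in> fst d" "\<forall>\<^sub>F y in nhds (h x). f y \<in> fst d" "C1_at (\<lambda>y. snd d (f y)) (h x)"
    using f unfolding gC1_def by blast
  have "filterlim h (nhds (h x)) (nhds x)"
    using C1_at_isCont[OF h] by (simp add: isCont_def tendsto_at_iff_tendsto_nhds)
  then have "\<forall>\<^sub>F y in nhds x. f (h y) \<in> fst d"
    using d(3) filterlim_iff by blast
  then show ?thesis unfolding gC1_def using d C1_at_compose[OF h d(4)] by blast
qed

lemma gC1_cong:
  assumes "gC1 f x" "\<forall>\<^sub>F y in nhds x. f y = h y"
  shows "gC1 h x"
proof -
  obtain d where d: "d \<in> atlas G" "f x \<in> fst d" "\<forall>\<^sub>F y in nhds x. f y \<in> fst d" "C1_at (\<lambda>y. snd d (f y)) x"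
    using assms(1) unfolding gC1_def by blast
  have "f x = h x" using assms(2) by (rule eventually_nhds_x_imp_x)
  moreover have "\<forall>\<^sub>F y in nhds x. h y \<in> fst d" using assms(2) d(3) by eventually_elim auto
  moreover have "C1_at (\<lambda>y. snd d (h y)) x"
    by (rule C1_at_cong[OF d(4)]) (use assms(2) in eventually_elim, simp)
  ultimately show ?thesis unfolding gC1_def using d by auto
qed

lemma gC1_pow: "gC1 f x \<Longrightarrow> gC1 (\<lambda>y. f y [^] (n::nat)) x"
  by (induction n) (auto intro: gC1_mult gC1_const)

lemma gC1_continuous_map:
  fixes f :: "'a::real_normed_vector \<Rightarrow> 'g"
  assumes "\<And>x. gC1 f x"
  shows "continuous_map euclidean (topol G) f"
  unfolding continuous_map_def
proof (intro conjI allI impI)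
  show "f \<in> topspace euclidean \<rightarrow> topspace (topol G)"
    using gC1_carrier assms topspace_G by auto
  fix U assume U: "openin (topol G) U"
  have "\<exists>T. open T \<and> x \<in> T \<and> T \<subseteq> {x. f x \<in> U}" if x: "f x \<in> U" for x
  proof -
    obtain d where d: "d \<in> atlas G" "f x \<in> fst d" "\<forall>\<^sub>F y in nhds x. f y \<in> fst d" "C1_at (\<lambda>y. snd d (f y)) x"
      using assms[of x] unfolding gC1_def by blast
    have "open (snd d ` (U \<inter> fst d))"
      by (intro chart_on_open_image[OF chart[OF d(1)]] openin_Int U chart_openin d) auto
    moreover have "snd d (f x) \<in> snd d ` (U \<inter> fst d)" using x d by auto
    ultimately have "\<forall>\<^sub>F y in nhds x. snd d (f y) \<in> snd d ` (U \<inter> fst d)"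
      using topological_tendstoD[OF C1_at_tendsto[OF d(4)]] by blast
    with d(3) have "\<forall>\<^sub>F y in nhds x. f y \<in> U"
    proof eventually_elim
      case (elim y)
      then show ?case using inj_on_image_mem_iff[OF chart_on_inj[OF chart[OF d(1)]], of "f y" "U \<inter> fst d"] by auto
    qed
    then show ?thesis unfolding eventually_nhds by auto
  qed
  then have "open {x. f x \<in> U}" by (subst open_subopen) auto
  then show "openin euclidean {x \<in> topspace euclidean. f x \<in> U}" by simp
qed

end

section \<open>The exponential map of a Lie group\<close>

text \<open>Taylor's formula to second order from a Lipschitz derivative.\<close>

lemma smooth_on_quadratic:
  fixes f :: "'a::euclidean_space \<Rightarrow> 'b::real_normed_vector"
  assumes "open S" "smooth_on S f" "a \<in> S"
  obtains r K where "r > 0" "K \<ge> 0"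
    "\<And>y. y \<in> ball a r \<Longrightarrow> norm (f y - f a - frechet_derivative f (at a) (y - a)) \<le> K * (norm (y - a))\<^sup>2"
proof -
  obtain r K f' where *: "r > 0" "K \<ge> 0" "ball a r \<subseteq> S"
    "\<And>y. y \<in> ball a r \<Longrightarrow> (f has_derivative blinfun_apply (f' y)) (at y)"
    "\<And>y z. \<lbrakk>y \<in> ball a r; z \<in> ball a r\<rbrakk> \<Longrightarrow> norm (f' y - f' z) \<le> K * norm (y - z)"
    using smooth_on_lipschitz_derivative[OF assms] by blast
  have D: "frechet_derivative f (at a) = f' a"
    using frechet_derivative_at[OF *(4)[of a]] *(1) by simp
  show thesis
  proof (rule that[OF *(1,2)])
    fix y assume y: "y \<in> ball a r"
    \<comment> \<open>A ball of radius |y - a| rather than \<open>r\<close>: on it the derivative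
      deviates by at most K |y - a|, which makes the bound quadratic.\<close>
    let ?S = "cball a (norm (y - a))"
    have sub: "?S \<subseteq> ball a r" using y by (auto simp: dist_norm norm_minus_commute)
    have "norm ((f y - f' a y) - (f a - f' a a)) \<le> (K * norm (y - a)) * norm (y - a)"
    proof (rule differentiable_bound[of ?S _ "\<lambda>w h. f' w h - f' a h"])
      show "((\<lambda>x. f x - blinfun_apply (f' a) x) has_derivative (\<lambda>h. f' w h - f' a h)) (at w within ?S)" if "w \<in> ?S" for w
        by (intro has_derivative_diff has_derivative_at_withinI[OF *(4)] bounded_linear_imp_has_derivative
            blinfun.bounded_linear_right) (use that sub in auto)
      show "onorm (\<lambda>h. f' w h - f' a h) \<le> K * norm (y - a)" if w: "w \<in> ?S" for w
      proof -
        have "onorm (\<lambda>h. f' w h - f' a h) = norm (f' w - f' a)"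
          by (simp add: norm_blinfun.rep_eq minus_blinfun.rep_eq)
        also have "\<dots> \<le> K * norm (w - a)" using w sub *(1) by (intro *(5)) auto
        also have "\<dots> \<le> K * norm (y - a)" using w *(2)
          by (intro mult_left_mono) (auto simp: dist_norm norm_minus_commute)
        finally show ?thesis .
      qed
    qed (auto simp: dist_norm norm_minus_commute)
    then show "norm (f y - f a - frechet_derivative f (at a) (y - a)) \<le> K * (norm (y - a))\<^sup>2"
      unfolding D by (simp add: blinfun.diff_right algebra_simps power2_eq_square)
  qed
qed

text \<open>Differentiability at 0 with error O(t^2), which is the accuracy that
  \<open>linz_unique\<close> consumes. It says nothing about the curve away from 0 and survives
  smooth maps, so it can be checked on products and inverses of curves.\<close>

definition second_order :: "(real \<Rightarrow> 'a::real_normed_vector) \<Rightarrow> 'a \<Rightarrow> 'a \<Rightarrow> bool" where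
  "second_order y a X \<longleftrightarrow> (\<exists>C. \<forall>\<^sub>F t in nhds 0. norm (y t - a - t *\<^sub>R X) \<le> C * t\<^sup>2)"

lemma second_orderE:
  assumes "second_order y a X"
  obtains C where "C \<ge> 0" "\<forall>\<^sub>F t in nhds 0. norm (y t - a - t *\<^sub>R X) \<le> C * t\<^sup>2"
    "\<forall>\<^sub>F t in nhds 0. norm (y t - a) \<le> (norm X + C) * \<bar>t\<bar>"
proof -
  obtain C0 where C0: "\<forall>\<^sub>F t in nhds 0. norm (y t - a - t *\<^sub>R X) \<le> C0 * t\<^sup>2"
    using assms unfolding second_order_def by blast
  define C where "C = max C0 0"
  have C: "\<forall>\<^sub>F t in nhds 0. norm (y t - a - t *\<^sub>R X) \<le> C * t\<^sup>2"
    using C0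
  proof eventually_elim
    case (elim t)
    have "C0 * t\<^sup>2 \<le> C * t\<^sup>2" by (intro mult_right_mono) (auto simp: C_def)
    with elim show ?case by linarith
  qed
  have "\<forall>\<^sub>F t::real in nhds 0. t \<in> ball 0 1" by (rule eventually_nhds_in_open) auto
  with C have "\<forall>\<^sub>F t in nhds 0. norm (y t - a) \<le> (norm X + C) * \<bar>t\<bar>"
  proof eventually_elim
    case (elim t)
    have "\<bar>t\<bar> * \<bar>t\<bar> \<le> 1 * \<bar>t\<bar>" using elim(2) by (intro mult_right_mono) auto
    then have "C * t\<^sup>2 \<le> C * \<bar>t\<bar>"
      by (intro mult_left_mono) (auto simp: C_def power2_eq_square)
    then show ?case using elim(1) norm_triangle_sub[of "y t - a" "t *\<^sub>R X"] by (simp add: algebra_simps)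
  qed
  then show thesis using C that[of C] by (simp add: C_def)
qed

lemma second_order_tendsto:
  assumes "second_order y a X" shows "(y \<longlongrightarrow> a) (nhds 0)"
proof -
  obtain C where C: "\<forall>\<^sub>F t in nhds 0. norm (y t - a) \<le> (norm X + C) * \<bar>t\<bar>"
    using second_orderE[OF assms] by blast
  have "((\<lambda>t. (norm X + C) * \<bar>t\<bar>) \<longlongrightarrow> (norm X + C) * \<bar>0::real\<bar>) (nhds 0)"
    by (intro tendsto_intros filterlim_ident)
  then have "((\<lambda>t. y t - a) \<longlongrightarrow> 0) (nhds 0)"
    by (intro Lim_null_comparison[OF C]) simp
  then show ?thesis by (simp add: LIM_zero_iff)
qed

text \<open>The new error is the quadratic remainder of \<open>f\<close> on an increment of size
  O(t), plus the image under the differential of the old error.\<close>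

lemma second_order_compose:
  fixes f :: "'a::euclidean_space \<Rightarrow> 'b::real_normed_vector"
  assumes f: "open S" "smooth_on S f" "a \<in> S" and y: "second_order y a X"
  shows "second_order (\<lambda>t. f (y t)) (f a) (frechet_derivative f (at a) X)"
proof -
  let ?L = "frechet_derivative f (at a)"
  have bl: "bounded_linear ?L"
    using C1_at_has_derivative[OF smooth_on_C1_at[OF f]] has_derivative_bounded_linear by blast
  obtain r K where rK: "r > 0" "K \<ge> 0"
    "\<And>y. y \<in> ball a r \<Longrightarrow> norm (f y - f a - ?L (y - a)) \<le> K * (norm (y - a))\<^sup>2"
    using smooth_on_quadratic[OF f] by blast
  obtain C where C: "C \<ge> 0" "\<forall>\<^sub>F t in nhds 0. norm (y t - a - t *\<^sub>R X) \<le> C * t\<^sup>2"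
    "\<forall>\<^sub>F t in nhds 0. norm (y t - a) \<le> (norm X + C) * \<bar>t\<bar>"
    using second_orderE[OF y] by blast
  have "\<forall>\<^sub>F t in nhds 0. y t \<in> ball a r"
    using topological_tendstoD[OF second_order_tendsto[OF y] open_ball, of a r] rK(1) by simp
  with C(2,3) have "\<forall>\<^sub>F t in nhds 0. norm (f (y t) - f a - t *\<^sub>R ?L X) \<le> (K * (norm X + C)\<^sup>2 + onorm ?L * C) * t\<^sup>2"
  proof eventually_elim
    case (elim t)
    have 1: "norm (f (y t) - f a - ?L (y t - a)) \<le> K * ((norm X + C) * \<bar>t\<bar>)\<^sup>2"
      using rK(3)[OF elim(3)] rK(2) elim(2)
      by (meson mult_left_mono norm_ge_zero order_trans power_mono)
    have 2: "norm (?L (y t - a - t *\<^sub>R X)) \<le> onorm ?L * (C * t\<^sup>2)"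
      using onorm[OF bl, of "y t - a - t *\<^sub>R X"] elim(1) onorm_pos_le[OF bl]
      by (meson mult_left_mono order_trans)
    have "f (y t) - f a - t *\<^sub>R ?L X = (f (y t) - f a - ?L (y t - a)) + ?L (y t - a - t *\<^sub>R X)"
      using bl by (simp add: bounded_linear.linear linear_diff linear_scale)
    then have "norm (f (y t) - f a - t *\<^sub>R ?L X) = norm ((f (y t) - f a - ?L (y t - a)) + ?L (y t - a - t *\<^sub>R X))"
      by (rule arg_cong)
    also have "\<dots> \<le> K * ((norm X + C) * \<bar>t\<bar>)\<^sup>2 + onorm ?L * (C * t\<^sup>2)"
      using 1 2 by (rule norm_triangle_mono)
    finally have "norm (f (y t) - f a - t *\<^sub>R ?L X) \<le> K * ((norm X + C) * \<bar>t\<bar>)\<^sup>2 + onorm ?L * (C * t\<^sup>2)" .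
    then show ?case unfolding power_mult_distrib power2_abs by (simp add: algebra_simps)
  qed
  then show ?thesis unfolding second_order_def by blast
qed

lemma second_order_Pair:
  assumes "second_order y a X" "second_order z b Y"
  shows "second_order (\<lambda>t. (y t, z t)) (a, b) (X, Y)"
proof -
  obtain C D where "\<forall>\<^sub>F t in nhds 0. norm (y t - a - t *\<^sub>R X) \<le> C * t\<^sup>2"
     "\<forall>\<^sub>F t in nhds 0. norm (z t - b - t *\<^sub>R Y) \<le> D * t\<^sup>2"
    using assms unfolding second_order_def by blast
  then have "\<forall>\<^sub>F t in nhds 0. norm ((y t, z t) - (a, b) - t *\<^sub>R (X, Y)) \<le> (C + D) * t\<^sup>2"
  proof eventually_elim
    case (elim t)
    then show ?case
      using norm_Pair_le[of "y t - a - t *\<^sub>R X" "z t - b - t *\<^sub>R Y"] by (simp add: algebra_simps)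
  qed
  then show ?thesis unfolding second_order_def by blast
qed

lemma second_order_unique:
  assumes "second_order y a X" "second_order y a Y" shows "X = Y"
proof -
  obtain C D where C: "\<forall>\<^sub>F t in nhds 0. norm (y t - a - t *\<^sub>R X) \<le> C * t\<^sup>2"
     and D: "\<forall>\<^sub>F t in nhds 0. norm (y t - a - t *\<^sub>R Y) \<le> D * t\<^sup>2"
    using assms unfolding second_order_def by blast
  have "\<forall>\<^sub>F t::real in at 0. t \<noteq> 0" by (simp add: eventually_at_filter)
  with eventually_nhds_conv_at[THEN iffD1, OF C, THEN conjunct1] eventually_nhds_conv_at[THEN iffD1, OF D, THEN conjunct1]
  have "\<forall>\<^sub>F t::real in at 0. norm (X - Y) \<le> (C + D) * \<bar>t\<bar>"
  proof (eventually_elim)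
    case (elim t)
    have "norm (t *\<^sub>R (X - Y)) = norm ((y t - a - t *\<^sub>R Y) - (y t - a - t *\<^sub>R X))" by (simp add: algebra_simps)
    also have "\<dots> \<le> C * t\<^sup>2 + D * t\<^sup>2" using norm_triangle_ineq4[of "y t - a - t *\<^sub>R Y" "y t - a - t *\<^sub>R X"] elim by linarith
    also have "\<dots> = \<bar>t\<bar> * ((C + D) * \<bar>t\<bar>)" by (simp add: algebra_simps power2_eq_square)
    finally have "\<bar>t\<bar> * norm (X - Y) \<le> \<bar>t\<bar> * ((C + D) * \<bar>t\<bar>)"
      by (simp only: norm_scaleR)
    then show ?case using elim by (cases "t = 0") auto
  qed
  moreover have "((\<lambda>t::real. (C + D) * \<bar>t\<bar>) \<longlongrightarrow> 0) (at 0)" by (auto intro!: tendsto_eq_intros)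
  ultimately have "norm (X - Y) \<le> 0" by (intro tendsto_lowerbound[where F = "at (0::real)"]) auto
  then show ?thesis by simp
qed

lemma second_order_scale:
  assumes "second_order y a X" shows "second_order (\<lambda>t. y (k * t)) a (k *\<^sub>R X)"
proof -
  obtain C where C: "\<forall>\<^sub>F t in nhds 0. norm (y t - a - t *\<^sub>R X) \<le> C * t\<^sup>2"
    using assms unfolding second_order_def by blast
  have "filterlim (\<lambda>t. k * t) (nhds (k * 0)) (nhds (0::real))" by (intro tendsto_intros filterlim_ident)
  then have "\<forall>\<^sub>F t in nhds 0. norm (y (k * t) - a - (k * t) *\<^sub>R X) \<le> C * (k * t)\<^sup>2"
    using eventually_compose_filterlim[OF C] by simp
  then show ?thesis unfolding second_order_def
    by (intro exI[of _ "C * k\<^sup>2"]) (simp add: power_mult_distrib mult_ac)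
qed

section \<open>Multiplication in a chart around the unit, and velocities with quadratic
  error\<close>

locale lie_group_chart = lie_group_on G for G :: "('g, 'e::euclidean_space) lie_group" (structure) +
  fixes c :: "('g, 'e) chart"
  assumes c: "c \<in> atlas G" "\<one> \<in> fst c"
begin

abbreviation x0 :: 'e where "x0 \<equiv> snd c \<one>"

abbreviation \<psi> :: "'e \<Rightarrow> 'g" where "\<psi> \<equiv> cinv c"

abbreviation \<Omega> :: "('e \<times> 'e) set" where "\<Omega> \<equiv> mult_dom c c c"

definition Mc :: "'e \<times> 'e \<Rightarrow> 'e" where
  "Mc = in_charts (fst c \<times> fst c, map_prod (snd c) (snd c)) c (\<lambda>(p, q). p \<otimes> q)"

lemma Mc: "open \<Omega>" "smooth_on \<Omega> Mc" "(x0, x0) \<in> \<Omega>"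
  using mult_in_charts[OF c(1) c(1) c(1)] c mult_domI[of \<one> c \<one> c c] unfolding Mc_def by auto

lemma Mc_chart:
  assumes "p \<in> fst c" "q \<in> fst c" "p \<otimes> q \<in> fst c"
  shows "Mc (snd c p, snd c q) = snd c (p \<otimes> q)"
  using mult_in_charts(3)[OF c(1) c(1) c(1) mult_domI[OF assms]] assms c cinv_chart unfolding Mc_def by simp

lemma \<psi>_chart: "p \<in> fst c \<Longrightarrow> \<psi> (snd c p) = p"
  using cinv_chart c by blast

lemma \<psi>_x0: "\<psi> x0 = \<one>"
  using \<psi>_chart c by blast

lemma chart_inj: "\<lbrakk>p \<in> fst c; q \<in> fst c; snd c p = snd c q\<rbrakk> \<Longrightarrow> p = q"
  using \<psi>_chart by metis

lemma \<psi>_in: "x \<in> snd c ` fst c \<Longrightarrow> \<psi> x \<in> fst c \<and> snd c (\<psi> x) = x"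
  by (simp add: f_inv_into_f inv_into_into)

lemma x0_in: "x0 \<in> snd c ` fst c"
  using c by blast

text \<open>With either factor frozen at the unit, multiplication is the identity, and a linear map
  on a product is determined by its restrictions to the two axes.\<close>

lemma Mc_derivative: "(Mc has_derivative (\<lambda>(u, v). u + v)) (at (x0, x0))"
proof -
  let ?L = "frechet_derivative Mc (at (x0, x0))"
  have L: "(Mc has_derivative ?L) (at (x0, x0))"
    by (rule C1_at_has_derivative[OF smooth_on_C1_at[OF Mc]])
  have V: "open (snd c ` fst c)" using open_chart c by blast
  have 1: "?L (u, 0) = u" for u
  proof -
    have "((\<lambda>x. (x, x0)) has_derivative (\<lambda>u. (u, 0))) (at x0)" by (auto intro!: derivative_eq_intros)
    from has_derivative_compose[OF this L]
    have "((\<lambda>x. Mc (x, x0)) has_derivative (\<lambda>u. ?L (u, 0))) (at x0)" .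
    moreover have "((\<lambda>x. Mc (x, x0)) has_derivative (\<lambda>u. u)) (at x0)"
    proof (rule has_derivative_transform_within_open[OF has_derivative_ident V x0_in])
      show "x = Mc (x, x0)" if "x \<in> snd c ` fst c" for x
        using that Mc_chart[of _ \<one>] c chart_carrier by auto
    qed
    ultimately show ?thesis using has_derivative_unique by metis
  qed
  have 2: "?L (0, v) = v" for v
  proof -
    have "((\<lambda>y. (x0, y)) has_derivative (\<lambda>v. (0, v))) (at x0)" by (auto intro!: derivative_eq_intros)
    from has_derivative_compose[OF this L]
    have "((\<lambda>y. Mc (x0, y)) has_derivative (\<lambda>v. ?L (0, v))) (at x0)" .
    moreover have "((\<lambda>y. Mc (x0, y)) has_derivative (\<lambda>v. v)) (at x0)"
    proof (rule has_derivative_transform_within_open[OF has_derivative_ident V x0_in])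
      show "y = Mc (x0, y)" if "y \<in> snd c ` fst c" for y
        using that Mc_chart[of \<one>] c chart_carrier by auto
    qed
    ultimately show ?thesis using has_derivative_unique by metis
  qed
  have "?L (u, v) = u + v" for u v
    using linear_add[OF has_derivative_linear[OF L], of "(u, 0)" "(0, v)"] 1 2 by simp
  then have "?L = (\<lambda>(u, v). u + v)" by auto
  with L show ?thesis by simp
qed

lemma Mc_frechet: "frechet_derivative Mc (at (x0, x0)) (u, v) = u + v"
  using frechet_derivative_at[OF Mc_derivative] by (metis (mono_tags) case_prod_conv)

definition velocity2 :: "(real \<Rightarrow> 'g) \<Rightarrow> 'e \<Rightarrow> bool" where
  "velocity2 \<beta> X \<longleftrightarrow> (\<forall>\<^sub>F t in nhds 0. \<beta> t \<in> fst c) \<and> second_order (\<lambda>t. snd c (\<beta> t)) x0 X"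

lemma velocity2_cong:
  assumes "velocity2 \<beta> X" and ev: "\<forall>\<^sub>F t in nhds 0. \<beta> t = \<gamma> t"
  shows "velocity2 \<gamma> X"
proof -
  obtain C where b: "\<forall>\<^sub>F t in nhds 0. \<beta> t \<in> fst c"
    and C: "\<forall>\<^sub>F t in nhds 0. norm (snd c (\<beta> t) - x0 - t *\<^sub>R X) \<le> C * t\<^sup>2"
    using assms(1) unfolding velocity2_def second_order_def by blast
  have "\<forall>\<^sub>F t in nhds 0. \<gamma> t \<in> fst c" using b ev by eventually_elim simp
  moreover have "\<forall>\<^sub>F t in nhds 0. norm (snd c (\<gamma> t) - x0 - t *\<^sub>R X) \<le> C * t\<^sup>2"
    using C ev by eventually_elim simp
  ultimately show ?thesis unfolding velocity2_def second_order_def by blast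
qed

lemma velocity2_mult:
  assumes "velocity2 \<beta> X" "velocity2 \<gamma> Y"
  shows "velocity2 (\<lambda>t. \<beta> t \<otimes> \<gamma> t) (X + Y)"
proof -
  let ?y = "\<lambda>t. (snd c (\<beta> t), snd c (\<gamma> t))"
  have so: "second_order ?y (x0, x0) (X, Y)"
    using assms by (intro second_order_Pair) (auto simp: velocity2_def)
  have "\<forall>\<^sub>F t in nhds 0. ?y t \<in> \<Omega>"
    using topological_tendstoD[OF second_order_tendsto[OF so]] Mc by blast
  moreover have "\<forall>\<^sub>F t in nhds 0. \<beta> t \<in> fst c" "\<forall>\<^sub>F t in nhds 0. \<gamma> t \<in> fst c"
    using assms by (auto simp: velocity2_def)
  ultimately have ev: "\<forall>\<^sub>F t in nhds 0. \<beta> t \<otimes> \<gamma> t \<in> fst c \<and> snd c (\<beta> t \<otimes> \<gamma> t) = Mc (?y t)"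
  proof eventually_elim
    case (elim t)
    then show ?case using mult_domD c Mc_chart by auto
  qed
  have "Mc (x0, x0) = x0" using Mc_chart[of \<one> \<one>] c by simp
  with second_order_compose[OF Mc so] have "second_order (\<lambda>t. Mc (?y t)) x0 (X + Y)"
    by (simp add: Mc_frechet)
  then obtain C where "\<forall>\<^sub>F t in nhds 0. norm (Mc (?y t) - x0 - t *\<^sub>R (X + Y)) \<le> C * t\<^sup>2"
    unfolding second_order_def by blast
  with ev have "\<forall>\<^sub>F t in nhds 0. norm (snd c (\<beta> t \<otimes> \<gamma> t) - x0 - t *\<^sub>R (X + Y)) \<le> C * t\<^sup>2"
    by eventually_elim simp
  then show ?thesis
    using ev unfolding velocity2_def second_order_def by (auto elim: eventually_mono)
qed

lemma velocity2_one: "velocity2 (\<lambda>_. \<one>) 0"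
  unfolding velocity2_def second_order_def using c by (auto intro: exI[of _ 0])

lemma velocity2_pow: "velocity2 \<beta> X \<Longrightarrow> velocity2 (\<lambda>t. \<beta> t [^] (n::nat)) (of_nat n *\<^sub>R X)"
proof (induction n)
  case (Suc n)
  then show ?case using velocity2_mult[of "\<lambda>t. \<beta> t [^] n" "of_nat n *\<^sub>R X" \<beta> X] by (simp add: algebra_simps)
qed (simp add: velocity2_one)

lemma velocity2_scale:
  assumes "velocity2 \<beta> X" shows "velocity2 (\<lambda>t. \<beta> (k * t)) (k *\<^sub>R X)"
proof -
  have "filterlim (\<lambda>t. k * t) (nhds (k * 0)) (nhds (0::real))" by (intro tendsto_intros filterlim_ident)
  then show ?thesis
    using assms unfolding velocity2_def by (auto intro: second_order_scale simp: filterlim_iff)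
qed

lemma velocity2_unique: "velocity2 \<beta> X \<Longrightarrow> velocity2 \<beta> Y \<Longrightarrow> X = Y"
  unfolding velocity2_def using second_order_unique by blast

text \<open>Smoothness of inversion only shows that some velocity \<open>?Y\<close> exists; it is
  identified by the constant product of the curve with its inverse, whose velocity is the
  sum.\<close>

lemma velocity2_inv:
  assumes "velocity2 \<beta> X"
  shows "velocity2 (\<lambda>t. inv (\<beta> t)) (- X)"
proof -
  let ?S = "snd c ` {p \<in> fst c. inv p \<in> fst c}"
  let ?J = "in_charts c c (\<lambda>p. inv p)"
  have S: "open ?S" "smooth_on ?S ?J"
    using smooth_inv c by (auto simp: smooth_map_def intro!: chart_on_open_domain[OF chart _ chart_openin])
  have x: "x0 \<in> ?S" using c by auto
  have so: "second_order (\<lambda>t. snd c (\<beta> t)) x0 X" using assms by (simp add: velocity2_def)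
  let ?Y = "frechet_derivative ?J (at x0) X"
  have "\<forall>\<^sub>F t in nhds 0. snd c (\<beta> t) \<in> ?S"
    using topological_tendstoD[OF second_order_tendsto[OF so]] S x by blast
  moreover have b: "\<forall>\<^sub>F t in nhds 0. \<beta> t \<in> fst c" using assms by (simp add: velocity2_def)
  ultimately have ev: "\<forall>\<^sub>F t in nhds 0. inv (\<beta> t) \<in> fst c \<and> snd c (inv (\<beta> t)) = ?J (snd c (\<beta> t))"
  proof eventually_elim
    case (elim t)
    then show ?case using \<psi>_chart chart_inj by (auto simp: in_charts_def)
  qed
  have "?J x0 = x0" by (simp add: in_charts_def \<psi>_x0)
  with second_order_compose[OF S x so] obtain C where
    "\<forall>\<^sub>F t in nhds 0. norm (?J (snd c (\<beta> t)) - x0 - t *\<^sub>R ?Y) \<le> C * t\<^sup>2"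
    unfolding second_order_def by auto
  with ev have "\<forall>\<^sub>F t in nhds 0. norm (snd c (inv (\<beta> t)) - x0 - t *\<^sub>R ?Y) \<le> C * t\<^sup>2"
    by eventually_elim simp
  then have v: "velocity2 (\<lambda>t. inv (\<beta> t)) ?Y"
    using ev unfolding velocity2_def second_order_def by (auto elim: eventually_mono)
  have "\<forall>\<^sub>F t in nhds 0. \<beta> t \<otimes> inv (\<beta> t) = \<one>"
    using b by eventually_elim (simp add: chart_carrier[OF c(1)])
  moreover have "velocity2 (\<lambda>t. \<beta> t \<otimes> inv (\<beta> t)) (X + ?Y)"
    by (rule velocity2_mult[OF assms v])
  ultimately have "velocity2 (\<lambda>_. \<one>) (X + ?Y)"
    by (rule velocity2_cong[rotated])
  then have "?Y = - X" using velocity2_unique[OF velocity2_one] by (metis add_eq_0_iff)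
  with v show ?thesis by simp
qed

end

section \<open>One-parameter subgroups from the linearised squaring map\<close>

context lie_group_chart
begin

definition sq :: "'e \<Rightarrow> 'e" where
  "sq z = Mc (x0 + z, x0 + z) - x0"

text \<open>Squaring is multiplication after the diagonal map. The differential (u, v) \<mapsto> u +
  v thus becomes doubling, and the Lipschitz constant K of the derivative becomes 4K, since the
  diagonal has norm at most 2 and enters twice.\<close>

lemma sq_expanding:
  obtains T' M R \<rho> where "smooth_expanding_map sq T' M R" "0 < \<rho>" "2 * \<rho> \<le> R" "4 * M * \<rho> \<le> 1"
    "\<And>z. norm z < R \<Longrightarrow> (x0 + z, x0 + z) \<in> \<Omega>"
proof -
  obtain r K f' where f': "r > 0" "K \<ge> 0" "ball (x0, x0) r \<subseteq> \<Omega>"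
    "\<And>y. y \<in> ball (x0, x0) r \<Longrightarrow> (Mc has_derivative blinfun_apply (f' y)) (at y)"
    "\<And>y z. \<lbrakk>y \<in> ball (x0, x0) r; z \<in> ball (x0, x0) r\<rbrakk> \<Longrightarrow> norm (f' y - f' z) \<le> K * norm (y - z)"
    using smooth_on_lipschitz_derivative[OF Mc] by metis
  have bl: "bounded_linear (\<lambda>v::'e. (v, v))" by (intro bounded_linear_intros)
  define \<delta> where "\<delta> = Blinfun (\<lambda>v::'e. (v, v))"
  have \<delta>: "blinfun_apply \<delta> = (\<lambda>v. (v, v))" unfolding \<delta>_def by (rule bounded_linear_Blinfun_apply[OF bl])
  have n2: "norm (v, v) \<le> 2 * norm v" for v :: 'e using norm_Pair_le[of v v] by simp
  have n\<delta>: "norm \<delta> \<le> 2" by (rule norm_blinfun_bound) (auto simp: \<delta> n2)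
  define T' where "T' z = f' (x0 + z, x0 + z) o\<^sub>L \<delta>" for z
  \<comment> \<open>The second bound gives 3 (4K) R \<le> 1, and r/2 keeps the diagonal points
    inside the ball of radius r.\<close>
  define R where "R = min (r/2) (1 / (12 * K + 1))"
  have R: "0 < R" "R \<le> r/2" "12 * K * R \<le> 1"
  proof -
    have p: "12 * K + 1 > 0" using f' by simp
    show "0 < R" "R \<le> r/2" using f' p by (auto simp: R_def)
    have "12 * K * R \<le> 12 * K * (1 / (12 * K + 1))"
      using f'(2) by (intro mult_left_mono) (auto simp: R_def)
    also have "\<dots> \<le> 1" using p f'(2) by (simp add: divide_le_eq)
    finally show "12 * K * R \<le> 1" .
  qed
  have inb: "(x0 + z, x0 + z) \<in> ball (x0, x0) r" if "norm z < R" for z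
  proof -
    have "dist (x0, x0) (x0 + z, x0 + z) = norm (z, z)"
      by (simp add: dist_norm norm_minus_commute norm_Pair dist_Pair_Pair)
    then show ?thesis using n2[of z] that R by simp
  qed
  have "smooth_expanding_map sq T' (4 * K) R"
  proof
    show "sq 0 = 0" using Mc_chart[of \<one> \<one>] c by (simp add: sq_def)
    show "T' 0 v = 2 *\<^sub>R v" for v
    proof -
      have "blinfun_apply (f' (x0, x0)) = frechet_derivative Mc (at (x0, x0))"
        using frechet_derivative_at[OF f'(4)[of "(x0, x0)"]] f'(1) by simp
      then show ?thesis by (simp add: T'_def \<delta> Mc_frechet scaleR_2)
    qed
    show "(sq has_derivative T' z) (at z)" if "norm z < R" for z
    proof -
      have "((\<lambda>z. (x0 + z, x0 + z)) has_derivative (\<lambda>v. (v, v))) (at z)" by (auto intro!: derivative_eq_intros)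
      from has_derivative_compose[OF this f'(4)[OF inb[OF that]]]
      have "((\<lambda>z. Mc (x0 + z, x0 + z) - x0) has_derivative (\<lambda>v. f' (x0 + z, x0 + z) (v, v))) (at z)"
        by (auto intro!: derivative_eq_intros)
      moreover have "blinfun_apply (T' z) = (\<lambda>v. f' (x0 + z, x0 + z) (v, v))" by (auto simp: T'_def \<delta>)
      ultimately show ?thesis by (simp add: sq_def[abs_def])
    qed
    show "norm (T' x - T' y) \<le> 4 * K * norm (x - y)" if "norm x < R" "norm y < R" for x y
    proof -
      have "T' x - T' y = (f' (x0 + x, x0 + x) - f' (x0 + y, x0 + y)) o\<^sub>L \<delta>"
        by (rule blinfun_eqI) (simp add: T'_def blinfun.diff_left)
      then have "norm (T' x - T' y) \<le> norm (f' (x0 + x, x0 + x) - f' (x0 + y, x0 + y)) * norm \<delta>"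
        by (simp add: norm_blinfun_compose)
      also have "\<dots> \<le> (K * norm ((x0 + x, x0 + x) - (x0 + y, x0 + y))) * 2"
        using f'(2) by (intro mult_mono f'(5) inb that n\<delta>) auto
      also have "\<dots> \<le> (K * (2 * norm (x - y))) * 2"
        using f'(2) n2[of "x - y"] by (intro mult_right_mono mult_left_mono) auto
      finally show ?thesis by simp
    qed
  qed (use f' R in auto)
  moreover obtain \<rho> where "0 < \<rho>" "2 * \<rho> \<le> R" "4 * (4 * K) * \<rho> \<le> 1"
  proof
    show "0 < R / 2" "2 * (R / 2) \<le> R" using R by auto
    show "4 * (4 * K) * (R / 2) \<le> 1" using R by simp
  qed
  ultimately show thesis using inb f'(3) by (intro that[of T' "4 * K" R \<rho>]) auto
qed

text \<open>All properties are packed into one existential because the linearisation depends on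
  constants that are chosen inside the proof. The local map \<open>e\<close> is extended to the
  whole space by taking the 2^n-th power of its value at X / 2^n.\<close>

lemma exp_exists:
  "\<exists>E::'e \<Rightarrow> 'g. (\<forall>X. gC1 E X) \<and> (\<forall>X. E X = E ((1/2) *\<^sub>R X) \<otimes> E ((1/2) *\<^sub>R X))
     \<and> ((\<lambda>X. snd c (E X)) has_derivative (\<lambda>h. h)) (at 0) \<and> E 0 = \<one>
     \<and> (\<forall>X. velocity2 (\<lambda>t. E (t *\<^sub>R X)) X)
     \<and> (\<forall>\<beta> X. (\<forall>t. \<beta> t \<in> carrier G \<and> \<beta> t = \<beta> (t/2) \<otimes> \<beta> (t/2)) \<longrightarrow> velocity2 \<beta> X \<longrightarrow> (\<forall>t. \<beta> t = E (t *\<^sub>R X)))"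
proof -
  obtain T' M R \<rho> where sm: "smooth_expanding_map sq T' M R" and rho: "0 < \<rho>" "2 * \<rho> \<le> R" "4 * M * \<rho> \<le> 1"
    and \<Omega>: "\<And>z. norm z < R \<Longrightarrow> (x0 + z, x0 + z) \<in> \<Omega>"
    using sq_expanding by metis
  interpret s: smooth_expanding_map sq T' M R by (rule sm)
  interpret m: expanding_map sq "2 * M" R \<rho> by (rule s.T_expanding[OF rho])
  have half: "norm ((1/2) *\<^sub>R X) < \<rho>" if "norm X < \<rho>" for X :: 'e using that rho by simp
  have in_c: "\<psi> (x0 + z) \<in> fst c" "snd c (\<psi> (x0 + z)) = x0 + z"
    and sq: "\<psi> (x0 + z) \<otimes> \<psi> (x0 + z) \<in> fst c" "snd c (\<psi> (x0 + z) \<otimes> \<psi> (x0 + z)) = x0 + sq z"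
    if z: "norm z < R" for z
  proof -
    have "x0 + z \<in> snd c ` fst c" using \<Omega>[OF z] unfolding mult_dom_def by auto
    then show *: "\<psi> (x0 + z) \<in> fst c" "snd c (\<psi> (x0 + z)) = x0 + z" using \<psi>_in by auto
    then show "\<psi> (x0 + z) \<otimes> \<psi> (x0 + z) \<in> fst c"
      using mult_domD[of c "\<psi> (x0 + z)" c "\<psi> (x0 + z)" c] \<Omega>[OF z] c by simp
    then show "snd c (\<psi> (x0 + z) \<otimes> \<psi> (x0 + z)) = x0 + sq z"
      using Mc_chart[OF *(1) *(1)] * by (simp add: sq_def)
  qed
  define e where "e X = \<psi> (x0 + m.linz X)" for X
  have e_c: "e X \<in> fst c" "snd c (e X) = x0 + m.linz X" if "norm X < \<rho>" for X
    using in_c[OF m.linz_near(3)[OF that]] by (auto simp: e_def)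
  have e_dbl: "e X = e ((1/2) *\<^sub>R X) \<otimes> e ((1/2) *\<^sub>R X)" if X: "norm X < \<rho>" for X
    using sq[OF m.linz_near(3)[OF half[OF X]]] e_c[OF X] e_c[OF half[OF X]] m.linz_double[OF X]
    by (intro chart_inj) (auto simp: e_def)
  \<comment> \<open>By doubling, the value does not depend on \<open>n\<close> once X / 2^n is
    small.\<close>
  define P where "P X n = (e ((1/2)^n *\<^sub>R X)) [^] ((2::nat)^n)" for X n
  have P_Suc: "P X (Suc n) = P X n" if "norm ((1/2)^n *\<^sub>R X) < \<rho>" for X n
  proof -
    let ?Y = "(1/2)^n *\<^sub>R X"
    have Y: "(1/2)^Suc n *\<^sub>R X = (1/2) *\<^sub>R ?Y" by simp
    have car: "e ((1/2) *\<^sub>R ?Y) \<in> carrier G"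
      using e_c(1)[OF half[OF that]] c chart_carrier by blast
    have "P X (Suc n) = (e ((1/2) *\<^sub>R ?Y) [^] (2::nat)) [^] ((2::nat)^n)"
      unfolding P_def Y using car by (simp add: nat_pow_pow)
    also have "e ((1/2) *\<^sub>R ?Y) [^] (2::nat) = e ?Y"
      using car e_dbl[OF that] by (simp add: numeral_2_eq_2)
    finally show ?thesis by (simp add: P_def)
  qed
  have small_mono: "norm ((1/2)^m *\<^sub>R X) < \<rho>" if "norm ((1/2)^n *\<^sub>R X) < \<rho>" "n \<le> m" for X :: 'e and n m
  proof -
    have "(1/2::real)^m \<le> (1/2)^n" using that(2) by (intro power_decreasing) auto
    then have "(1/2)^m * norm X \<le> (1/2)^n * norm X" by (rule mult_right_mono) simp
    then show ?thesis using that(1) by simp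
  qed
  have P_eq: "P X m = P X n" if "norm ((1/2)^n *\<^sub>R X) < \<rho>" "n \<le> m" for X n m
    using that(2)
  proof (induction m rule: dec_induct)
    case (step k)
    then show ?case using P_Suc small_mono[OF that(1)] by simp
  qed simp
  have ex_small: "\<exists>n. norm ((1/2)^n *\<^sub>R X) < r" if "r > 0" for X :: 'e and r :: real
  proof -
    have "(\<lambda>n. (1/2)^n *\<^sub>R X) \<longlonglongrightarrow> 0 *\<^sub>R X"
      by (intro tendsto_intros LIMSEQ_power_zero) auto
    then have "\<forall>\<^sub>F n in sequentially. dist ((1/2)^n *\<^sub>R X) 0 < r"
      using that by (intro tendstoD) auto
    then show ?thesis by (auto simp: eventually_sequentially)
  qed
  \<comment> \<open>The least exponent is only a selection; \<open>E_P\<close> allows any admissible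
    one.\<close>
  define E where "E X = P X (LEAST n. norm ((1/2)^n *\<^sub>R X) < \<rho>)" for X
  have E_P: "E X = P X n" if n: "norm ((1/2)^n *\<^sub>R X) < \<rho>" for X n
    unfolding E_def
    using P_eq[OF LeastI[of "\<lambda>n. norm ((1/2)^n *\<^sub>R X) < \<rho>", OF n] Least_le[of "\<lambda>n. norm ((1/2)^n *\<^sub>R X) < \<rho>", OF n]] by simp
  have E_e: "E X = e X" if "norm X < \<rho>" for X
  proof -
    have "e X \<in> carrier G" using e_c(1)[OF that] c chart_carrier by blast
    then show ?thesis using E_P[of 0 X] that by (simp add: P_def)
  qed
  have E_dbl: "E X = E ((1/2) *\<^sub>R X) \<otimes> E ((1/2) *\<^sub>R X)" for X
  proof -
    obtain n where n: "norm ((1/2)^n *\<^sub>R X) < \<rho>" using ex_small rho by blast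
    have n': "norm ((1/2)^n *\<^sub>R (1/2) *\<^sub>R X) < \<rho>" using half[OF n] by simp
    have car: "e ((1/2)^n *\<^sub>R (1/2) *\<^sub>R X) \<in> carrier G" using e_c(1)[OF n'] c chart_carrier by blast
    have "E X = P X (Suc n)" using P_Suc[OF n] E_P[OF n] by simp
    also have "\<dots> = P ((1/2) *\<^sub>R X) n \<otimes> P ((1/2) *\<^sub>R X) n"
      unfolding P_def using car by (simp add: nat_pow_mult mult.commute mult_2)
    finally show ?thesis using E_P[OF n'] by simp
  qed
  have E_C1: "gC1 E X" for X
  proof -
    obtain n where n: "norm ((1/2)^n *\<^sub>R X) < \<rho>/2" using ex_small[of "\<rho>/2"] rho by auto
    \<comment> \<open>One exponent serves a whole neighbourhood of X, on which the extension is a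
      fixed power of a C^1 map.\<close>
    let ?S = "{Y::'e. norm ((1/2)^n *\<^sub>R Y) < \<rho>/2}"
    have "open ?S" by (intro open_Collect_less continuous_intros)
    then have "\<forall>\<^sub>F Y in nhds X. Y \<in> ?S" using n by (intro eventually_nhds_in_open) auto
    then have ev: "\<forall>\<^sub>F Y in nhds X. e ((1/2)^n *\<^sub>R Y) [^] ((2::nat)^n) = E Y"
    proof eventually_elim
      case (elim Y)
      then have "norm ((1/2)^n *\<^sub>R Y) < \<rho>" using rho by simp
      from E_P[OF this] show ?case by (simp add: P_def)
    qed
    have 1: "C1_at (\<lambda>Y. (1/2)^n *\<^sub>R Y) X" by (intro C1_at_bounded_linear bounded_linear_intros)
    have 2: "C1_at (\<lambda>Z. x0 + m.linz Z) ((1/2)^n *\<^sub>R X)"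
      by (rule C1_at_compose[OF C1_at_Pair[OF C1_at_const s.linz_C1[OF rho n]] C1_at_bounded_linear[of "\<lambda>p. fst p + snd p"], simplified])
        (intro bounded_linear_intros)
    have "gC1 \<psi> (x0 + m.linz ((1/2)^n *\<^sub>R X))"
    proof (rule gC1_cinv[OF c(1)])
      have "norm ((1/2)^n *\<^sub>R X) < \<rho>" using n rho by simp
      then show "x0 + m.linz ((1/2)^n *\<^sub>R X) \<in> snd c ` fst c" using e_c by (metis image_eqI)
    qed
    then have "gC1 e ((1/2)^n *\<^sub>R X)" unfolding e_def by (intro gC1_compose[OF _ 2])
    then have "gC1 (\<lambda>Y. e ((1/2)^n *\<^sub>R Y)) X" by (rule gC1_compose[OF _ 1])
    then show ?thesis by (rule gC1_cong[OF gC1_pow ev])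
  qed
  have near0: "\<forall>\<^sub>F X in nhds (0::'e). norm X < \<rho>"
    using eventually_nhds_in_open[OF open_ball, of "0::'e" 0 \<rho>] rho by (simp add: mem_ball_0 del: mem_ball)
  have E_d: "((\<lambda>X. snd c (E X)) has_derivative (\<lambda>h. h)) (at 0)"
  proof (rule has_derivative_transform_within_open[of "\<lambda>X. x0 + m.linz X" _ _ _ "ball 0 \<rho>"])
    show "((\<lambda>X. x0 + m.linz X) has_derivative (\<lambda>h. h)) (at 0)"
      using m.linz_has_derivative_0 by (auto intro!: derivative_eq_intros)
  qed (use rho E_e e_c in auto)
  have E_0: "E 0 = \<one>" using E_e[of 0] rho by (simp add: e_def m.linz_0 \<psi>_x0)
  have E_v: "velocity2 (\<lambda>t. E (t *\<^sub>R X)) X" for X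
  proof -
    have "((\<lambda>t. t *\<^sub>R X) \<longlongrightarrow> 0 *\<^sub>R X) (nhds (0::real))" by (intro tendsto_intros filterlim_ident)
    then have "((\<lambda>t. t *\<^sub>R X) \<longlongrightarrow> 0) (nhds (0::real))" by simp
    then have ev: "\<forall>\<^sub>F t in nhds (0::real). norm (t *\<^sub>R X) < \<rho>"
      by (rule eventually_compose_filterlim[OF near0])
    then have "\<forall>\<^sub>F t in nhds 0. E (t *\<^sub>R X) \<in> fst c" by eventually_elim (simp add: E_e e_c)
    moreover have "\<forall>\<^sub>F t in nhds 0. norm (snd c (E (t *\<^sub>R X)) - x0 - t *\<^sub>R X) \<le> (2 * (2 * M) * (norm X)\<^sup>2) * t\<^sup>2"
      using ev
    proof eventually_elim
      case (elim t)
      then show ?case using m.linz_near(1)[OF elim] by (simp add: E_e e_c power_mult_distrib mult_ac)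
    qed
    ultimately show ?thesis unfolding velocity2_def second_order_def by blast
  qed
  have E_unique: "\<beta> t = E (t *\<^sub>R X)"
    if car: "\<And>t. \<beta> t \<in> carrier G" and dbl: "\<And>t. \<beta> t = \<beta> (t/2) \<otimes> \<beta> (t/2)" and v: "velocity2 \<beta> X" for \<beta> X t
  proof -
    define y where "y t = snd c (\<beta> t) - x0" for t
    obtain C where b: "\<forall>\<^sub>F t in nhds 0. \<beta> t \<in> fst c" and C: "\<forall>\<^sub>F t in nhds 0. norm (y t - t *\<^sub>R X) \<le> C * t\<^sup>2"
      using v unfolding velocity2_def second_order_def y_def by blast
    have "((\<lambda>t. snd c (\<beta> t)) \<longlongrightarrow> x0) (nhds 0)"
      using v second_order_tendsto unfolding velocity2_def by blast
    then have "(y \<longlongrightarrow> 0) (nhds 0)" unfolding y_def by (simp add: LIM_zero_iff)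
    then have r: "\<forall>\<^sub>F t in nhds 0. norm (y t) < R" using tendstoD[of y 0 "nhds 0" R] s.R by simp
    obtain \<epsilon>1 where e1: "\<epsilon>1 > 0" "\<And>t. \<bar>t\<bar> < \<epsilon>1 \<Longrightarrow> \<beta> t \<in> fst c \<and> norm (y t - t *\<^sub>R X) \<le> C * t\<^sup>2 \<and> norm (y t) < R"
      using eventually_conj[OF b eventually_conj[OF C r]]
      unfolding eventually_nhds_metric by (auto simp: dist_norm)
    define \<epsilon> where "\<epsilon> = min \<epsilon>1 (\<rho> / (norm X + 1))"
    have pX: "norm X + 1 > 0" by (smt (verit) norm_ge_zero)
    have eps: "\<epsilon> > 0" "\<epsilon> \<le> \<epsilon>1" using e1 rho pX by (auto simp: \<epsilon>_def)
    have sm: "norm (t *\<^sub>R X) < \<rho>" if "\<bar>t\<bar> < \<epsilon>" for t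
    proof -
      have "\<bar>t\<bar> * (norm X + 1) < \<rho>" using that pX by (simp add: \<epsilon>_def pos_less_divide_eq)
      then show ?thesis using mult_left_mono[of "norm X" "norm X + 1" "\<bar>t\<bar>"] by simp
    qed
    have local: "\<beta> t = E (t *\<^sub>R X)" if t: "\<bar>t\<bar> < \<epsilon>" for t
    proof -
      have "y t = m.linz (t *\<^sub>R X)"
      proof (rule m.linz_unique[where \<epsilon> = \<epsilon>1 and C = C])
        fix t assume t: "\<bar>t\<bar> < \<epsilon>1"
        then have h: "\<bar>t/2\<bar> < \<epsilon>1" by simp
        have "\<psi> (x0 + y (t/2)) = \<beta> (t/2)" using e1(2)[OF h] \<psi>_chart by (simp add: y_def)
        then show "y t = sq (y (t/2))"
          using sq(2)[of "y (t/2)"] e1(2)[OF h] dbl[of t] by (simp add: y_def)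
      qed (use e1 t eps sm in auto)
      then have "snd c (\<beta> t) = snd c (e (t *\<^sub>R X))" using e_c(2)[OF sm[OF t]] by (simp add: y_def algebra_simps)
      then have "\<beta> t = e (t *\<^sub>R X)" using e1(2)[of t] t eps e_c(1)[OF sm[OF t]] chart_inj by auto
      then show ?thesis using E_e[OF sm[OF t]] by simp
    qed
    \<comment> \<open>Both curves satisfy the doubling equation, so agreement on an interval spreads
      to the interval of twice the length.\<close>
    have glob: "\<beta> t = E (t *\<^sub>R X)" if "\<bar>t\<bar> < \<epsilon> * 2^n" for n t
      using that
    proof (induction n arbitrary: t)
      case (Suc n)
      then have "\<bar>t/2\<bar> < \<epsilon> * 2^n" by simp
      from Suc.IH[OF this] show ?case using dbl[of t] E_dbl[of "t *\<^sub>R X"] by simp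
    qed (simp add: local)
    obtain n where "\<bar>t\<bar> / \<epsilon> < 2^n" using real_arch_pow[of 2 "\<bar>t\<bar> / \<epsilon>"] by auto
    then show ?thesis using glob[of t n] eps by (simp add: pos_divide_less_eq mult.commute)
  qed
  show ?thesis using E_C1 E_dbl E_d E_0 E_v E_unique by (intro exI[of _ E]) blast
qed

text \<open>The choice is in fact unique: the last property, applied to the curve t \<mapsto> E'(t
  X) of another candidate E', identifies the two.\<close>

definition Exp :: "'e \<Rightarrow> 'g" where
  "Exp = (SOME E::'e \<Rightarrow> 'g. (\<forall>X. gC1 E X) \<and> (\<forall>X. E X = E ((1/2) *\<^sub>R X) \<otimes> E ((1/2) *\<^sub>R X))
     \<and> ((\<lambda>X. snd c (E X)) has_derivative (\<lambda>h. h)) (at 0) \<and> E 0 = \<one>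
     \<and> (\<forall>X. velocity2 (\<lambda>t. E (t *\<^sub>R X)) X)
     \<and> (\<forall>\<beta> X. (\<forall>t. \<beta> t \<in> carrier G \<and> \<beta> t = \<beta> (t/2) \<otimes> \<beta> (t/2)) \<longrightarrow> velocity2 \<beta> X \<longrightarrow> (\<forall>t. \<beta> t = E (t *\<^sub>R X))))"

lemmas Exp_props = someI_ex[OF exp_exists, folded Exp_def]

lemma Exp_C1: "gC1 Exp X" using Exp_props by blast

lemma Exp_carrier [simp]: "Exp X \<in> carrier G" using gC1_carrier[OF Exp_C1] .

lemma Exp_double: "Exp X = Exp ((1/2) *\<^sub>R X) \<otimes> Exp ((1/2) *\<^sub>R X)" using Exp_props by blast

lemma Exp_has_derivative_0: "((\<lambda>X. snd c (Exp X)) has_derivative (\<lambda>h. h)) (at 0)"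
  using Exp_props by blast

lemma Exp_0 [simp]: "Exp 0 = \<one>" using Exp_props by blast

lemma Exp_velocity2: "velocity2 (\<lambda>t. Exp (t *\<^sub>R X)) X" using Exp_props by blast

lemma Exp_unique_double:
  "\<lbrakk>\<And>t. \<beta> t \<in> carrier G; \<And>t. \<beta> t = \<beta> (t/2) \<otimes> \<beta> (t/2); velocity2 \<beta> X\<rbrakk> \<Longrightarrow> \<beta> t = Exp (t *\<^sub>R X)"
  using Exp_props by blast

text \<open>The m-th power of t \<mapsto> Exp(t X / m) satisfies the doubling equation, because an
  element commutes with itself, and has velocity m (X / m) = X.\<close>

lemma Exp_nat: "Exp (of_nat m *\<^sub>R X) = Exp X [^] (m::nat)"
proof (cases "m = 0")
  case False
  have "Exp ((1/m) *\<^sub>R t *\<^sub>R X) [^] m = Exp (t *\<^sub>R X)" for t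
  proof (rule Exp_unique_double[where \<beta> = "\<lambda>t. Exp ((1/m) *\<^sub>R t *\<^sub>R X) [^] m"])
    fix t :: real
    let ?a = "Exp ((1/m) *\<^sub>R (t/2) *\<^sub>R X)"
    have h: "(1/2) *\<^sub>R (1/m) *\<^sub>R t *\<^sub>R X = (1/m) *\<^sub>R (t/2) *\<^sub>R X" by simp
    have "Exp ((1/m) *\<^sub>R t *\<^sub>R X) = ?a \<otimes> ?a"
      using Exp_double[of "(1/m) *\<^sub>R t *\<^sub>R X"] unfolding h .
    then have "Exp ((1/m) *\<^sub>R t *\<^sub>R X) [^] m = (?a \<otimes> ?a) [^] m" by (rule arg_cong)
    also have "\<dots> = ?a [^] m \<otimes> ?a [^] m" by (rule pow_mult_distrib) auto
    finally show "Exp ((1/m) *\<^sub>R t *\<^sub>R X) [^] m = ?a [^] m \<otimes> ?a [^] m" .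
  next
    have "velocity2 (\<lambda>t. Exp ((1/m * t) *\<^sub>R X)) ((1/m) *\<^sub>R X)"
      by (rule velocity2_scale[OF Exp_velocity2])
    from velocity2_pow[OF this, of m] show "velocity2 (\<lambda>t. Exp ((1/m) *\<^sub>R t *\<^sub>R X) [^] m) X"
      using False by simp
  qed simp
  from this[of "real m"] show ?thesis using False by simp
qed simp

text \<open>The inverse curve inherits doubling and has the opposite velocity.\<close>

lemma Exp_minus: "Exp (- X) = inv (Exp X)"
proof -
  have "inv (Exp (t *\<^sub>R X)) = Exp (t *\<^sub>R (- X))" for t
  proof (rule Exp_unique_double[where \<beta> = "\<lambda>t. inv (Exp (t *\<^sub>R X))"])
    show "inv (Exp (t *\<^sub>R X)) = inv (Exp ((t/2) *\<^sub>R X)) \<otimes> inv (Exp ((t/2) *\<^sub>R X))" for t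
      using Exp_double[of "t *\<^sub>R X"] by (simp add: inv_mult_group)
  qed (auto intro: velocity2_inv Exp_velocity2)
  from this[of 1] show ?thesis by simp
qed

lemma Exp_int: "Exp (of_int k *\<^sub>R X) = Exp X [^] (k::int)"
proof (cases "k \<ge> 0")
  case True
  then have "real_of_int k = real (nat k)" by simp
  then have "Exp (of_int k *\<^sub>R X) = Exp X [^] nat k" by (simp only: Exp_nat)
  then show ?thesis unfolding int_pow_def2 using True by simp
next
  case False
  then have "real_of_int k = - real (nat (- k))" by simp
  then have "of_int k *\<^sub>R X = - (real (nat (- k)) *\<^sub>R X)" by (simp only: scaleR_minus_left)
  then have "Exp (of_int k *\<^sub>R X) = inv (Exp X [^] nat (- k))"
    by (simp only: Exp_minus Exp_nat)
  then show ?thesis unfolding int_pow_def2 using False by simp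
qed

text \<open>With a common denominator both factors are integer powers of one element.\<close>

lemma Exp_rat_add:
  assumes "s \<in> \<rat>" "t \<in> \<rat>"
  shows "Exp ((s + t) *\<^sub>R X) = Exp (s *\<^sub>R X) \<otimes> Exp (t *\<^sub>R X)"
proof -
  obtain i m where i: "m > 0" "s = of_int i / of_int m" using assms(1) by (meson Rats_cases')
  obtain j n where j: "n > 0" "t = of_int j / of_int n" using assms(2) by (meson Rats_cases')
  define Y where "Y = (1 / (of_int m * of_int n)) *\<^sub>R X"
  have st: "s *\<^sub>R X = of_int (i * n) *\<^sub>R Y" "t *\<^sub>R X = of_int (j * m) *\<^sub>R Y"
    using i j by (simp_all add: Y_def field_simps)
  then have "(s + t) *\<^sub>R X = of_int (i * n + j * m) *\<^sub>R Y"
    by (simp only: scaleR_add_left of_int_add)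
  then show ?thesis unfolding st by (simp only: Exp_int) (simp add: int_pow_mult)
qed

text \<open>Both sides are continuous in (s, t) and agree on the dense set of rational pairs; the
  group is Hausdorff.\<close>

lemma Exp_add: "Exp ((s + t) *\<^sub>R X) = Exp (s *\<^sub>R X) \<otimes> Exp (t *\<^sub>R X)"
proof -
  let ?f = "\<lambda>(s::real, t::real). Exp ((s + t) *\<^sub>R X)" and ?g = "\<lambda>(s, t). Exp (s *\<^sub>R X) \<otimes> Exp (t *\<^sub>R X)"
  have "?f (s, t) = ?g (s, t)"
  proof (rule forall_in_closure_of_eq[where X = euclidean and S = "\<rat> \<times> \<rat>"])
    show "(s, t) \<in> euclidean closure_of (\<rat> \<times> \<rat>)"
      by (simp add: closure_Times Rats_closure_real)
    have "gC1 (\<lambda>p. Exp ((fst p + snd p) *\<^sub>R X)) x" for x :: "real \<times> real"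
      by (rule gC1_compose[OF Exp_C1]) (intro C1_at_bounded_linear bounded_linear_intros)
    then show "continuous_map euclidean (topol G) ?f"
      unfolding case_prod_unfold by (rule gC1_continuous_map)
    have "gC1 (\<lambda>p. Exp (fst p *\<^sub>R X) \<otimes> Exp (snd p *\<^sub>R X)) x" for x :: "real \<times> real"
      by (intro gC1_mult gC1_compose[OF Exp_C1] C1_at_bounded_linear bounded_linear_intros)
    then show "continuous_map euclidean (topol G) ?g"
      unfolding case_prod_unfold by (rule gC1_continuous_map)
    show "?f p = ?g p" if "p \<in> \<rat> \<times> \<rat>" for p
      using that Exp_rat_add by auto
  qed (rule Hausdorff_G)
  then show ?thesis by simp
qed

end

section \<open>Integral curves and the adjoint representation\<close>

context lie_group_chart
begin

text \<open>The logarithmic derivative beta^{-1} beta', taken in the fixed chart at the unit. Plain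
  differentiability is asked, which is what evaluation of a geodesic of the loop group at a point of
  the circle provides.\<close>

definition left_velocity :: "(real \<Rightarrow> 'g) \<Rightarrow> real \<Rightarrow> 'e \<Rightarrow> bool" where
  "left_velocity \<beta> t X \<longleftrightarrow> (\<forall>\<^sub>F t' in nhds t. inv (\<beta> t) \<otimes> \<beta> t' \<in> fst c) \<and>
     ((\<lambda>t'. snd c (inv (\<beta> t) \<otimes> \<beta> t')) has_derivative (\<lambda>h. h *\<^sub>R X)) (at t)"

lemma inv_cancel: "\<lbrakk>a \<in> carrier G; b \<in> carrier G\<rbrakk> \<Longrightarrow> inv a \<otimes> (a \<otimes> b) = b \<and> a \<otimes> (inv a \<otimes> b) = b"
  using m_assoc[of "inv a" a b] m_assoc[of a "inv a" b] by simp

lemma gC1_\<psi>: "gC1 \<psi> x0"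
  using gC1_cinv c x0_in by blast

lemma gC1_compose_Exp: "C1_at h x \<Longrightarrow> gC1 (\<lambda>y. Exp (h y)) x"
  using gC1_compose[OF Exp_C1] .

text \<open>Near \<open>t0\<close> the curve translated by its value at \<open>t0\<close> has
  coordinates in a single chart, and these have zero derivative. Local constancy spreads over the
  connected line.\<close>

lemma left_velocity_zero_const:
  assumes car: "\<And>t. \<delta> t \<in> carrier G" and v: "\<And>t. left_velocity \<delta> t 0"
  shows "\<delta> s = \<delta> t"
proof (rule connected_local_const[OF connected_UNIV UNIV_I UNIV_I ballI])
  fix t0
  obtain \<epsilon> where eps: "\<epsilon> > 0" "\<And>t. dist t t0 < \<epsilon> \<Longrightarrow> inv (\<delta> t0) \<otimes> \<delta> t \<in> fst c"
    using v[of t0] unfolding left_velocity_def eventually_nhds_metric by blast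
  define y where "y t = snd c (inv (\<delta> t0) \<otimes> \<delta> t)" for t
  have d: "(y has_derivative (\<lambda>h. 0)) (at t)" if t: "dist t t0 < \<epsilon>" for t
  proof -
    let ?b = "inv (\<delta> t0) \<otimes> \<delta> t"
    \<comment> \<open>Left translation by \<open>?b\<close> in the chart; it carries the
      displacement measured from time t to the one measured from \<open>t0\<close>.\<close>
    let ?K = "\<lambda>x. snd c (?b \<otimes> \<psi> x)"
    have b: "?b \<in> fst c" "?b \<in> carrier G" using eps(2)[OF t] car by auto
    have "gC1 (\<lambda>x. ?b \<otimes> \<psi> x) x0" by (intro gC1_mult gC1_const gC1_\<psi> b)
    then have "C1_at ?K x0" using b by (intro gC1_chart(2)[OF _ c(1)]) (simp_all add: \<psi>_x0)
    then have K: "(?K has_derivative frechet_derivative ?K (at x0)) (at (snd c (inv (\<delta> t) \<otimes> \<delta> t)))"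
      using C1_at_has_derivative car by simp
    have z: "((\<lambda>t'. snd c (inv (\<delta> t) \<otimes> \<delta> t')) has_derivative (\<lambda>h. h *\<^sub>R 0)) (at t)"
      and ev: "\<forall>\<^sub>F t' in nhds t. inv (\<delta> t) \<otimes> \<delta> t' \<in> fst c"
      using v[of t] unfolding left_velocity_def by auto
    have "linear (frechet_derivative ?K (at x0))" using K has_derivative_linear by blast
    then have "((\<lambda>t'. ?K (snd c (inv (\<delta> t) \<otimes> \<delta> t'))) has_derivative (\<lambda>h. 0)) (at t)"
      using has_derivative_compose[OF z K] by (simp add: linear_0)
    then show ?thesis
    proof (rule has_derivative_eventually_cong)
      show "\<forall>\<^sub>F t' in nhds t. ?K (snd c (inv (\<delta> t) \<otimes> \<delta> t')) = y t'"
        using ev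
      proof eventually_elim
        case (elim t')
        have "?b \<otimes> (inv (\<delta> t) \<otimes> \<delta> t') = inv (\<delta> t0) \<otimes> \<delta> t'"
          using car by (simp add: m_assoc inv_cancel)
        then show ?case using elim by (simp add: \<psi>_chart y_def)
      qed
    qed
  qed
  have "\<delta> t0 = \<delta> t" if t: "dist t t0 < \<epsilon>" for t
  proof -
    have "y t = y t0"
    proof (rule has_derivative_zero_unique[of "ball t0 \<epsilon>" y])
      show "(y has_derivative (\<lambda>h. 0)) (at x within ball t0 \<epsilon>)" if "x \<in> ball t0 \<epsilon>" for x
        using that by (intro has_derivative_at_withinI[OF d]) (simp add: dist_commute)
    qed (use eps t in \<open>auto simp: dist_commute\<close>)
    then have "inv (\<delta> t0) \<otimes> \<delta> t = inv (\<delta> t0) \<otimes> \<delta> t0"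
      using eps t unfolding y_def by (intro chart_inj) auto
    then have "\<delta> t0 \<otimes> (inv (\<delta> t0) \<otimes> \<delta> t) = \<delta> t0" using car by simp
    then show ?thesis using car inv_cancel by simp
  qed
  then show "\<forall>\<^sub>F t in at t0 within UNIV. \<delta> t0 = \<delta> t"
    using eps unfolding eventually_at by blast
qed

lemma Exp_diff: "inv (Exp (t *\<^sub>R X)) \<otimes> Exp (t' *\<^sub>R X) = Exp ((t' - t) *\<^sub>R X)"
  using Exp_add[of "- t" t' X] Exp_minus[of "t *\<^sub>R X"] by simp

lemma left_velocity_Exp: "left_velocity (\<lambda>t. Exp (t *\<^sub>R X)) t X"
proof -
  have d: "((\<lambda>t'. (t' - t) *\<^sub>R X) has_derivative (\<lambda>h. h *\<^sub>R X)) (at t)"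
    by (auto intro!: derivative_eq_intros)
  have "((\<lambda>X. snd c (Exp X)) has_derivative (\<lambda>h. h)) (at ((t - t) *\<^sub>R X))"
    using Exp_has_derivative_0 by simp
  note 1 = has_derivative_compose[OF d this]
  have "C1_at (\<lambda>t'. (t' - t) *\<^sub>R X) t"
    by (rule C1_at_compose[OF _ C1_at_bounded_linear[of "\<lambda>s. s *\<^sub>R X"]],
      rule C1_atI[of UNIV _ _ "\<lambda>_. id_blinfun"])
      (auto intro!: derivative_eq_intros bounded_linear_intros)
  then have "gC1 (\<lambda>t'. Exp ((t' - t) *\<^sub>R X)) t" by (rule gC1_compose_Exp)
  then have "\<forall>\<^sub>F t' in nhds t. Exp ((t' - t) *\<^sub>R X) \<in> fst c"
    using c by (intro gC1_chart(1)) auto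
  with 1 show ?thesis by (simp add: left_velocity_def Exp_diff)
qed

section \<open>The adjoint representation and uniqueness of integral curves\<close>

definition conj_chart :: "'g \<Rightarrow> 'e \<Rightarrow> 'e" where
  "conj_chart a x = snd c (a \<otimes> \<psi> x \<otimes> inv a)"

definition Ad :: "'g \<Rightarrow> 'e \<Rightarrow> 'e" where
  "Ad a = frechet_derivative (conj_chart a) (at x0)"

lemma conj_chart_C1:
  assumes "a \<in> carrier G"
  shows "C1_at (conj_chart a) x0" "\<forall>\<^sub>F x in nhds x0. a \<otimes> \<psi> x \<otimes> inv a \<in> fst c" "conj_chart a x0 = x0"
proof -
  have "gC1 (\<lambda>x. a \<otimes> \<psi> x \<otimes> inv a) x0" by (intro gC1_mult gC1_const gC1_\<psi> inv_closed assms)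
  moreover have "a \<otimes> \<psi> x0 \<otimes> inv a = \<one>" using assms by (simp add: \<psi>_x0)
  ultimately show "C1_at (conj_chart a) x0" "\<forall>\<^sub>F x in nhds x0. a \<otimes> \<psi> x \<otimes> inv a \<in> fst c"
    using gC1_chart[of _ x0 c] c unfolding conj_chart_def[abs_def] by auto
  show "conj_chart a x0 = x0" using assms by (simp add: conj_chart_def \<psi>_x0)
qed

lemma Ad_has_derivative: "a \<in> carrier G \<Longrightarrow> (conj_chart a has_derivative Ad a) (at x0)"
  unfolding Ad_def by (intro C1_at_has_derivative conj_chart_C1)

lemma linear_Ad: "a \<in> carrier G \<Longrightarrow> linear (Ad a)"
  using Ad_has_derivative has_derivative_linear by blast

lemma eventually_nhds_tendsto_chart:
  assumes "(y has_derivative D) (at t)" "y t = x0" "\<forall>\<^sub>F x in nhds x0. P x"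
  shows "\<forall>\<^sub>F t' in nhds t. P (y t')"
proof -
  have "isCont y t" using assms(1) has_derivative_continuous by blast
  then have "(y \<longlongrightarrow> x0) (nhds t)" using assms(2) by (rule isCont_tendsto_nhds)
  then show ?thesis by (rule eventually_compose_filterlim[OF assms(3)])
qed

lemma left_velocity_conj:
  assumes a: "a \<in> carrier G" and car: "\<And>t. \<beta> t \<in> carrier G" and v: "left_velocity \<beta> t X"
  shows "left_velocity (\<lambda>t. a \<otimes> \<beta> t \<otimes> inv a) t (Ad a X)"
proof -
  let ?z = "\<lambda>t'. snd c (inv (\<beta> t) \<otimes> \<beta> t')"
  have z: "(?z has_derivative (\<lambda>h. h *\<^sub>R X)) (at t)"
    and ev: "\<forall>\<^sub>F t' in nhds t. inv (\<beta> t) \<otimes> \<beta> t' \<in> fst c"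
    using v unfolding left_velocity_def by auto
  have zt: "?z t = x0" using car by simp
  have eq: "inv (a \<otimes> \<beta> t \<otimes> inv a) \<otimes> (a \<otimes> \<beta> t' \<otimes> inv a) = a \<otimes> (inv (\<beta> t) \<otimes> \<beta> t') \<otimes> inv a" for t'
  proof -
    have "inv (a \<otimes> \<beta> t \<otimes> inv a) = a \<otimes> inv (\<beta> t) \<otimes> inv a"
      using a car by (simp add: inv_mult_group m_assoc)
    then show ?thesis using a car by (simp add: m_assoc inv_cancel)
  qed
  have e2: "\<forall>\<^sub>F t' in nhds t. a \<otimes> \<psi> (?z t') \<otimes> inv a \<in> fst c"
    by (rule eventually_nhds_tendsto_chart[OF z zt conj_chart_C1(2)[OF a]])
  have "(conj_chart a has_derivative Ad a) (at (?z t))" using Ad_has_derivative[OF a] zt by simp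
  from has_derivative_compose[OF z this]
  have d: "((\<lambda>t'. conj_chart a (?z t')) has_derivative (\<lambda>h. h *\<^sub>R Ad a X)) (at t)"
    by (simp add: linear_scale[OF linear_Ad[OF a]])
  have "((\<lambda>t'. snd c (a \<otimes> (inv (\<beta> t) \<otimes> \<beta> t') \<otimes> inv a)) has_derivative (\<lambda>h. h *\<^sub>R Ad a X)) (at t)"
    by (rule has_derivative_eventually_cong[OF d]) (use ev in eventually_elim, simp add: conj_chart_def \<psi>_chart)
  moreover have "\<forall>\<^sub>F t' in nhds t. a \<otimes> (inv (\<beta> t) \<otimes> \<beta> t') \<otimes> inv a \<in> fst c"
    using e2 ev by eventually_elim (simp add: \<psi>_chart)
  ultimately show ?thesis by (simp add: left_velocity_def eq)
qed

text \<open>The curve beta(t) Exp(-t X) has zero left velocity: up to conjugation its displacement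
  is a product of two displacements with velocities X and -X, and these cancel because
  multiplication has differential u + v at the unit.\<close>

theorem integral_curve_unique:
  assumes car: "\<And>t. \<beta> t \<in> carrier G" and v: "\<And>t. left_velocity \<beta> t X" and "\<beta> 0 = \<one>"
  shows "\<beta> t = Exp (t *\<^sub>R X)"
proof -
  define \<delta> where "\<delta> t = \<beta> t \<otimes> Exp (t *\<^sub>R (- X))" for t
  have v\<delta>: "left_velocity \<delta> t 0" for t
  proof -
    let ?z1 = "\<lambda>t'. snd c (inv (\<beta> t) \<otimes> \<beta> t')"
    let ?z2 = "\<lambda>t'. snd c (inv (Exp (t *\<^sub>R (- X))) \<otimes> Exp (t' *\<^sub>R (- X)))"
    let ?q = "\<lambda>t'. (inv (\<beta> t) \<otimes> \<beta> t') \<otimes> (inv (Exp (t *\<^sub>R (- X))) \<otimes> Exp (t' *\<^sub>R (- X)))"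
    have 1: "(?z1 has_derivative (\<lambda>h. h *\<^sub>R X)) (at t)" "\<forall>\<^sub>F t' in nhds t. inv (\<beta> t) \<otimes> \<beta> t' \<in> fst c"
      using v[of t] unfolding left_velocity_def by auto
    have 2: "(?z2 has_derivative (\<lambda>h. h *\<^sub>R (- X))) (at t)"
       "\<forall>\<^sub>F t' in nhds t. inv (Exp (t *\<^sub>R (- X))) \<otimes> Exp (t' *\<^sub>R (- X)) \<in> fst c"
      using left_velocity_Exp[of "- X" t] unfolding left_velocity_def by auto
    have p: "((\<lambda>t'. (?z1 t', ?z2 t')) has_derivative (\<lambda>h. (h *\<^sub>R X, h *\<^sub>R (- X)))) (at t)"
      by (rule has_derivative_Pair[OF 1(1) 2(1)])
    have pt: "(?z1 t, ?z2 t) = (x0, x0)" using car by simp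
    have "(Mc has_derivative (\<lambda>(u, v). u + v)) (at (?z1 t, ?z2 t))" unfolding pt by (rule Mc_derivative)
    from has_derivative_compose[OF p this]
    have d: "((\<lambda>t'. Mc (?z1 t', ?z2 t')) has_derivative (\<lambda>h. 0)) (at t)" by simp
    have "isCont (\<lambda>t'. (?z1 t', ?z2 t')) t" using p has_derivative_continuous by blast
    then have "((\<lambda>t'. (?z1 t', ?z2 t')) \<longlongrightarrow> (x0, x0)) (nhds t)"
      using pt by (rule isCont_tendsto_nhds)
    then have "\<forall>\<^sub>F t' in nhds t. (?z1 t', ?z2 t') \<in> \<Omega>" using topological_tendstoD Mc by blast
    with 1(2) 2(2) have ev: "\<forall>\<^sub>F t' in nhds t. ?q t' \<in> fst c \<and> Mc (?z1 t', ?z2 t') = snd c (?q t')"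
    proof eventually_elim
      case (elim t')
      then show ?case using mult_domD[OF elim(3) c(1) c(1) elim(1,2)] Mc_chart by blast
    qed
    have dq: "((\<lambda>t'. snd c (?q t')) has_derivative (\<lambda>h. 0)) (at t)"
      by (rule has_derivative_eventually_cong[OF d]) (use ev in eventually_elim, simp)
    let ?a = "Exp (t *\<^sub>R X)"
    have a: "inv (Exp (t *\<^sub>R (- X))) = ?a" using Exp_minus[of "t *\<^sub>R (- X)"] by simp
    \<comment> \<open>Conjugation by \<open>?a\<close> can be inserted because \<open>?a\<close>
      commutes with the values of its own one-parameter subgroup.\<close>
    have eq: "inv (\<delta> t) \<otimes> \<delta> t' = ?a \<otimes> ?q t' \<otimes> inv ?a" for t'
    proof -
      have "?a \<otimes> ?q t' \<otimes> inv ?a = ?a \<otimes> (inv (\<beta> t) \<otimes> \<beta> t') \<otimes> (?a \<otimes> Exp (t' *\<^sub>R (- X)) \<otimes> inv ?a)"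
        using car unfolding a by (simp add: m_assoc)
      also have "?a \<otimes> Exp (t' *\<^sub>R (- X)) \<otimes> inv ?a = Exp (t' *\<^sub>R (- X))"
        using Exp_add[of t "- t'" X] Exp_add[of "t - t'" "- t" X] Exp_minus[of "t *\<^sub>R X"] by simp
      also have "?a \<otimes> (inv (\<beta> t) \<otimes> \<beta> t') \<otimes> Exp (t' *\<^sub>R (- X)) = inv (\<delta> t) \<otimes> \<delta> t'"
        using car by (simp add: \<delta>_def inv_mult_group a m_assoc del: scaleR_minus_right)
      finally show ?thesis ..
    qed
    have q0: "snd c (?q t) = x0" using car by simp
    have "(conj_chart ?a has_derivative Ad ?a) (at (snd c (?q t)))" unfolding q0 by (rule Ad_has_derivative) simp
    from has_derivative_compose[OF dq this]
    have d': "((\<lambda>t'. conj_chart ?a (snd c (?q t'))) has_derivative (\<lambda>h. 0)) (at t)"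
      by (simp add: linear_0[OF linear_Ad])
    have e2: "\<forall>\<^sub>F t' in nhds t. ?a \<otimes> \<psi> (snd c (?q t')) \<otimes> inv ?a \<in> fst c"
      by (rule eventually_nhds_tendsto_chart[OF dq q0 conj_chart_C1(2)]) simp
    have "((\<lambda>t'. snd c (?a \<otimes> ?q t' \<otimes> inv ?a)) has_derivative (\<lambda>h. 0)) (at t)"
    proof (rule has_derivative_eventually_cong[OF d'])
      show "\<forall>\<^sub>F t' in nhds t. conj_chart ?a (snd c (?q t')) = snd c (?a \<otimes> ?q t' \<otimes> inv ?a)"
        using ev by eventually_elim (simp only: conj_chart_def \<psi>_chart)
    qed
    moreover have "\<forall>\<^sub>F t' in nhds t. ?a \<otimes> ?q t' \<otimes> inv ?a \<in> fst c"
      using e2 ev by eventually_elim (simp only: \<psi>_chart)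
    ultimately show ?thesis unfolding left_velocity_def eq by simp
  qed
  have "\<delta> t = \<delta> 0"
    by (rule left_velocity_zero_const[OF _ v\<delta>]) (simp add: \<delta>_def car)
  then have "\<beta> t \<otimes> Exp (t *\<^sub>R (- X)) = \<one>" by (simp add: \<delta>_def assms(3))
  then have "\<beta> t = inv (Exp (t *\<^sub>R (- X)))"
    using car by (metis Exp_carrier inv_equality inv_inv)
  then show ?thesis using Exp_minus[of "t *\<^sub>R (- X)"] by simp
qed

text \<open>Conjugating an integral curve by \<open>a\<close> gives a curve with constant left
  velocity \<open>Ad a X\<close>.\<close>

lemma Exp_Ad:
  assumes a: "a \<in> carrier G"
  shows "Exp (Ad a X) = a \<otimes> Exp X \<otimes> inv a"
proof -
  have "a \<otimes> Exp (1 *\<^sub>R X) \<otimes> inv a = Exp (1 *\<^sub>R Ad a X)"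
    by (rule integral_curve_unique[where \<beta> = "\<lambda>t. a \<otimes> Exp (t *\<^sub>R X) \<otimes> inv a"])
      (use a in \<open>auto intro!: left_velocity_conj left_velocity_Exp\<close>)
  then show ?thesis by simp
qed

lemma Ad_mult:
  assumes a: "a \<in> carrier G" and b: "b \<in> carrier G"
  shows "Ad (a \<otimes> b) X = Ad a (Ad b X)"
proof -
  have "(conj_chart a has_derivative Ad a) (at (conj_chart b x0))"
    using Ad_has_derivative[OF a] conj_chart_C1(3)[OF b] by simp
  from has_derivative_compose[OF Ad_has_derivative[OF b] this]
  have d: "((\<lambda>x. conj_chart a (conj_chart b x)) has_derivative (\<lambda>h. Ad a (Ad b h))) (at x0)" .
  have "\<forall>\<^sub>F x in nhds x0. x \<in> snd c ` fst c"
    using open_chart[OF c(1)] x0_in by (rule eventually_nhds_in_open)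
  with conj_chart_C1(2)[OF b]
  have "\<forall>\<^sub>F x in nhds x0. conj_chart a (conj_chart b x) = conj_chart (a \<otimes> b) x"
  proof eventually_elim
    case (elim x)
    then have "\<psi> x \<in> carrier G" using \<psi>_in chart_carrier c by blast
    then show ?case using elim a b
      by (simp add: conj_chart_def \<psi>_chart inv_mult_group m_assoc)
  qed
  from has_derivative_eventually_cong[OF d this]
  have "((conj_chart (a \<otimes> b)) has_derivative (\<lambda>h. Ad a (Ad b h))) (at x0)" .
  then show ?thesis using has_derivative_unique[OF Ad_has_derivative] a b by (metis m_closed)
qed

lemma Ad_one: "Ad \<one> X = X"
proof -
  have "\<forall>\<^sub>F x in nhds x0. x \<in> snd c ` fst c"
    using open_chart[OF c(1)] x0_in by (rule eventually_nhds_in_open)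
  then have "\<forall>\<^sub>F x in nhds x0. x = conj_chart \<one> x"
  proof eventually_elim
    case (elim x)
    then show ?case using \<psi>_in[OF elim] chart_carrier[OF c(1), of "\<psi> x"] by (simp add: conj_chart_def)
  qed
  from has_derivative_eventually_cong[OF has_derivative_ident this]
  show ?thesis using has_derivative_unique[OF Ad_has_derivative[OF one_closed]] by metis
qed

section \<open>The Lie bracket\<close>

text \<open>The mixed second partial derivative of multiplication at the unit, \<open>u\<close> in
  the first factor and \<open>v\<close> in the second. Its antisymmetric part is the Lie
  bracket.\<close>

definition mixed :: "'e \<Rightarrow> 'e \<Rightarrow> 'e" where
  "mixed u v = frechet_derivative (\<lambda>z. frechet_derivative Mc (at z) (0, v)) (at (x0, x0)) (u, 0)"

lemma Mc_has_derivative: "z \<in> \<Omega> \<Longrightarrow> (Mc has_derivative frechet_derivative Mc (at z)) (at z)"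
  by (rule C1_at_has_derivative[OF smooth_on_C1_at[OF Mc(1,2)]])

lemma linear_Mc': "z \<in> \<Omega> \<Longrightarrow> linear (frechet_derivative Mc (at z))"
  using Mc_has_derivative has_derivative_linear by blast

lemma left_field_Mc:
  assumes x: "x \<in> snd c ` fst c"
  shows "left_field G c v x = frechet_derivative Mc (at (x, x0)) (0, v)"
proof -
  have p: "\<psi> x \<in> fst c" "snd c (\<psi> x) = x" "\<psi> x \<in> carrier G" using \<psi>_in[OF x] chart_carrier[OF c(1)] by auto
  have om: "(x, x0) \<in> \<Omega>" using mult_domI[of "\<psi> x" c \<one> c c] p c by simp
  have "((\<lambda>y. (x, y)) has_derivative (\<lambda>v. (0, v))) (at x0)" by (auto intro!: derivative_eq_intros)
  from has_derivative_compose[OF this Mc_has_derivative[OF om]]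
  have d: "((\<lambda>y. Mc (x, y)) has_derivative (\<lambda>v. frechet_derivative Mc (at (x, x0)) (0, v))) (at x0)" .
  have 1: "\<forall>\<^sub>F y in nhds x0. y \<in> snd c ` fst c"
    using open_chart[OF c(1)] x0_in by (rule eventually_nhds_in_open)
  have "((\<lambda>y. (x, y)) \<longlongrightarrow> (x, x0)) (nhds x0)" by (intro tendsto_intros filterlim_ident)
  then have 2: "\<forall>\<^sub>F y in nhds x0. (x, y) \<in> \<Omega>" using topological_tendstoD Mc(1) om by blast
  have "\<forall>\<^sub>F y in nhds x0. Mc (x, y) = in_charts c c (\<lambda>q. \<psi> x \<otimes> q) y"
    using 1 2
  proof eventually_elim
    case (elim y)
    have q: "\<psi> y \<in> fst c" "snd c (\<psi> y) = y" using \<psi>_in[OF elim(1)] by auto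
    have "\<psi> x \<otimes> \<psi> y \<in> fst c" using mult_domD[of c "\<psi> x" c "\<psi> y" c] elim(2) p q c by simp
    then show ?case using Mc_chart[OF p(1) q(1)] p q by (simp add: in_charts_def)
  qed
  from has_derivative_eventually_cong[OF d this] show ?thesis
    unfolding left_field_def differential_def
    using frechet_derivative_at by metis
qed

lemma left_field_has_derivative: "(left_field G c v has_derivative (\<lambda>u. mixed u v)) (at x0)"
proof -
  have p: "((\<lambda>x. (x, x0)) has_derivative (\<lambda>u. (u, 0))) (at x0)" by (auto intro!: derivative_eq_intros)
  have "((\<lambda>z. frechet_derivative Mc (at z) (0, v)) has_derivative
      frechet_derivative (\<lambda>z. frechet_derivative Mc (at z) (0, v)) (at (x0, x0))) (at (x0, x0))"
    by (rule C1_at_has_derivative[OF smooth_on_derivative_C1_at[OF Mc]])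
  from has_derivative_compose[OF p this]
  have d: "((\<lambda>x. frechet_derivative Mc (at (x, x0)) (0, v)) has_derivative (\<lambda>u. mixed u v)) (at x0)"
    by (simp add: mixed_def)
  have "\<forall>\<^sub>F x in nhds x0. x \<in> snd c ` fst c"
    using open_chart[OF c(1)] x0_in by (rule eventually_nhds_in_open)
  then have "\<forall>\<^sub>F x in nhds x0. frechet_derivative Mc (at (x, x0)) (0, v) = left_field G c v x"
    by eventually_elim (simp add: left_field_Mc)
  from has_derivative_eventually_cong[OF d this] show ?thesis .
qed

text \<open>The function is the right invariant field of \<open>v\<close>. Differentiating it
  produces the mixed derivative in the opposite order, so symmetry of second derivatives exchanges
  the arguments of \<open>mixed\<close> compared with
  \<open>left_field_has_derivative\<close>.\<close>

lemma right_field_has_derivative: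
  "((\<lambda>x. frechet_derivative Mc (at (x0, x)) (v, 0)) has_derivative (\<lambda>u. mixed v u)) (at x0)"
proof -
  have p: "((\<lambda>x. (x0, x)) has_derivative (\<lambda>u. (0, u))) (at x0)" by (auto intro!: derivative_eq_intros)
  have "((\<lambda>z. frechet_derivative Mc (at z) (v, 0)) has_derivative
      frechet_derivative (\<lambda>z. frechet_derivative Mc (at z) (v, 0)) (at (x0, x0))) (at (x0, x0))"
    by (rule C1_at_has_derivative[OF smooth_on_derivative_C1_at[OF Mc]])
  from has_derivative_compose[OF p this] show ?thesis
    by (simp add: mixed_def smooth_on_second_derivative_symmetric[OF Mc, of "(v, 0)"])
qed

lemma lie_bracket_mixed: "lie_bracket G c u v = mixed u v - mixed v u"
  unfolding lie_bracket_def
  using frechet_derivative_at[OF left_field_has_derivative[of u]] frechet_derivative_at[OF left_field_has_derivative[of v]]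
  by metis

text \<open>Linearity in the second argument holds for the first derivative at every point near the
  unit and is inherited by differentiating that identity.\<close>

lemma bilinear_mixed: "bilinear mixed"
  unfolding bilinear_def
proof (intro conjI allI)
  fix v
  show "linear (\<lambda>u. mixed u v)" using left_field_has_derivative has_derivative_linear by blast
next
  fix u
  let ?f = "\<lambda>v z. frechet_derivative Mc (at z) (0, v)"
  have d: "(?f v has_derivative frechet_derivative (?f v) (at (x0, x0))) (at (x0, x0))" for v
    by (rule C1_at_has_derivative[OF smooth_on_derivative_C1_at[OF Mc]])
  have ev: "\<forall>\<^sub>F z in nhds (x0, x0). z \<in> \<Omega>" using Mc by (intro eventually_nhds_in_open)
  show "linear (mixed u)"
  proof (rule linearI)
    fix v w
    have "\<forall>\<^sub>F z in nhds (x0, x0). ?f v z + ?f w z = ?f (v + w) z"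
      using ev by eventually_elim (use linear_add[OF linear_Mc', of _ "(0, v)" "(0, w)" for v w] in simp)
    from fun_cong[OF frechet_derivative_at[OF has_derivative_eventually_cong[OF has_derivative_add[OF d d] this]], of "(u, 0)"]
    show "mixed u (v + w) = mixed u v + mixed u w" by (simp add: mixed_def)
  next
    fix r v
    have "\<forall>\<^sub>F z in nhds (x0, x0). r *\<^sub>R ?f v z = ?f (r *\<^sub>R v) z"
      using ev by eventually_elim (use linear_scale[OF linear_Mc', of _ r "(0, v)" for r v] in simp)
    from fun_cong[OF frechet_derivative_at[OF has_derivative_eventually_cong[OF has_derivative_scaleR_right[OF d] this]], of "(u, 0)"]
    show "mixed u (r *\<^sub>R v) = r *\<^sub>R mixed u v" by (simp add: mixed_def)
  qed
qed

lemma bilinear_lie_bracket: "bilinear (lie_bracket G c)"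
  using bilinear_mixed unfolding bilinear_def lie_bracket_mixed[abs_def]
  by (auto intro!: linear_compose_sub)

lemma lie_bracket_antisym: "lie_bracket G c u v = - lie_bracket G c v u"
  by (simp add: lie_bracket_mixed)

text \<open>The identity $p q = (p q p^{-1}) p$, differentiated at \<open>q = \<one>\<close>.\<close>

lemma left_field_right_field_Ad:
  assumes p: "p \<in> fst c"
  shows "left_field G c v (snd c p) = frechet_derivative Mc (at (x0, snd c p)) (Ad p v, 0)"
proof -
  have pc: "p \<in> carrier G" using p chart_carrier c by blast
  let ?x = "snd c p"
  have om: "(?x, x0) \<in> \<Omega>" "(x0, ?x) \<in> \<Omega>"
    using mult_domI[of p c \<one> c c] mult_domI[of \<one> c p c c] p pc c by simp_all
  have "((\<lambda>y. (?x, y)) has_derivative (\<lambda>v. (0, v))) (at x0)" by (auto intro!: derivative_eq_intros)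
  from has_derivative_compose[OF this Mc_has_derivative[OF om(1)]]
  have d1: "((\<lambda>y. Mc (?x, y)) has_derivative (\<lambda>v. frechet_derivative Mc (at (?x, x0)) (0, v))) (at x0)" .
  have p2: "((\<lambda>y. (conj_chart p y, ?x)) has_derivative (\<lambda>v. (Ad p v, 0))) (at x0)"
    by (intro has_derivative_Pair Ad_has_derivative[OF pc] has_derivative_const)
  have "(Mc has_derivative frechet_derivative Mc (at (x0, ?x))) (at (conj_chart p x0, ?x))"
    using Mc_has_derivative[OF om(2)] conj_chart_C1(3)[OF pc] by simp
  from has_derivative_compose[OF p2 this]
  have d2: "((\<lambda>y. Mc (conj_chart p y, ?x)) has_derivative (\<lambda>v. frechet_derivative Mc (at (x0, ?x)) (Ad p v, 0))) (at x0)" .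
  have 1: "\<forall>\<^sub>F y in nhds x0. y \<in> snd c ` fst c"
    using open_chart[OF c(1)] x0_in by (rule eventually_nhds_in_open)
  have "((\<lambda>y. (?x, y)) \<longlongrightarrow> (?x, x0)) (nhds x0)" by (intro tendsto_intros filterlim_ident)
  then have 2: "\<forall>\<^sub>F y in nhds x0. (?x, y) \<in> \<Omega>" using topological_tendstoD Mc(1) om by blast
  have "\<forall>\<^sub>F y in nhds x0. Mc (?x, y) = Mc (conj_chart p y, ?x)"
    using 1 2 conj_chart_C1(2)[OF pc]
  proof eventually_elim
    case (elim y)
    have q: "\<psi> y \<in> fst c" "snd c (\<psi> y) = y" "\<psi> y \<in> carrier G" using \<psi>_in[OF elim(1)] chart_carrier[OF c(1)] by auto
    have pq: "p \<otimes> \<psi> y \<in> fst c" using mult_domD[of c p c "\<psi> y" c] elim(2) p q c by simp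
    have e: "(p \<otimes> \<psi> y \<otimes> inv p) \<otimes> p = p \<otimes> \<psi> y" using pc q by (simp add: m_assoc)
    have "Mc (?x, y) = snd c (p \<otimes> \<psi> y)" using Mc_chart[OF p q(1) pq] q by simp
    also have "\<dots> = Mc (conj_chart p y, ?x)"
      using Mc_chart[OF elim(3) p] pq e by (simp add: conj_chart_def)
    finally show ?case .
  qed
  from has_derivative_unique[OF has_derivative_eventually_cong[OF d1 this] d2]
  show ?thesis using left_field_Mc[of ?x v] p by (metis imageI)
qed

text \<open>Ad(Exp X) is the partial differential of the map \<open>?H\<close>, which is C^1 jointly
  in X and the conjugated point; hence it is continuous at X = 0.\<close>

lemma Ad_Exp_tendsto: "((\<lambda>t. Ad (Exp (t *\<^sub>R u)) v) \<longlongrightarrow> v) (at 0)"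
proof -
  let ?H = "\<lambda>z::'e \<times> 'e. snd c (Exp (fst z) \<otimes> \<psi> (snd z) \<otimes> inv (Exp (fst z)))"
  have "gC1 (\<lambda>z::'e \<times> 'e. Exp (fst z) \<otimes> \<psi> (snd z) \<otimes> inv (Exp (fst z))) (0, x0)"
    by (intro gC1_mult gC1_inv gC1_compose_Exp gC1_compose[of \<psi> snd] C1_at_bounded_linear bounded_linear_intros)
      (simp add: gC1_\<psi>)
  then have H: "C1_at ?H (0, x0)" using c by (intro gC1_chart(2)) (simp_all add: \<psi>_x0)
  have "((\<lambda>t::real. (t *\<^sub>R u, x0)) \<longlongrightarrow> (0 *\<^sub>R u, x0)) (at 0)" by (intro tendsto_intros)
  then have t: "((\<lambda>t::real. (t *\<^sub>R u, x0)) \<longlongrightarrow> (0, x0)) (at 0)" by simp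
  have eq: "frechet_derivative ?H (at (X, x0)) (0, v) = Ad (Exp X) v" if "C1_at ?H (X, x0)" for X v
  proof -
    have "((\<lambda>y. (X, y)) has_derivative (\<lambda>v. (0, v))) (at x0)" by (auto intro!: derivative_eq_intros)
    from has_derivative_compose[OF this C1_at_has_derivative[OF that]]
    have "(conj_chart (Exp X) has_derivative (\<lambda>v. frechet_derivative ?H (at (X, x0)) (0, v))) (at x0)"
      by (simp add: conj_chart_def[abs_def])
    from fun_cong[OF has_derivative_unique[OF this Ad_has_derivative[OF Exp_carrier]]] show ?thesis by simp
  qed
  have "((\<lambda>t::real. frechet_derivative ?H (at (t *\<^sub>R u, x0)) (0, v)) \<longlongrightarrow> frechet_derivative ?H (at (0, x0)) (0, v)) (at 0)"
    using isCont_tendsto_compose[OF C1_at_isCont_derivative[OF H] t] .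
  moreover have "\<forall>\<^sub>F t::real in at 0. frechet_derivative ?H (at (t *\<^sub>R u, x0)) (0, v) = Ad (Exp (t *\<^sub>R u)) v"
    by (rule eventually_mono[OF eventually_compose_filterlim[OF C1_at_eventually[OF H] t]]) (rule eq)
  ultimately have "((\<lambda>t. Ad (Exp (t *\<^sub>R u)) v) \<longlongrightarrow> frechet_derivative ?H (at (0, x0)) (0, v)) (at 0)"
    by (rule Lim_transform_eventually)
  then show ?thesis unfolding eq[OF H] by (simp add: Ad_one)
qed

text \<open>Along x(t) = Exp(t u), \<open>left_field_right_field_Ad\<close> gives L(x) = R(A(t), x),
  with L the left field of v, R(w, .) the right field of w and A(t) the adjoint image of v. Solving
  for A gives A = v + (L - R(v, .))(x) - S. The middle term has derivative
  \<open>mixed u v - mixed v u\<close>, the bracket, and S is negligible.\<close>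

lemma Ad_Exp_has_derivative_0:
  "((\<lambda>t. Ad (Exp (t *\<^sub>R u)) v) has_derivative (\<lambda>h. h *\<^sub>R lie_bracket G c u v)) (at 0)"
proof -
  obtain r K f' where f': "r > 0" "K \<ge> 0" "ball (x0, x0) r \<subseteq> \<Omega>"
    "\<And>y. y \<in> ball (x0, x0) r \<Longrightarrow> (Mc has_derivative blinfun_apply (f' y)) (at y)"
    "\<And>y z. \<lbrakk>y \<in> ball (x0, x0) r; z \<in> ball (x0, x0) r\<rbrakk> \<Longrightarrow> norm (f' y - f' z) \<le> K * norm (y - z)"
    using smooth_on_lipschitz_derivative[OF Mc] by metis
  have D: "frechet_derivative Mc (at z) = f' z" if "z \<in> ball (x0, x0) r" for z
    using frechet_derivative_at[OF f'(4)[OF that]] by simp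
  define x where "x t = snd c (Exp (t *\<^sub>R u))" for t
  define A where "A t = Ad (Exp (t *\<^sub>R u)) v" for t
  define L where "L y = left_field G c v y" for y
  define R where "R w y = frechet_derivative Mc (at (x0, y)) (w, 0)" for w y
  \<comment> \<open>A product of two small factors: the right field map differs from the identity by
    O(t), and A(t) - v tends to 0. Mere continuity of A therefore suffices for S to be o(t).\<close>
  define S where "S t = R (A t - v) (x t) - (A t - v)" for t
  have gx: "gC1 (\<lambda>t. Exp (t *\<^sub>R u)) 0"
    by (intro gC1_compose_Exp C1_at_bounded_linear bounded_linear_intros)
  have x_c: "\<forall>\<^sub>F t in nhds 0. Exp (t *\<^sub>R u) \<in> fst c" and x_C1: "C1_at x 0"
    using gC1_chart[OF gx c(1)] c unfolding x_def by auto
  have x_0: "x 0 = x0" by (simp add: x_def)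
  have "((\<lambda>t. t *\<^sub>R u) has_derivative (\<lambda>h. h *\<^sub>R u)) (at (0::real))" by (auto intro!: derivative_eq_intros)
  moreover have "((\<lambda>X. snd c (Exp X)) has_derivative (\<lambda>h. h)) (at ((0::real) *\<^sub>R u))"
    using Exp_has_derivative_0 by simp
  ultimately have x_d: "(x has_derivative (\<lambda>h. h *\<^sub>R u)) (at 0)"
    unfolding x_def by (rule has_derivative_compose)
  obtain d C where dC: "d > 0" "C \<ge> 0" "\<And>y z. \<lbrakk>y \<in> ball 0 d; z \<in> ball 0 d\<rbrakk> \<Longrightarrow> norm (x y - x z) \<le> C * norm (y - z)"
    using C1_at_lipschitz[OF x_C1] by metis
  have "((\<lambda>t. (x0, x t)) \<longlongrightarrow> (x0, x0)) (nhds 0)"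
    using C1_at_tendsto[OF x_C1] by (intro tendsto_intros) (simp add: x_0)
  then have "\<forall>\<^sub>F t in nhds 0. (x0, x t) \<in> ball (x0, x0) r" using topological_tendstoD[OF _ open_ball] f'(1) by fastforce
  with x_c have "\<forall>\<^sub>F t in nhds 0. Exp (t *\<^sub>R u) \<in> fst c \<and> (x0, x t) \<in> ball (x0, x0) r"
    by eventually_elim simp
  then obtain e0 where e0: "e0 > 0" "\<And>t. dist t 0 < e0 \<Longrightarrow> Exp (t *\<^sub>R u) \<in> fst c \<and> (x0, x t) \<in> ball (x0, x0) r"
    unfolding eventually_nhds_metric by blast
  have A0: "A 0 = v" by (simp add: A_def Ad_one)
  have S_le: "norm (S t) \<le> (K * norm (x t - x0)) * norm (A t - v)" if t: "dist t 0 < e0" for t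
  proof -
    have in_b: "(x0, x t) \<in> ball (x0, x0) r" "(x0, x0) \<in> ball (x0, x0) r" using e0(2)[OF t] f'(1) by auto
    have "f' (x0, x0) (w, 0) = w" for w using D[OF in_b(2)] Mc_frechet[of w 0] by simp
    then have "S t = (f' (x0, x t) - f' (x0, x0)) (A t - v, 0)"
      by (simp add: S_def R_def D[OF in_b(1)] blinfun.diff_left)
    then have "norm (S t) \<le> norm (f' (x0, x t) - f' (x0, x0)) * norm (A t - v, 0::'e)"
      using norm_blinfun by metis
    also have "\<dots> \<le> (K * norm ((x0, x t) - (x0, x0))) * norm (A t - v)"
      using f'(5)[OF in_b] f'(2) by (intro mult_mono) (auto simp: norm_Pair)
    finally show ?thesis by (simp add: norm_Pair)
  qed
  have S_d: "(S has_derivative (\<lambda>h. 0)) (at 0)"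
  proof (rule has_derivativeI_sandwich[of "min e0 d"])
    have S0: "S 0 = 0" using e0(2)[of 0] e0(1) D[of "(x0, x0)"] f'(1) linear_0[OF linear_Mc'[OF Mc(3)]]
      by (simp add: S_def A0 R_def x_0 zero_prod_def)
    show "norm (S y - S 0 - 0) / norm (y - 0) \<le> K * C * norm (A y - v)"
      if y: "y \<noteq> 0" "dist y 0 < min e0 d" for y
    proof -
      have "norm (S y) \<le> (K * norm (x y - x0)) * norm (A y - v)" using y by (intro S_le) auto
      also have "\<dots> \<le> (K * (C * norm y)) * norm (A y - v)"
        using dC(3)[of y 0] y dC(1) f'(2) x_0 by (intro mult_right_mono mult_left_mono) (auto simp: dist_norm)
      finally show ?thesis using y(1) by (simp add: S0 divide_le_eq mult_ac)
    qed
    have "((\<lambda>t. K * C * norm (A t - v)) \<longlongrightarrow> K * C * norm (v - v)) (at 0)"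
      unfolding A_def by (intro tendsto_intros Ad_Exp_tendsto)
    then show "((\<lambda>t. K * C * norm (A t - v)) \<longlongrightarrow> 0) (at 0)" by simp
  qed (use e0 dC in auto)
  have "((\<lambda>y. L y - R v y) has_derivative (\<lambda>h. mixed h v - mixed v h)) (at (x 0))"
    unfolding L_def R_def x_0
    by (intro has_derivative_diff right_field_has_derivative left_field_has_derivative)
  from has_derivative_compose[OF x_d this]
  have LR: "((\<lambda>t. L (x t) - R v (x t)) has_derivative (\<lambda>h. h *\<^sub>R lie_bracket G c u v)) (at 0)"
    using bilinear_mixed by (simp add: lie_bracket_mixed bilinear_lmul bilinear_rmul scaleR_diff_right)
  have "((\<lambda>t. v + (L (x t) - R v (x t)) - S t) has_derivative (\<lambda>h. h *\<^sub>R lie_bracket G c u v)) (at 0)"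
    using has_derivative_diff[OF has_derivative_add[OF has_derivative_const LR] S_d, of v] by simp
  then have "(A has_derivative (\<lambda>h. h *\<^sub>R lie_bracket G c u v)) (at 0)"
  proof (rule has_derivative_eventually_cong)
    have "\<forall>\<^sub>F t in nhds 0. dist t 0 < e0" using e0(1) unfolding eventually_nhds_metric by blast
    then show "\<forall>\<^sub>F t in nhds 0. v + (L (x t) - R v (x t)) - S t = A t"
    proof eventually_elim
      case (elim t)
      have ex: "Exp (t *\<^sub>R u) \<in> fst c" and ib: "(x0, x t) \<in> ball (x0, x0) r" using e0(2)[OF elim] by auto
      have "L (x t) = R (A t) (x t)"
        using left_field_right_field_Ad[OF ex] by (simp add: L_def R_def A_def x_def)
      moreover have "R (A t - v) (x t) = R (A t) (x t) - R v (x t)"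
        using linear_diff[OF linear_Mc', of "(x0, x t)" "(A t, 0)" "(v, 0)"] ib f'(3) by (auto simp: R_def)
      ultimately show ?case by (simp add: S_def)
    qed
  qed
  then show ?thesis unfolding A_def .
qed

lemma Ad_Exp_has_derivative:
  "((\<lambda>t. Ad (Exp (t *\<^sub>R u)) v) has_derivative (\<lambda>h. h *\<^sub>R lie_bracket G c u (Ad (Exp (t *\<^sub>R u)) v))) (at t)"
proof -
  have d: "((\<lambda>t'. t' - t) has_derivative (\<lambda>h. h)) (at t)" by (auto intro!: derivative_eq_intros)
  have "((\<lambda>s. Ad (Exp (s *\<^sub>R u)) (Ad (Exp (t *\<^sub>R u)) v)) has_derivative
      (\<lambda>h. h *\<^sub>R lie_bracket G c u (Ad (Exp (t *\<^sub>R u)) v))) (at (t - t))"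
    using Ad_Exp_has_derivative_0 by simp
  from has_derivative_compose[OF d this]
  have "((\<lambda>t'. Ad (Exp ((t' - t) *\<^sub>R u)) (Ad (Exp (t *\<^sub>R u)) v)) has_derivative
      (\<lambda>h. h *\<^sub>R lie_bracket G c u (Ad (Exp (t *\<^sub>R u)) v))) (at t)" .
  moreover have "Ad (Exp ((t' - t) *\<^sub>R u)) (Ad (Exp (t *\<^sub>R u)) v) = Ad (Exp (t' *\<^sub>R u)) v" for t'
    using Ad_mult[OF Exp_carrier Exp_carrier] Exp_add[of "t' - t" t u] by simp
  ultimately show ?thesis by simp
qed

end

section \<open>Conjugate points of a bi-invariant metric\<close>

text \<open>The first order condition at a minimum, for a quadratic polynomial that vanishes at s =
  0.\<close>

lemma linear_part_zero:
  assumes "\<And>s::real. 0 \<le> 2 * s * a + s\<^sup>2 * b"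
  shows "a = 0"
proof (rule ccontr)
  assume a: "a \<noteq> 0"
  \<comment> \<open>The test value s = -a/k gives (a/k)^2 (b - 2k), which is negative since k
    exceeds |b|.\<close>
  define k where "k = \<bar>b\<bar> + 1"
  have k: "k > 0" "b < 2 * k" by (auto simp: k_def)
  have "0 \<le> 2 * (- a / k) * a + (- a / k)\<^sup>2 * b" by (rule assms)
  also have "\<dots> = (a / k)\<^sup>2 * (b - 2 * k)" using k by (simp add: power2_eq_square field_simps)
  also have "\<dots> < 0" using a k by (intro mult_pos_neg) auto
  finally show False by simp
qed

locale lie_group_metric = lie_group_chart G c
  for G :: "('g, 'e::euclidean_space) lie_group" (structure) and c :: "('g, 'e) chart" +
  fixes g :: "('g, 'e) metric"
  assumes bi_inv: "bi_invariant_metric G g"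
begin

abbreviation ge :: "'e \<Rightarrow> 'e \<Rightarrow> real" where "ge \<equiv> g c \<one>"

abbreviation br :: "'e \<Rightarrow> 'e \<Rightarrow> 'e" where "br \<equiv> lie_bracket G c"

lemma ge: "bilinear ge" "ge u v = ge v u" "u \<noteq> 0 \<Longrightarrow> 0 < ge u u"
  using bi_inv c unfolding bi_invariant_metric_def riemannian_metric_def by blast+

lemma bounded_bilinear_ge: "bounded_bilinear ge"
  using ge(1) bilinear_conv_bounded_bilinear by blast

lemma bounded_bilinear_br: "bounded_bilinear br"
  using bilinear_lie_bracket bilinear_conv_bounded_bilinear by blast

sublocale gb: bounded_bilinear ge by (rule bounded_bilinear_ge)

sublocale bb: bounded_bilinear br by (rule bounded_bilinear_br)

lemma ge_eq_0: "ge u u = 0 \<longleftrightarrow> u = 0"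
  using ge(3)[of u] by (cases "u = 0") (auto simp: gb.zero_left)

lemma ge_nonneg: "0 \<le> ge u u"
  using ge(3)[of u] by (cases "u = 0") (auto simp: gb.zero_left)

lemma isometryD:
  assumes "is_isometry (atlas G) g f" "d1 \<in> atlas G" "d2 \<in> atlas G" "p \<in> fst d1" "f p \<in> fst d2"
  shows "g d2 (f p) (differential d1 d2 f p u) (differential d1 d2 f p v) = g d1 p u v"
  using assms unfolding is_isometry_def by blast

lemma left_differential:
  assumes p: "p \<in> carrier G" and d: "d \<in> atlas G" "p \<in> fst d"
  shows "(in_charts c d (\<lambda>q. p \<otimes> q) has_derivative differential c d (\<lambda>q. p \<otimes> q) \<one>) (at x0)"
    "ge u v = g d p (differential c d (\<lambda>q. p \<otimes> q) \<one> u) (differential c d (\<lambda>q. p \<otimes> q) \<one> v)"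
proof -
  have "gC1 (\<lambda>x. p \<otimes> \<psi> x) x0" by (intro gC1_mult gC1_const gC1_\<psi> p)
  then have "C1_at (\<lambda>x. snd d (p \<otimes> \<psi> x)) x0" using d p by (intro gC1_chart(2)) (simp_all add: \<psi>_x0)
  then show "(in_charts c d (\<lambda>q. p \<otimes> q) has_derivative differential c d (\<lambda>q. p \<otimes> q) \<one>) (at x0)"
    unfolding differential_def in_charts_def o_def by (rule C1_at_has_derivative)
  have "is_isometry (atlas G) g (\<lambda>q. p \<otimes> q)"
    using bi_inv p unfolding bi_invariant_metric_def by blast
  then have "g d (p \<otimes> \<one>) (differential c d (\<lambda>q. p \<otimes> q) \<one> u) (differential c d (\<lambda>q. p \<otimes> q) \<one> v) = ge u v"
    using c d p by (intro isometryD) simp_all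
  then show "ge u v = g d p (differential c d (\<lambda>q. p \<otimes> q) \<one> u) (differential c d (\<lambda>q. p \<otimes> q) \<one> v)"
    using p by simp
qed

text \<open>Ad p is the differential of left translation by p followed by that of right translation
  by its inverse, both isometries; \<open>d\<close> is an intermediate chart around p.\<close>

lemma Ad_isometry:
  assumes p: "p \<in> carrier G"
  shows "ge (Ad p u) (Ad p v) = ge u v"
proof -
  obtain d where d: "d \<in> atlas G" "p \<in> fst d" using chart_at p by blast
  let ?L = "differential c d (\<lambda>q. p \<otimes> q) \<one>"
  let ?R = "differential d c (\<lambda>q. q \<otimes> inv p) p"
  have dp: "snd d p \<in> snd d ` fst d" using d by blast
  have "gC1 (\<lambda>x. cinv d x \<otimes> inv p) (snd d p)"
    by (intro gC1_mult gC1_const gC1_cinv[OF d(1) dp] inv_closed p)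
  then have "C1_at (\<lambda>x. snd c (cinv d x \<otimes> inv p)) (snd d p)"
    using d p c by (intro gC1_chart(2)) (simp_all add: cinv_chart)
  then have R: "(in_charts d c (\<lambda>q. q \<otimes> inv p) has_derivative ?R) (at (snd d p))"
    unfolding differential_def in_charts_def o_def by (rule C1_at_has_derivative)
  have v: "in_charts c d (\<lambda>q. p \<otimes> q) x0 = snd d p" using p by (simp add: in_charts_def \<psi>_x0)
  have d1: "((\<lambda>x. in_charts d c (\<lambda>q. q \<otimes> inv p) (in_charts c d (\<lambda>q. p \<otimes> q) x)) has_derivative (\<lambda>h. ?R (?L h))) (at x0)"
    by (rule has_derivative_compose[OF left_differential(1)[OF p d]]) (simp add: v R)
  have "gC1 (\<lambda>x. p \<otimes> \<psi> x) x0" by (intro gC1_mult gC1_const gC1_\<psi> p)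
  then have "\<forall>\<^sub>F x in nhds x0. p \<otimes> \<psi> x \<in> fst d" using d p by (intro gC1_chart(1)) (simp_all add: \<psi>_x0)
  then have "\<forall>\<^sub>F x in nhds x0. in_charts d c (\<lambda>q. q \<otimes> inv p) (in_charts c d (\<lambda>q. p \<otimes> q) x) = conj_chart p x"
    by eventually_elim (simp add: in_charts_def conj_chart_def cinv_chart[OF d(1)])
  from has_derivative_unique[OF has_derivative_eventually_cong[OF d1 this] Ad_has_derivative[OF p]]
  have Ad: "Ad p h = ?R (?L h)" for h by (metis)
  have "is_isometry (atlas G) g (\<lambda>q. q \<otimes> inv p)"
    using bi_inv p unfolding bi_invariant_metric_def by blast
  then have "g c (p \<otimes> inv p) (?R (?L u)) (?R (?L v)) = g d p (?L u) (?L v)"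
    using c d p by (intro isometryD) simp_all
  then show ?thesis using p left_differential(2)[OF p d] by (simp add: Ad)
qed

text \<open>The invariance \<open>Ad_isometry\<close> along Exp(t u), differentiated at t =
  0.\<close>

lemma br_skew: "ge (br u v) w = - ge v (br u w)"
proof -
  let ?A = "\<lambda>v t. Ad (Exp (t *\<^sub>R u)) v"
  have "((\<lambda>t. ge (?A v t) (?A w t)) has_derivative (\<lambda>h. ge (?A v 0) (h *\<^sub>R br u w) + ge (h *\<^sub>R br u v) (?A w 0))) (at 0)"
    by (intro gb.FDERIV Ad_Exp_has_derivative_0)
  moreover have "(\<lambda>t. ge (?A v t) (?A w t)) = (\<lambda>t. ge v w)" by (simp add: Ad_isometry)
  ultimately have "((\<lambda>t::real. ge v w) has_derivative (\<lambda>h. ge v (h *\<^sub>R br u w) + ge (h *\<^sub>R br u v) w)) (at 0)"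
    by (simp add: Ad_one)
  from fun_cong[OF has_derivative_unique[OF this has_derivative_const], of 1] show ?thesis by simp
qed

lemma br_skew_self: "ge (br u v) v = 0"
  using br_skew[of u v v] ge(2)[of v "br u v"] by simp

section \<open>Vanishing bracket and commutativity of the identity component\<close>

lemma Exp_range_nbhd: "\<exists>U. openin (topol G) U \<and> \<one> \<in> U \<and> U \<subseteq> range Exp"
proof -
  let ?f = "\<lambda>X. snd c (Exp X)"
  let ?S = "{X. Exp X \<in> fst c}"
  have "openin euclidean {X \<in> topspace euclidean. Exp X \<in> fst c}"
    using chart_openin[OF c(1)] by (intro openin_continuous_map_preimage[OF gC1_continuous_map[OF Exp_C1]])
  then have S: "open ?S" by simp
  have cont: "continuous_on ?S ?f"
    using gC1_chart(2)[OF Exp_C1 c(1)] C1_at_isCont by (intro continuous_at_imp_continuous_on) auto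
  \<comment> \<open>An open mapping theorem that uses the differential at the single point 0, where
    it is the identity.\<close>
  have "?f 0 \<in> interior (?f ` ?S)"
    by (rule sussmann_open_mapping[OF S cont _ Exp_has_derivative_0, where g' = id])
      (use c S in \<open>auto simp: interior_open bounded_linear_ident id_def\<close>)
  then have x0: "x0 \<in> interior (?f ` ?S)" by simp
  let ?U = "{p \<in> fst c. snd c p \<in> interior (?f ` ?S)}"
  have "openin (topol G) ?U" by (rule chart_on_open_preimage[OF chart[OF c(1)] open_interior])
  moreover have "?U \<subseteq> range Exp"
  proof
    fix p assume p: "p \<in> ?U"
    then obtain X where "Exp X \<in> fst c" "snd c p = snd c (Exp X)" using interior_subset by blast
    then have "p = Exp X" using chart_inj p by blast
    then show "p \<in> range Exp" by blast
  qed
  ultimately show ?thesis using x0 c by blast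
qed

text \<open>An induction principle for the identity component. A set stable under right
  multiplication by exponentials is open, as these fill a neighbourhood of the unit. The complement
  is stable too, since Exp(-X) inverts Exp X; so \<open>H\<close> is open and closed.\<close>

lemma component_subset:
  assumes H: "H \<subseteq> carrier G" "\<one> \<in> H" and step: "\<And>p X. p \<in> H \<Longrightarrow> p \<otimes> Exp X \<in> H"
  shows "connected_component_of_set (topol G) \<one> \<subseteq> H"
proof -
  obtain U where U: "openin (topol G) U" "\<one> \<in> U" "U \<subseteq> range Exp" using Exp_range_nbhd by blast
  have op: "openin (topol G) A" if A: "A \<subseteq> carrier G" and st: "\<And>p X. p \<in> A \<Longrightarrow> p \<otimes> Exp X \<in> A" for A
  proof (subst openin_subopen, intro ballI)
    fix p assume p: "p \<in> A"
    then have pc: "p \<in> carrier G" using A by blast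
    have "continuous_map (topol G) (topol G) (\<lambda>q. inv p \<otimes> q)"
    proof -
      have m: "continuous_map (prod_topology (topol G) (topol G)) (topol G) (\<lambda>(p, q). p \<otimes> q)"
        using smooth_mult unfolding smooth_map_def by blast
      have "continuous_map (topol G) (prod_topology (topol G) (topol G)) (\<lambda>q. (inv p, q))"
        using pc by (intro continuous_map_pairedI) (simp_all add: topspace_G)
      from continuous_map_compose[OF this m] show ?thesis by (simp add: o_def)
    qed
    then have "openin (topol G) {q \<in> topspace (topol G). inv p \<otimes> q \<in> U}"
      using U by (intro openin_continuous_map_preimage)
    moreover have "p \<in> {q \<in> topspace (topol G). inv p \<otimes> q \<in> U}" using pc U by (simp add: topspace_G)
    moreover have "{q \<in> topspace (topol G). inv p \<otimes> q \<in> U} \<subseteq> A"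
    proof
      fix q assume q: "q \<in> {q \<in> topspace (topol G). inv p \<otimes> q \<in> U}"
      then obtain X where X: "inv p \<otimes> q = Exp X" using U by auto
      have "q = p \<otimes> Exp X" using q pc inv_cancel[of p q] by (simp add: topspace_G X[symmetric])
      then show "q \<in> A" using st[OF p] by simp
    qed
    ultimately show "\<exists>T. openin (topol G) T \<and> p \<in> T \<and> T \<subseteq> A" by blast
  qed
  have "openin (topol G) (carrier G - H)"
  proof (rule op)
    fix p X assume p: "p \<in> carrier G - H"
    have "p \<otimes> Exp X \<notin> H"
    proof
      assume "p \<otimes> Exp X \<in> H"
      from step[OF this, of "- X"] have "p \<in> H" using p by (simp add: m_assoc Exp_minus)
      then show False using p by blast
    qed
    then show "p \<otimes> Exp X \<in> carrier G - H" using p by simp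
  qed blast
  moreover have "openin (topol G) H" by (rule op[OF H(1) step])
  ultimately have "closedin (topol G) H" "openin (topol G) H"
    using H(1) by (auto simp: closedin_def topspace_G)
  then have "connected_component_of_set (topol G) \<one> \<subseteq> H \<or> disjnt (connected_component_of_set (topol G) \<one>) H"
    using connectedin_clopen_cases connectedin_connected_component_of by metis
  moreover have "\<one> \<in> connected_component_of_set (topol G) \<one>"
    by (simp add: connected_component_of_refl topspace_G)
  ultimately show ?thesis using H(2) by (auto simp: disjnt_iff)
qed

text \<open>With zero bracket, Ad(Exp(t u)) v has zero derivative, so exponentials commute. Two
  passes of \<open>component_subset\<close> follow: elements of the component commute with
  exponentials, and then with one another.\<close>

lemma abelian_component:
  assumes triv: "\<And>u v. br u v = 0"
    and a: "a \<in> connected_component_of_set (topol G) \<one>" and b: "b \<in> connected_component_of_set (topol G) \<one>"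
  shows "a \<otimes> b = b \<otimes> a"
proof -
  let ?C = "connected_component_of_set (topol G) \<one>"
  have Ad: "Ad (Exp u) v = v" for u v
  proof -
    have "Ad (Exp (1 *\<^sub>R u)) v = Ad (Exp (0 *\<^sub>R u)) v"
    proof (rule has_derivative_zero_unique[of UNIV "\<lambda>t. Ad (Exp (t *\<^sub>R u)) v"])
      show "((\<lambda>t. Ad (Exp (t *\<^sub>R u)) v) has_derivative (\<lambda>h. 0)) (at t within UNIV)" for t
        using Ad_Exp_has_derivative[of u v t] by (simp add: triv)
    qed auto
    then show ?thesis by (simp add: Ad_one)
  qed
  have comm: "Exp u \<otimes> Exp v = Exp v \<otimes> Exp u" for u v
  proof -
    have "Exp v = Exp u \<otimes> Exp v \<otimes> inv (Exp u)" using Exp_Ad[of "Exp u" v] by (simp add: Ad)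
    then have "Exp v \<otimes> Exp u = Exp u \<otimes> Exp v \<otimes> inv (Exp u) \<otimes> Exp u" by (rule arg_cong)
    then show ?thesis by (simp add: m_assoc)
  qed
  have Z1: "?C \<subseteq> {p \<in> carrier G. \<forall>X. p \<otimes> Exp X = Exp X \<otimes> p}"
  proof (rule component_subset)
    fix p X assume p: "p \<in> {p \<in> carrier G. \<forall>X. p \<otimes> Exp X = Exp X \<otimes> p}"
    have "p \<otimes> Exp X \<otimes> Exp Y = Exp Y \<otimes> (p \<otimes> Exp X)" for Y
    proof -
      have pc: "p \<in> carrier G" using p by blast
      have "p \<otimes> Exp X \<otimes> Exp Y = p \<otimes> (Exp Y \<otimes> Exp X)" unfolding comm[of Y X] using pc by (simp add: m_assoc)
      also have "\<dots> = (p \<otimes> Exp Y) \<otimes> Exp X" using pc by (simp add: m_assoc)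
      also have "p \<otimes> Exp Y = Exp Y \<otimes> p" using p by blast
      finally show ?thesis using pc by (simp add: m_assoc)
    qed
    then show "p \<otimes> Exp X \<in> {p \<in> carrier G. \<forall>X. p \<otimes> Exp X = Exp X \<otimes> p}" using p by simp
  qed auto
  have "?C \<subseteq> {p \<in> carrier G. \<forall>q\<in>?C. p \<otimes> q = q \<otimes> p}"
  proof (rule component_subset)
    fix p X assume p: "p \<in> {p \<in> carrier G. \<forall>q\<in>?C. p \<otimes> q = q \<otimes> p}"
    have "p \<otimes> Exp X \<otimes> q = q \<otimes> (p \<otimes> Exp X)" if q: "q \<in> ?C" for q
    proof -
      have qc: "q \<in> carrier G" "q \<otimes> Exp X = Exp X \<otimes> q" using q Z1 by auto
      have pc: "p \<in> carrier G" "p \<otimes> q = q \<otimes> p" using p q by auto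
      have "p \<otimes> Exp X \<otimes> q = p \<otimes> (q \<otimes> Exp X)" using qc pc(1) by (simp add: m_assoc)
      also have "\<dots> = (p \<otimes> q) \<otimes> Exp X" using qc(1) pc(1) by (simp add: m_assoc)
      finally show ?thesis using qc(1) pc by (simp add: m_assoc)
    qed
    then show "p \<otimes> Exp X \<in> {p \<in> carrier G. \<forall>q\<in>?C. p \<otimes> q = q \<otimes> p}" using p by simp
  next
    show "\<one> \<in> {p \<in> carrier G. \<forall>q\<in>?C. p \<otimes> q = q \<otimes> p}" using Z1 by auto
  qed blast
  then show ?thesis using a b by auto
qed

text \<open>A maximum of $|[u,v]|^2 / |v|^2$ is attained at an eigenvector of the negative semidefinite
  operator $(\mathrm{ad}\,u)^2$.\<close>

lemma bracket_eigenvector: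
  assumes "br u v0 \<noteq> 0"
  obtains \<mu> w where "\<mu> > 0" "br u w \<noteq> 0" "br u (br u w) = - \<mu> *\<^sub>R w"
proof -
  let ?q = "\<lambda>v. ge (br u v) (br u v) / ge v v"
  let ?S = "sphere 0 1 :: 'e set"
  have v0: "v0 \<noteq> 0" using assms by (auto simp: bb.zero_right)
  have "continuous_on ?S ?q"
    by (intro continuous_on_divide gb.continuous_on bb.continuous_on continuous_on_id continuous_on_const)
      (auto simp: ge_eq_0)
  moreover have "?S \<noteq> {}" using v0 by (metis norm_sgn mem_sphere_0 empty_iff)
  ultimately obtain w where w: "w \<in> ?S" "\<And>v. v \<in> ?S \<Longrightarrow> ?q v \<le> ?q w"
    using continuous_attains_sup[OF compact_sphere] by blast
  define \<mu> where "\<mu> = ?q w"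
  have w0: "w \<noteq> 0" using w(1) by auto
  have scale: "?q (s *\<^sub>R v) = ?q v" if "s \<noteq> 0" for s v
    using that by (simp add: bb.scaleR_right gb.scaleR_left gb.scaleR_right)
  have le: "?q v \<le> \<mu>" if "v \<noteq> 0" for v
  proof -
    have "?q v = ?q (sgn v)" unfolding sgn_div_norm by (rule scale[symmetric]) (use that in simp)
    also have "\<dots> \<le> \<mu>" unfolding \<mu>_def using that by (intro w(2)) (simp add: norm_sgn)
    finally show ?thesis .
  qed
  have "0 < ?q v0" using ge(3)[OF assms] ge(3)[OF v0] by simp
  then have mu: "\<mu> > 0" using le[OF v0] by simp
  have Q: "0 \<le> \<mu> * ge v v - ge (br u v) (br u v)" for v
    using le[of v] ge(3)[of v] by (cases "v = 0") (auto simp: gb.zero_left bb.zero_right divide_le_eq)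
  have Qw: "\<mu> * ge w w = ge (br u w) (br u w)" using ge(3)[OF w0] by (simp add: \<mu>_def)
  \<comment> \<open>The form \<mu> |v|^2 - |[u, v]|^2 is nonnegative and vanishes at
    \<open>w\<close>, so its linear part there vanishes.\<close>
  have crit: "\<mu> * ge w v - ge (br u w) (br u v) = 0" for v
  proof (rule linear_part_zero)
    fix s :: real
    have "\<mu> * ge (w + s *\<^sub>R v) (w + s *\<^sub>R v) - ge (br u (w + s *\<^sub>R v)) (br u (w + s *\<^sub>R v))
      = 2 * s * (\<mu> * ge w v - ge (br u w) (br u v)) + s\<^sup>2 * (\<mu> * ge v v - ge (br u v) (br u v))"
      using Qw ge(2)[of v w] ge(2)[of "br u v" "br u w"]
      by (simp add: bb.add_right bb.scaleR_right gb.add_left gb.add_right gb.scaleR_left gb.scaleR_right power2_eq_square algebra_simps)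
    then show "0 \<le> 2 * s * (\<mu> * ge w v - ge (br u w) (br u v)) + s\<^sup>2 * (\<mu> * ge v v - ge (br u v) (br u v))"
      using Q[of "w + s *\<^sub>R v"] by simp
  qed
  \<comment> \<open>By skewness, criticality of \<open>w\<close> says that \<open>?r\<close> is
    orthogonal to every v; it is tested against itself.\<close>
  let ?r = "\<mu> *\<^sub>R w + br u (br u w)"
  have "ge ?r ?r = 0"
    using crit[of ?r] br_skew[of u "br u w" ?r] by (simp add: gb.add_left gb.scaleR_left)
  then have "?r = 0" by (simp add: ge_eq_0)
  then have "br u (br u w) = - \<mu> *\<^sub>R w" by (simp add: add_eq_0_iff)
  moreover have "br u w \<noteq> 0" using Qw mu ge(3)[OF w0] by (auto simp: gb.zero_left)
  ultimately show thesis using that mu by blast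
qed

text \<open>Both sides solve x' = [u, x] with x(0) = w. Their difference solves it as well, and its
  norm is constant because ad u is skew.\<close>

lemma Ad_Exp_rotation:
  assumes l: "\<kappa> > 0" and w: "br u (br u w) = - (\<kappa>\<^sup>2) *\<^sub>R w"
  shows "Ad (Exp (t *\<^sub>R u)) w = cos (\<kappa> * t) *\<^sub>R w + (sin (\<kappa> * t) / \<kappa>) *\<^sub>R br u w"
proof -
  define q where "q t = cos (\<kappa> * t) *\<^sub>R w + (sin (\<kappa> * t) / \<kappa>) *\<^sub>R br u w" for t
  define d where "d t = Ad (Exp (t *\<^sub>R u)) w - q t" for t
  have "(q has_derivative (\<lambda>h. h *\<^sub>R br u (q t))) (at t)" for t
  proof -
    have "(q has_derivative (\<lambda>h. (- sin (\<kappa> * t) * (\<kappa> * h)) *\<^sub>R w + ((cos (\<kappa> * t) * (\<kappa> * h)) / \<kappa>) *\<^sub>R br u w)) (at t)"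
      unfolding q_def using l by (auto intro!: derivative_eq_intros simp: mult_ac)
    moreover have "(- sin (\<kappa> * t) * (\<kappa> * h)) *\<^sub>R w + ((cos (\<kappa> * t) * (\<kappa> * h)) / \<kappa>) *\<^sub>R br u w = h *\<^sub>R br u (q t)" for h
      using l by (simp add: q_def bb.add_right bb.scaleR_right w scaleR_add_right scaleR_diff_right power2_eq_square mult_ac)
    ultimately show ?thesis by simp
  qed
  then have d': "(d has_derivative (\<lambda>h. h *\<^sub>R br u (d t))) (at t)" for t
    using has_derivative_diff[OF Ad_Exp_has_derivative[of u w t], of q "\<lambda>h. h *\<^sub>R br u (q t)"]
    unfolding d_def by (simp add: bb.diff_right scaleR_diff_right)
  have "ge (d t) (d t) = ge (d 0) (d 0)"
  proof (rule has_derivative_zero_unique[of UNIV "\<lambda>t. ge (d t) (d t)"])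
    fix t :: real
    have "((\<lambda>t. ge (d t) (d t)) has_derivative (\<lambda>h. ge (d t) (h *\<^sub>R br u (d t)) + ge (h *\<^sub>R br u (d t)) (d t))) (at t)"
      by (intro gb.FDERIV d')
    then show "((\<lambda>t. ge (d t) (d t)) has_derivative (\<lambda>h. 0)) (at t within UNIV)"
      using br_skew_self[of u "d t"] ge(2)[of "d t" "br u (d t)"] by (simp add: gb.scaleR_left gb.scaleR_right)
  qed auto
  moreover have "d 0 = 0" by (simp add: d_def q_def Ad_one)
  ultimately have "d t = 0" using ge_eq_0 by (simp add: gb.zero_left)
  then show ?thesis by (simp add: d_def q_def)
qed

theorem conjugate_point:
  assumes "a \<in> connected_component_of_set (topol G) \<one>" "b \<in> connected_component_of_set (topol G) \<one>"
    and "a \<otimes> b \<noteq> b \<otimes> a"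
  obtains u v A where "v \<noteq> 0" "A v = 0"
    "((\<lambda>Y. snd c (inv (Exp u) \<otimes> Exp Y)) has_derivative A) (at u)"
proof -
  obtain u0 v0 where "br u0 v0 \<noteq> 0" using abelian_component[OF _ assms(1,2)] assms(3) by blast
  then obtain \<mu> w where w: "\<mu> > 0" "br u0 w \<noteq> 0" "br u0 (br u0 w) = - \<mu> *\<^sub>R w"
    using bracket_eigenvector by blast
  define \<kappa> where "\<kappa> = sqrt \<mu>"
  have l: "\<kappa> > 0" "br u0 (br u0 w) = - (\<kappa>\<^sup>2) *\<^sub>R w" using w by (auto simp: \<kappa>_def)
  define u where "u = (2 * pi / \<kappa>) *\<^sub>R u0"
  have Adw: "Ad (Exp u) w = w"
    using Ad_Exp_rotation[OF l, of "2 * pi / \<kappa>"] l(1) by (simp add: u_def)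
  have bw: "br w u \<noteq> 0"
    using w(2) l(1) lie_bracket_antisym[of w u0] by (simp add: u_def bb.scaleR_right)
  have comm: "Exp u \<otimes> Exp (s *\<^sub>R w) = Exp (s *\<^sub>R w) \<otimes> Exp u" for s
  proof -
    have "Ad (Exp u) (s *\<^sub>R w) = s *\<^sub>R w"
      using Adw linear_scale[OF linear_Ad[OF Exp_carrier]] by simp
    then have "Exp (s *\<^sub>R w) = Exp u \<otimes> Exp (s *\<^sub>R w) \<otimes> inv (Exp u)"
      using Exp_Ad[of "Exp u" "s *\<^sub>R w"] by simp
    then have "Exp (s *\<^sub>R w) \<otimes> Exp u = Exp u \<otimes> Exp (s *\<^sub>R w) \<otimes> inv (Exp u) \<otimes> Exp u" by (rule arg_cong)
    then show ?thesis by (simp add: m_assoc)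
  qed
  let ?F = "\<lambda>Y. snd c (inv (Exp u) \<otimes> Exp Y)"
  have "gC1 (\<lambda>Y. inv (Exp u) \<otimes> Exp Y) u" by (intro gC1_mult gC1_const Exp_C1 inv_closed Exp_carrier)
  then have "C1_at ?F u" using c by (intro gC1_chart(2)) simp_all
  then have F: "(?F has_derivative frechet_derivative ?F (at u)) (at u)" by (rule C1_at_has_derivative)
  have F': "(?F has_derivative frechet_derivative ?F (at u)) (at (Ad (Exp (0 *\<^sub>R w)) u))"
    using F by (simp add: Ad_one)
  have "((\<lambda>s. ?F (Ad (Exp (s *\<^sub>R w)) u)) has_derivative (\<lambda>h. frechet_derivative ?F (at u) (h *\<^sub>R br w u))) (at 0)"
    by (rule has_derivative_compose[OF Ad_Exp_has_derivative_0 F'])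
  moreover have "?F (Ad (Exp (s *\<^sub>R w)) u) = x0" for s
  proof -
    have "Exp (Ad (Exp (s *\<^sub>R w)) u) = Exp u"
      using Exp_Ad[of "Exp (s *\<^sub>R w)" u] comm[of s, symmetric] by (simp add: m_assoc)
    then show ?thesis by simp
  qed
  ultimately have "((\<lambda>s::real. x0) has_derivative (\<lambda>h. frechet_derivative ?F (at u) (h *\<^sub>R br w u))) (at 0)" by simp
  from fun_cong[OF has_derivative_unique[OF this has_derivative_const], of 1]
  have "frechet_derivative ?F (at u) (br w u) = 0" by simp
  then show thesis using that bw F by blast
qed

end

section \<open>Superposition operators on $H^1$\<close>

text \<open>Passes from the Lebesgue integral of the definition to the gauge integral, for which
  additivity over adjacent intervals is available.\<close>

lemma weak_deriv_on_integral:
  assumes "weak_deriv_on a b f g" "a \<le> s" "s \<le> t" "t \<le> b"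
  shows "g integrable_on {s..t}" "(\<lambda>r. norm (g r)) integrable_on {s..t}" "f t - f s = integral {s..t} g"
proof -
  have int: "set_integrable lborel {u..v} g" if "a \<le> u" "v \<le> b" for u v
    using that by (intro set_integrable_subset[OF weak_deriv_integrable[OF assms(1)]]) auto
  have hk: "g integrable_on {u..v}" "(LINT r:{u..v}|lborel. g r) = integral {u..v} g" if "a \<le> u" "v \<le> b" for u v
    using set_borel_integral_eq_integral[OF int[OF that]] by auto
  show "g integrable_on {s..t}" using hk assms by blast
  have "set_integrable lborel {s..t} (\<lambda>r. norm (g r))"
    using set_integrable_norm[OF int] assms by blast
  then show "(\<lambda>r. norm (g r)) integrable_on {s..t}" by (rule set_borel_integral_eq_integral(1))
  have "f u = f a + integral {a..u} g" if "a \<le> u" "u \<le> b" for u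
  proof -
    have "u \<in> {a..b}" using that by simp
    then have "f u = f a + (LINT r:{a..u}|lborel. g r)"
      using assms(1) unfolding weak_deriv_on_def by blast
    then show ?thesis using hk(2)[of a u] that by simp
  qed
  from this[of s] this[of t] show "f t - f s = integral {s..t} g"
    using Henstock_Kurzweil_Integration.integral_combine[OF assms(2,3) hk(1)[OF order_refl assms(4)]] assms by (simp add: algebra_simps)
qed

lemma weak_deriv_onI:
  assumes "g \<in> borel_measurable borel" and sq: "set_integrable lborel {a..b} (\<lambda>t. (norm (g t))\<^sup>2)"
    and f: "\<And>t. t \<in> {a..b} \<Longrightarrow> f t - f a = integral {a..t} g"
  shows "weak_deriv_on a b f g"
  unfolding weak_deriv_on_def
proof (intro conjI ballI assms(1) sq)
  fix t assume t: "t \<in> {a..b}"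
  have "AE s in lborel. indicator {a..a} s *\<^sub>R g s = 0"
    using AE_lborel_singleton[of a] by eventually_elim (simp add: indicator_def)
  then have "(LINT s:{a..a}|lborel. g s) = 0"
    unfolding set_lebesgue_integral_def by (rule integral_eq_zero_AE)
  \<comment> \<open>An auxiliary primitive of \<open>g\<close>, introduced so that
    \<open>weak_deriv_integrable\<close> applies to \<open>g\<close>.\<close>
  then have "weak_deriv_on a b (\<lambda>t. (LINT s:{a..t}|lborel. g s)) g"
    using assms(1) sq by (simp add: weak_deriv_on_def)
  then have "set_integrable lborel {a..t} g"
    using set_integrable_Icc_subset[OF weak_deriv_integrable] t by auto
  from set_borel_integral_eq_integral(2)[OF this] f[OF t]
  show "f t = f a + (LINT s:{a..t}|lborel. g s)" by (simp add: algebra_simps)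
qed

text \<open>Locally \<open>F (f t) - F (f s)\<close> is close to \<open>F' (f x) (f t - f s)\<close>, with an error that is small
  relative to the additive set function \<open>integral {s..t} (norm \<circ> g)\<close>.\<close>

lemma weak_deriv_compose:
  fixes f :: "real \<Rightarrow> 'a::euclidean_space" and F :: "'a \<Rightarrow> 'b::euclidean_space"
  assumes w: "weak_deriv_on a b f g" and F: "\<And>t. t \<in> {a..b} \<Longrightarrow> C1_at F (f t)"
  shows "weak_deriv_on a b (\<lambda>t. F (f t)) (\<lambda>t. indicator {a..b} t *\<^sub>R frechet_derivative F (at (f t)) (g t))"
proof -
  let ?D = "\<lambda>t. frechet_derivative F (at (f t))"
  \<comment> \<open>The cut-off keeps the candidate measurable on the whole line, while
    \<open>F\<close> is controlled only at the values of \<open>f\<close> on the interval.\<close>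
  define G where "G t = indicator {a..b} t *\<^sub>R ?D t (g t)" for t
  have G: "G t = ?D t (g t)" if "t \<in> {a..b}" for t using that by (simp add: G_def)
  have cf: "continuous_on {a..b} f" by (rule weak_deriv_continuous[OF w])
  have [measurable]: "g \<in> borel_measurable borel" using w by (simp add: weak_deriv_on_def)
  have bl: "bounded_linear (?D t)" if "t \<in> {a..b}" for t
    using C1_at_has_derivative[OF F[OF that]] has_derivative_bounded_linear by blast
  have cD: "continuous_on {a..b} (\<lambda>t. ?D t i)" for i
    unfolding continuous_on_eq_continuous_within
  proof
    fix t assume t: "t \<in> {a..b}"
    then have "continuous (at t within {a..b}) f" using cf by (simp add: continuous_on_eq_continuous_within)
    then show "continuous (at t within {a..b}) (\<lambda>t. ?D t i)"
      using C1_at_isCont_derivative[OF F[OF t], of i] by (rule continuous_within_compose3[rotated])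
  qed
  \<comment> \<open>Expansion in a basis writes G through the coordinates of \<open>g\<close> and
    continuous functions, which gives measurability and the pointwise bound.\<close>
  have exp: "G t = (\<Sum>i\<in>Basis. (g t \<bullet> i) *\<^sub>R (indicator {a..b} t *\<^sub>R ?D t i))" for t
  proof (cases "t \<in> {a..b}")
    case True
    have "?D t (g t) = ?D t (\<Sum>i\<in>Basis. (g t \<bullet> i) *\<^sub>R i)" by (simp add: euclidean_representation)
    also have "\<dots> = (\<Sum>i\<in>Basis. (g t \<bullet> i) *\<^sub>R ?D t i)"
      using bl[OF True] by (simp add: linear_sum linear_scale bounded_linear.linear)
    finally show ?thesis using True by (simp add: G_def)
  qed (simp add: G_def)
  have [measurable]: "(\<lambda>t. indicator {a..b} t *\<^sub>R ?D t i) \<in> borel_measurable borel" for i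
    by (intro borel_measurable_continuous_on_indicator cD) simp
  have meas: "G \<in> borel_measurable borel"
  proof -
    have "(\<lambda>t. \<Sum>i\<in>Basis. (g t \<bullet> i) *\<^sub>R (indicator {a..b} t *\<^sub>R ?D t i)) \<in> borel_measurable borel" by measurable
    then show ?thesis unfolding exp[symmetric] .
  qed
  have "\<exists>B. \<forall>t\<in>{a..b}. norm (?D t i) \<le> B" for i
    using compact_imp_bounded[OF compact_continuous_image[OF cD compact_Icc]] unfolding bounded_iff by fast
  then obtain B where B: "\<And>i t. t \<in> {a..b} \<Longrightarrow> norm (?D t i) \<le> B i" by metis
  define B1 where "B1 = (\<Sum>i\<in>Basis. \<bar>B i\<bar>)"
  have Gle: "norm (G t) \<le> B1 * norm (g t)" for t
  proof (cases "t \<in> {a..b}")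
    case True
    have "norm (G t) \<le> (\<Sum>i\<in>Basis. norm (g t) * \<bar>B i\<bar>)"
      unfolding exp
    proof (rule sum_norm_le)
      fix i :: 'a assume "i \<in> Basis"
      have "\<bar>g t \<bullet> i\<bar> * norm (?D t i) \<le> norm (g t) * \<bar>B i\<bar>"
        using Basis_le_norm[OF \<open>i \<in> Basis\<close>, of "g t"] B[OF True, of i] by (intro mult_mono) auto
      then show "norm ((g t \<bullet> i) *\<^sub>R (indicator {a..b} t *\<^sub>R ?D t i)) \<le> norm (g t) * \<bar>B i\<bar>" using True by simp
    qed
    then show ?thesis by (simp add: B1_def sum_distrib_left mult.commute)
  qed (auto simp: B1_def G_def sum_nonneg)
  have sq: "set_integrable lborel {a..b} (\<lambda>t. (norm (G t))\<^sup>2)"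
    unfolding set_integrable_def
  proof (rule Bochner_Integration.integrable_bound)
    show "integrable lborel (\<lambda>t. indicator {a..b} t *\<^sub>R (B1\<^sup>2 * (norm (g t))\<^sup>2))"
      using w set_integrable_mult_right[of "B1\<^sup>2" lborel "{a..b}" "\<lambda>t. (norm (g t))\<^sup>2"]
      unfolding weak_deriv_on_def set_integrable_def by simp
    show "(\<lambda>t. indicator {a..b} t *\<^sub>R (norm (G t))\<^sup>2) \<in> borel_measurable lborel"
      using meas by measurable
    have "(norm (G t))\<^sup>2 \<le> B1\<^sup>2 * (norm (g t))\<^sup>2" for t
      using power_mono[OF Gle norm_ge_zero, of t 2] by (simp add: power_mult_distrib)
    then show "AE t in lborel. norm (indicator {a..b} t *\<^sub>R (norm (G t))\<^sup>2) \<le> norm (indicator {a..b} t *\<^sub>R (B1\<^sup>2 * (norm (g t))\<^sup>2))"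
      by (intro AE_I2) (auto simp: indicator_def)
  qed
  have intG: "G integrable_on {s..t}" if "a \<le> s" "t \<le> b" for s t
  proof -
    have "set_integrable lborel {a..b} G"
      unfolding set_integrable_def
    proof (rule Bochner_Integration.integrable_bound)
      show "integrable lborel (\<lambda>t. indicator {a..b} t *\<^sub>R (B1 *\<^sub>R g t))"
        using set_integrable_scaleR_right[of B1 lborel "{a..b}" g] weak_deriv_integrable[OF w]
        unfolding set_integrable_def by simp
      show "(\<lambda>t. indicator {a..b} t *\<^sub>R G t) \<in> borel_measurable lborel" using meas by measurable
      have "norm (G t) \<le> norm (B1 *\<^sub>R g t)" for t using Gle[of t] by (simp add: B1_def sum_nonneg)
      then show "AE t in lborel. norm (indicator {a..b} t *\<^sub>R G t) \<le> norm (indicator {a..b} t *\<^sub>R (B1 *\<^sub>R g t))"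
        by (intro AE_I2) (auto simp: indicator_def)
    qed
    then have "set_integrable lborel {s..t} G" by (rule set_integrable_subset) (use that in auto)
    then show ?thesis by (rule set_borel_integral_eq_integral(1))
  qed
  have main: "norm (F (f t) - F (f a) - integral {a..t} G) \<le> e * integral {a..t} (\<lambda>r. norm (g r))"
    if t: "t \<in> {a..b}" and e: "e > 0" for t e
  proof -
    let ?P = "\<lambda>s t. a \<le> s \<and> t \<le> b \<longrightarrow> norm (F (f t) - F (f s) - integral {s..t} G) \<le> e * integral {s..t} (\<lambda>r. norm (g r))"
    have "?P a t"
    \<comment> \<open>The estimate is additive over adjacent intervals, so by bisection it is enough
      to prove it on short intervals around each point.\<close>
    proof (rule Bolzano[of a t ?P])
      show "a \<le> t" using t by simp
    next
      fix p q r assume P: "?P p q" "?P q r" "p \<le> q" "q \<le> r"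
      show "?P p r"
      proof
        assume pr: "a \<le> p \<and> r \<le> b"
        have c1: "integral {p..r} G = integral {p..q} G + integral {q..r} G"
          using Henstock_Kurzweil_Integration.integral_combine[OF P(3,4) intG[of p r]] pr by simp
        have c2: "integral {p..r} (\<lambda>r. norm (g r)) = integral {p..q} (\<lambda>r. norm (g r)) + integral {q..r} (\<lambda>r. norm (g r))"
          using Henstock_Kurzweil_Integration.integral_combine[OF P(3,4) weak_deriv_on_integral(2)[OF w, of p r]] pr P by simp
        have "norm (F (f q) - F (f p) - integral {p..q} G) \<le> e * integral {p..q} (\<lambda>r. norm (g r))"
          "norm (F (f r) - F (f q) - integral {q..r} G) \<le> e * integral {q..r} (\<lambda>r. norm (g r))"
          using P pr by auto
        from norm_triangle_mono[OF this]
        show "norm (F (f r) - F (f p) - integral {p..r} G) \<le> e * integral {p..r} (\<lambda>r. norm (g r))"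
          unfolding c1 c2 by (simp add: algebra_simps)
      qed
    next
      fix x assume x: "a \<le> x" "x \<le> t"
      then have xb: "x \<in> {a..b}" using t by auto
      let ?L = "?D x"
      have "e / 2 > 0" using e by simp
      then obtain d where d: "d > 0"
        "\<And>y. y \<in> ball (f x) d \<Longrightarrow> onorm (\<lambda>h. frechet_derivative F (at y) h - ?L h) \<le> e / 2"
        "\<And>y z. \<lbrakk>y \<in> ball (f x) d; z \<in> ball (f x) d\<rbrakk> \<Longrightarrow> norm (F y - F z - ?L (y - z)) \<le> e / 2 * norm (y - z)"
        by (rule C1_at_strict[OF F[OF xb]]) blast
      obtain \<delta> where \<delta>: "\<delta> > 0" "\<And>s. s \<in> {a..b} \<Longrightarrow> dist s x < \<delta> \<Longrightarrow> dist (f s) (f x) < d"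
        using cf xb d(1) unfolding continuous_on_iff by metis
      show "\<exists>d>0. \<forall>p q. p \<le> x \<and> x \<le> q \<and> q - p < d \<longrightarrow> ?P p q"
      proof (intro exI[of _ \<delta>] conjI allI impI \<delta>(1))
        fix p q assume pq: "p \<le> x \<and> x \<le> q \<and> q - p < \<delta>" and ab: "a \<le> p \<and> q \<le> b"
        then have le: "a \<le> p" "p \<le> q" "q \<le> b" by auto
        have inb: "f r \<in> ball (f x) d" if "r \<in> {p..q}" for r
          using \<delta>(2)[of r] that pq ab by (auto simp: dist_commute dist_real_def)
        note I = weak_deriv_on_integral[OF w le]
        have 1: "norm (F (f q) - F (f p) - ?L (f q - f p)) \<le> e / 2 * integral {p..q} (\<lambda>r. norm (g r))"
        proof -
          have "norm (F (f q) - F (f p) - ?L (f q - f p)) \<le> e / 2 * norm (f q - f p)"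
            using le by (intro d(3) inb) auto
          also have "\<dots> \<le> e / 2 * integral {p..q} (\<lambda>r. norm (g r))"
            unfolding I(3) using e by (intro mult_left_mono integral_norm_bound_integral I(1,2)) auto
          finally show ?thesis .
        qed
        have L: "?L (f q - f p) = integral {p..q} (\<lambda>r. ?L (g r))" "(\<lambda>r. ?L (g r)) integrable_on {p..q}"
          unfolding I(3) using integral_linear[OF I(1) bl[OF xb]] integrable_linear[OF I(1) bl[OF xb]]
          by (auto simp: o_def)
        have "norm (integral {p..q} (\<lambda>r. ?L (g r) - G r)) \<le> integral {p..q} (\<lambda>r. e / 2 * norm (g r))"
        proof (rule integral_norm_bound_integral)
          show "(\<lambda>r. ?L (g r) - G r) integrable_on {p..q}" using le by (intro integrable_diff L intG)
          show "(\<lambda>r. e / 2 * norm (g r)) integrable_on {p..q}" by (intro integrable_on_mult_right I)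
          fix r assume r: "r \<in> {p..q}"
          then have rb: "r \<in> {a..b}" using le by auto
          have "norm (?D r (g r) - ?L (g r)) \<le> onorm (\<lambda>h. ?D r h - ?L h) * norm (g r)"
            by (rule onorm[OF bounded_linear_sub[OF bl[OF rb] bl[OF xb]]])
          also have "\<dots> \<le> e / 2 * norm (g r)" using inb[OF r] by (intro mult_right_mono d(2)) auto
          finally show "norm (?L (g r) - G r) \<le> e / 2 * norm (g r)" using G[OF rb] by (simp add: norm_minus_commute)
        qed
        then have 2: "norm (?L (f q - f p) - integral {p..q} G) \<le> e / 2 * integral {p..q} (\<lambda>r. norm (g r))"
          using integral_diff[OF L(2) intG[OF le(1,3)]] L(1) by simp
        from norm_triangle_mono[OF 1 2]
        show "norm (F (f q) - F (f p) - integral {p..q} G) \<le> e * integral {p..q} (\<lambda>r. norm (g r))"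
          by (simp add: algebra_simps)
      qed
    qed
    then show ?thesis using t by simp
  qed
  have "weak_deriv_on a b (\<lambda>t. F (f t)) G"
  proof (rule weak_deriv_onI[OF meas sq])
    fix t assume t: "t \<in> {a..b}"
    let ?I = "integral {a..t} (\<lambda>r. norm (g r))"
    have I0: "0 \<le> ?I" using weak_deriv_on_integral(2)[OF w, of a t] t by (intro Henstock_Kurzweil_Integration.integral_nonneg) auto
    have "norm (F (f t) - F (f a) - integral {a..t} G) \<le> 0"
    proof (rule field_le_epsilon)
      fix e :: real assume e: "e > 0"
      have "norm (F (f t) - F (f a) - integral {a..t} G) \<le> e / (?I + 1) * ?I"
        using e I0 by (intro main[OF t]) (auto intro!: divide_pos_pos)
      also have "\<dots> \<le> 0 + e" using e I0 by (simp add: divide_simps mult_left_mono)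
      finally show "norm (F (f t) - F (f a) - integral {a..t} G) \<le> 0 + e" .
    qed
    then show "F (f t) - F (f a) = integral {a..t} G" by simp
  qed
  then show ?thesis unfolding G_def[abs_def] .
qed

section \<open>H^1 functions under composition, restriction, gluing and periodic extension\<close>

lemma h1_on_compose:
  fixes F :: "'a::euclidean_space \<Rightarrow> 'b::euclidean_space"
  shows "h1_on a b f \<Longrightarrow> (\<And>t. t \<in> {a..b} \<Longrightarrow> C1_at F (f t)) \<Longrightarrow> h1_on a b (\<lambda>t. F (f t))"
  unfolding h1_on_def using weak_deriv_compose by blast

lemma h1_on_cong:
  assumes "h1_on a b f" "\<And>t. t \<in> {a..b} \<Longrightarrow> f t = h t"
  shows "h1_on a b h"
proof (cases "a \<le> b")
  case True
  obtain g where g: "weak_deriv_on a b f g" using assms(1) unfolding h1_on_def by blast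
  have "h t = h a + (LINT s:{a..t}|lborel. g s)" if t: "t \<in> {a..b}" for t
  proof -
    have "f t = f a + (LINT s:{a..t}|lborel. g s)" using g t unfolding weak_deriv_on_def by blast
    then show ?thesis using assms(2)[OF t] assms(2)[of a] True by simp
  qed
  then show ?thesis using g unfolding h1_on_def weak_deriv_on_def by blast
next
  case False
  then show ?thesis unfolding h1_on_def weak_deriv_on_def
    by (intro exI[of _ "\<lambda>_. 0"]) (auto simp: set_integrable_def)
qed

text \<open>A pair is the sum of (f, 0) and (0, h), each a linear image of an H^1 function.\<close>

lemma h1_on_Pair:
  fixes f :: "real \<Rightarrow> 'a::euclidean_space" and h :: "real \<Rightarrow> 'b::euclidean_space"
  assumes "h1_on a b f" "h1_on a b h" shows "h1_on a b (\<lambda>t. (f t, h t))"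
proof -
  have "h1_on a b (\<lambda>t. (f t, 0::'b))" "h1_on a b (\<lambda>t. (0::'a, h t))"
    by (intro h1_on_compose[OF assms(1)] h1_on_compose[OF assms(2)] C1_at_bounded_linear bounded_linear_intros)+
  then obtain f' h' where "weak_deriv_on a b (\<lambda>t. (f t, 0::'b)) f'" "weak_deriv_on a b (\<lambda>t. (0::'a, h t)) h'"
    unfolding h1_on_def by blast
  from weak_deriv_add[OF this] show ?thesis unfolding h1_on_def by auto
qed

lemma weak_deriv_on_subinterval:
  assumes "weak_deriv_on a b f g" "a \<le> s" "t \<le> b"
  shows "weak_deriv_on s t f g"
proof (rule weak_deriv_onI)
  show "set_integrable lborel {s..t} (\<lambda>t. (norm (g t))\<^sup>2)"
    using assms unfolding weak_deriv_on_def by (auto intro: set_integrable_subset)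
  show "f r - f s = integral {s..r} g" if "r \<in> {s..t}" for r
    using that assms by (intro weak_deriv_on_integral(3)[OF assms(1)]) auto
qed (use assms in \<open>simp add: weak_deriv_on_def\<close>)

lemma h1_on_subinterval: "h1_on a b f \<Longrightarrow> a \<le> s \<Longrightarrow> t \<le> b \<Longrightarrow> h1_on s t f"
  unfolding h1_on_def using weak_deriv_on_subinterval by blast

lemma h1_on_combine:
  assumes "h1_on a m f" "h1_on m b f" "a \<le> m" "m \<le> b"
  shows "h1_on a b f"
proof -
  obtain g h where g: "weak_deriv_on a m f g" and h: "weak_deriv_on m b f h"
    using assms unfolding h1_on_def by blast
  define k where "k t = (if t \<le> m then g t else h t)" for t
  have [measurable]: "g \<in> borel_measurable borel" "h \<in> borel_measurable borel"
    using g h by (auto simp: weak_deriv_on_def)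
  have "weak_deriv_on a b f k"
  proof (rule weak_deriv_onI)
    show "k \<in> borel_measurable borel" unfolding k_def by measurable
    have s1: "set_integrable lborel {a..m} (\<lambda>t. (norm (g t))\<^sup>2)" using g by (simp add: weak_deriv_on_def)
    have "set_integrable lborel {m..b} (\<lambda>t. (norm (h t))\<^sup>2)" using h by (simp add: weak_deriv_on_def)
    \<comment> \<open>The half-open interval makes the two indicators add up to that of the whole
      interval.\<close>
    then have s2: "set_integrable lborel {m<..b} (\<lambda>t. (norm (h t))\<^sup>2)" by (rule set_integrable_subset) auto
    have "integrable lborel (\<lambda>t. indicator {a..m} t *\<^sub>R (norm (g t))\<^sup>2 + indicator {m<..b} t *\<^sub>R (norm (h t))\<^sup>2)"
      using s1 s2 unfolding set_integrable_def by (rule Bochner_Integration.integrable_add)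
    moreover have "(\<lambda>t. indicator {a..m} t *\<^sub>R (norm (g t))\<^sup>2 + indicator {m<..b} t *\<^sub>R (norm (h t))\<^sup>2) =
        (\<lambda>t. indicator {a..b} t *\<^sub>R (norm (k t))\<^sup>2)"
      using assms by (auto simp: fun_eq_iff indicator_def k_def)
    ultimately show "set_integrable lborel {a..b} (\<lambda>t. (norm (k t))\<^sup>2)" by (simp add: set_integrable_def)
    have left: "integral {a..t} k = integral {a..t} g" "k integrable_on {a..t}" if "a \<le> t" "t \<le> m" for t
    proof -
      have e: "\<And>x. x \<in> {a..t} \<Longrightarrow> k x = g x" using that by (auto simp: k_def)
      show "integral {a..t} k = integral {a..t} g" using e by (rule integral_cong)
      show "k integrable_on {a..t}"
        by (rule integrable_eq[OF weak_deriv_on_integral(1)[OF g, of a t]]) (use that e in auto)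
    qed
    have right: "integral {m..t} k = integral {m..t} h" "k integrable_on {m..t}" if "m \<le> t" "t \<le> b" for t
    proof -
      have e: "\<And>x. x \<in> {m..t} - {m} \<Longrightarrow> k x = h x" using that by (auto simp: k_def)
      show "integral {m..t} k = integral {m..t} h" by (rule integral_spike[of "{m}"]) (use e in auto)
      show "k integrable_on {m..t}"
        by (rule integrable_spike[OF weak_deriv_on_integral(1)[OF h, of m t], of "{m}"]) (use e that in auto)
    qed
    fix t assume t: "t \<in> {a..b}"
    show "f t - f a = integral {a..t} k"
    proof (cases "t \<le> m")
      case True
      then show ?thesis using left[of t] weak_deriv_on_integral(3)[OF g, of a t] t by simp
    next
      case False
      have "k integrable_on {a..t}"
        using Henstock_Kurzweil_Integration.integrable_combine[OF assms(3) _ left(2)[OF assms(3) order_refl] right(2)] False t by simp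
      from Henstock_Kurzweil_Integration.integral_combine[OF assms(3) _ this]
      have "integral {a..t} k = (f m - f a) + (f t - f m)"
        using False t left[of m] right[of t] assms weak_deriv_on_integral(3)[OF g, of a m] weak_deriv_on_integral(3)[OF h, of m t]
        by simp
      then show ?thesis by simp
    qed
  qed
  then show ?thesis unfolding h1_on_def by blast
qed

text \<open>Being H^1 is a local property on a compact interval, by bisection and gluing. This is
  what permits a loop to pass through several charts.\<close>

lemma h1_on_local:
  assumes "\<And>x. a \<le> x \<Longrightarrow> x \<le> b \<Longrightarrow> \<exists>d>0. \<forall>s t. a \<le> s \<and> s \<le> x \<and> x \<le> t \<and> t \<le> b \<and> t - s < d \<longrightarrow> h1_on s t f"
  shows "h1_on a b f"
proof (cases "a \<le> b")
  case True
  let ?P = "\<lambda>s t. a \<le> s \<and> t \<le> b \<longrightarrow> h1_on s t f"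
  have "?P a b"
  proof (rule Bolzano[of a b ?P, OF True])
    fix p q r assume *: "?P p q" "?P q r" "p \<le> q" "q \<le> r"
    show "?P p r"
    proof
      assume "a \<le> p \<and> r \<le> b"
      then show "h1_on p r f" using * by (intro h1_on_combine[of p q f r]) auto
    qed
  next
    fix x assume x: "a \<le> x" "x \<le> b"
    show "\<exists>d>0. \<forall>p q. p \<le> x \<and> x \<le> q \<and> q - p < d \<longrightarrow> ?P p q"
      using assms[OF x] by blast
  qed
  then show ?thesis by simp
next
  case False
  then show ?thesis unfolding h1_on_def weak_deriv_on_def
    by (intro exI[of _ "\<lambda>_. 0"]) (auto simp: set_integrable_def)
qed

lemma h1_on_shift:
  fixes f :: "real \<Rightarrow> 'a::euclidean_space"
  assumes "h1_on a b f" shows "h1_on (a + k) (b + k) (\<lambda>t. f (t - k))"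
proof -
  obtain g where g: "weak_deriv_on a b f g" using assms unfolding h1_on_def by blast
  have [measurable]: "g \<in> borel_measurable borel" using g by (simp add: weak_deriv_on_def)
  have ind: "indicator {p + k..q + k} (k + 1 * x) = (indicator {p..q} x :: real)" for p q x :: real
    by (auto simp: indicator_def)
  have "weak_deriv_on (a + k) (b + k) (\<lambda>t. f (t - k)) (\<lambda>t. g (t - k))"
    unfolding weak_deriv_on_def
  proof (intro conjI ballI)
    show "(\<lambda>t. g (t - k)) \<in> borel_measurable borel" by measurable
    have "integrable lborel (\<lambda>t. indicator {a..b} t *\<^sub>R (norm (g t))\<^sup>2)"
      using g by (simp add: weak_deriv_on_def set_integrable_def)
    then show "set_integrable lborel {a + k..b + k} (\<lambda>t. (norm (g (t - k)))\<^sup>2)"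
      unfolding set_integrable_def
      using lborel_integrable_real_affine_iff[of 1 "\<lambda>t. indicator {a + k..b + k} t *\<^sub>R (norm (g (t - k)))\<^sup>2" k]
      by (simp only: ind) simp
    fix t assume t: "t \<in> {a + k..b + k}"
    have "(LINT s:{a + k..t}|lborel. g (s - k)) = (LINT s:{a..t - k}|lborel. g s)"
      unfolding set_lebesgue_integral_def
      using lborel_integral_real_affine[of 1 "\<lambda>s. indicator {a + k..t} s *\<^sub>R g (s - k)" k] ind[of a "t - k"]
      by simp
    moreover have "f (t - k) = f a + (LINT s:{a..t - k}|lborel. g s)"
    proof -
      have "t - k \<in> {a..b}" using t by auto
      then show ?thesis using g unfolding weak_deriv_on_def by blast
    qed
    ultimately show "f (t - k) = f (a + k - k) + (LINT s:{a + k..t}|lborel. g (s - k))" by simp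
  qed
  then show ?thesis unfolding h1_on_def by blast
qed

lemma periodic1_int:
  assumes "periodic1 f" shows "f (t + of_int n) = f t"
proof -
  have p: "f (t + real m) = f t" for t m
  proof (induction m)
    case (Suc m)
    then show ?case using assms unfolding periodic1_def by (metis add.assoc of_nat_Suc add.commute)
  qed simp
  show ?thesis
  proof (cases "n \<ge> 0")
    case True
    then show ?thesis using p[of t "nat n"] by simp
  next
    case False
    then show ?thesis using p[of "t + of_int n" "nat (- n)"] by simp
  qed
qed

lemma periodic_h1_on:
  assumes per: "periodic1 f" and f: "h1_on 0 1 f"
  shows "h1_on a b f"
proof -
  have unit: "h1_on (of_int n) (of_int n + 1) f" for n :: int
  proof -
    have "(\<lambda>t. f (t - of_int n)) = f" using periodic1_int[OF per, of _ "- n"] by (auto simp: fun_eq_iff)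
    then show ?thesis using h1_on_shift[OF f, of "of_int n"] by (simp add: add.commute)
  qed
  have "h1_on (of_int n) (of_int n + real m) f" for n m
  proof (induction m)
    case 0
    show ?case using h1_on_subinterval[OF unit[of n], of "of_int n" "of_int n"] by simp
  next
    case (Suc m)
    have "h1_on (of_int n + real m) (of_int n + real (Suc m)) f"
      using unit[of "n + int m"] by (simp add: algebra_simps)
    from h1_on_combine[OF Suc this] show ?case by simp
  qed
  then have *: "h1_on (of_int \<lfloor>a\<rfloor>) (of_int \<lfloor>a\<rfloor> + real (nat (\<lceil>b\<rceil> - \<lfloor>a\<rfloor>))) f" by blast
  show ?thesis
  proof (cases "a \<le> b")
    case True
    then have "b \<le> of_int \<lfloor>a\<rfloor> + real (nat (\<lceil>b\<rceil> - \<lfloor>a\<rfloor>))"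
      by (smt (verit) le_of_int_ceiling of_int_diff of_int_floor_le of_nat_nat of_int_of_nat_eq le_nat_iff of_int_0_le_iff)
    then show ?thesis using h1_on_subinterval[OF *, of a b] by simp
  next
    case False
    then show ?thesis using h1_on_local[of a b f] by simp
  qed
qed

section \<open>Estimates in the H^1 norm\<close>

lemma loop_of_Abs_h1: "periodic1 f \<Longrightarrow> h1_on 0 1 f \<Longrightarrow> loop_of (Abs_h1 f) = f"
  by (simp add: Abs_h1_inverse)

lemma periodic_loop_of: "periodic1 (loop_of \<xi>)" and h1_on_loop_of: "h1_on 0 1 (loop_of \<xi>)"
  using loop_of[of \<xi>] by auto

lemma loop_of_diff: "loop_of (f - h) t = loop_of f t - loop_of h t"
  unfolding minus_h1_def plus_h1.rep_eq scaleR_h1.rep_eq by simp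

text \<open>\<open>wderiv\<close> is an arbitrary choice; almost everywhere uniqueness lets the norm
  be computed from whichever weak derivative is explicit.\<close>

lemma norm_h1_eq:
  fixes f :: "'a::euclidean_space h1"
  assumes w: "weak_deriv_on 0 1 (loop_of f) f'"
  shows "(norm f)\<^sup>2 = (LINT t:{0..1}|lborel. (norm (loop_of f t))\<^sup>2) + (LINT t:{0..1}|lborel. (norm (f' t))\<^sup>2)"
proof -
  have [measurable]: "f' \<in> borel_measurable borel" "wderiv f \<in> borel_measurable borel"
    using w wderiv_measurable by (auto simp: weak_deriv_on_def)
  have "AE t in lborel. t \<in> {0..1} \<longrightarrow> wderiv f t = f' t"
    by (rule weak_deriv_unique_AE[OF wderiv w])
  then have "(LINT t:{0..1}|lborel. inner (wderiv f t) (wderiv f t)) = (LINT t:{0..1}|lborel. (norm (f' t))\<^sup>2)"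
    by (intro set_lebesgue_integral_cong_AE) (auto simp: power2_norm_eq_inner)
  moreover have "(norm f)\<^sup>2 = inner f f" by (rule power2_norm_eq_inner)
  ultimately show ?thesis by (simp add: inner_h1_def power2_norm_eq_inner)
qed

lemma set_integrable_loop_square: "set_integrable lborel {0..1} (\<lambda>t. (norm (loop_of f t))\<^sup>2)"
  by (intro borel_integrable_atLeastAtMost' continuous_intros loop_of_continuous)

lemma norm_h1_le:
  fixes f :: "'a::euclidean_space h1" and h :: "'b::euclidean_space h1"
  assumes f: "weak_deriv_on 0 1 (loop_of f) f'" and h: "weak_deriv_on 0 1 (loop_of h) h'" and e: "e \<ge> 0"
    and le: "\<And>t. t \<in> {0..1} \<Longrightarrow> norm (loop_of f t) \<le> e * norm (loop_of h t)"
    and le': "\<And>t. t \<in> {0..1} \<Longrightarrow> norm (f' t) \<le> e * norm (h' t)"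
  shows "norm f \<le> e * norm h"
proof (rule power2_le_imp_le)
  have sq: "(norm x)\<^sup>2 \<le> e\<^sup>2 * (norm y)\<^sup>2" if "norm x \<le> e * norm y" for x :: 'a and y :: 'b
    using power_mono[OF that norm_ge_zero, of 2] by (simp add: power_mult_distrib)
  have i: "set_integrable lborel {0..1} (\<lambda>t. (norm (f' t))\<^sup>2)" "set_integrable lborel {0..1} (\<lambda>t. (norm (h' t))\<^sup>2)"
    using f h by (auto simp: weak_deriv_on_def)
  have "(norm f)\<^sup>2 \<le> (LINT t:{0..1}|lborel. e\<^sup>2 * (norm (loop_of h t))\<^sup>2) + (LINT t:{0..1}|lborel. e\<^sup>2 * (norm (h' t))\<^sup>2)"
    unfolding norm_h1_eq[OF f]
    by (intro add_mono set_integral_mono set_integrable_mult_right set_integrable_loop_square i sq le le') auto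
  also have "\<dots> = (e * norm h)\<^sup>2"
    unfolding power_mult_distrib norm_h1_eq[OF h] by (simp add: algebra_simps)
  finally show "(norm f)\<^sup>2 \<le> (e * norm h)\<^sup>2" .
qed (use e in simp)

text \<open>The Sobolev embedding into continuous loops. After scaling to norm 1, |F(t)| is at most
  |F(s)| plus the integral of |F'|. Averaging over s and using y \<le> (1 + y^2)/2 in place of
  Cauchy-Schwarz gives 3/2, rounded up to 2.\<close>

lemma loop_of_bound: "norm (loop_of \<xi> t) \<le> 2 * norm \<xi>"
proof -
  have unit: "norm (loop_of f t) \<le> 2" if f: "norm f = 1" and t: "t \<in> {0..1}" for f :: "'a h1" and t
  proof -
    define F where "F = loop_of f"
    define D where "D = wderiv f"
    have w: "weak_deriv_on 0 1 F D" unfolding F_def D_def by (rule wderiv)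
    have sqD: "set_integrable lborel {0..1} (\<lambda>t. (norm (D t))\<^sup>2)" using w by (simp add: weak_deriv_on_def)
    have sqF: "set_integrable lborel {0..1} (\<lambda>t. (norm (F t))\<^sup>2)" unfolding F_def by (rule set_integrable_loop_square)
    have iD: "(\<lambda>t. (norm (D t))\<^sup>2) integrable_on {0..1}" and iF: "(\<lambda>t. (norm (F t))\<^sup>2) integrable_on {0..1}"
      using set_borel_integral_eq_integral(1) sqD sqF by blast+
    have n: "integral {0..1} (\<lambda>t. (norm (F t))\<^sup>2) + integral {0..1} (\<lambda>t. (norm (D t))\<^sup>2) = 1"
      using norm_h1_eq[OF w[unfolded F_def]] f set_borel_integral_eq_integral(2)[OF sqD] set_borel_integral_eq_integral(2)[OF sqF]
      by (simp add: F_def)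
    have am: "norm x \<le> (1 + (norm x)\<^sup>2) / 2" for x :: 'a
      using zero_le_power2[of "norm x - 1"] by (simp add: power2_eq_square algebra_simps)
    have nD: "(\<lambda>t. norm (D t)) integrable_on {0..1}" by (rule weak_deriv_on_integral(2)[OF w]) auto
    have h: "(\<lambda>s. (1 + (norm (D s))\<^sup>2) / 2) integrable_on {0..1}" "(\<lambda>s. (1 + (norm (F s))\<^sup>2) / 2) integrable_on {0..1}"
      using iD iF by (auto intro!: integrable_on_divide integrable_add)
    have hv: "integral {0..1} (\<lambda>s. (1 + (norm (D s))\<^sup>2) / 2) = (1 + integral {0..1} (\<lambda>t. (norm (D t))\<^sup>2)) / 2"
      "integral {0..1} (\<lambda>s. (1 + (norm (F s))\<^sup>2) / 2) = (1 + integral {0..1} (\<lambda>t. (norm (F t))\<^sup>2)) / 2"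
      using integral_add[OF _ iD, of "\<lambda>_. 1"] integral_add[OF _ iF, of "\<lambda>_. 1"] by auto
    define J where "J = integral {0..1} (\<lambda>t. norm (D t))"
    have J: "J \<le> (1 + integral {0..1} (\<lambda>t. (norm (D t))\<^sup>2)) / 2"
      unfolding J_def hv(1)[symmetric] by (rule integral_le[OF nD h(1)]) (rule am)
    have seg: "norm (F q - F p) \<le> J" if "0 \<le> p" "p \<le> q" "q \<le> 1" for p q
    proof -
      have "norm (F q - F p) \<le> integral {p..q} (\<lambda>t. norm (D t))"
        unfolding weak_deriv_on_integral(3)[OF w that]
        by (intro integral_norm_bound_integral weak_deriv_on_integral[OF w that]) auto
      also have "\<dots> \<le> J" unfolding J_def
        by (rule integral_subset_le) (use that nD weak_deriv_on_integral(2)[OF w that] in auto)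
      finally show ?thesis .
    qed
    have pt: "norm (F t) \<le> (1 + (norm (F s))\<^sup>2) / 2 + J" if s: "s \<in> {0..1}" for s
    proof -
      have "norm (F t - F s) \<le> J"
        using seg[of s t] seg[of t s] s t by (cases "s \<le> t") (auto simp: norm_minus_commute)
      then show ?thesis using norm_triangle_sub[of "F t" "F s"] am[of "F s"] by linarith
    qed
    have "integral {0..1} (\<lambda>s::real. norm (F t)) \<le> integral {0..1} (\<lambda>s. (1 + (norm (F s))\<^sup>2) / 2 + J)"
      by (rule integral_le) (use pt h(2) in \<open>auto intro!: integrable_add\<close>)
    also have "\<dots> = (1 + integral {0..1} (\<lambda>t. (norm (F t))\<^sup>2)) / 2 + J"
      using integral_add[OF h(2) integrable_const_ivl[of J 0 1]] hv(2) by simp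
    finally have "norm (F t) \<le> (1 + integral {0..1} (\<lambda>t. (norm (F t))\<^sup>2)) / 2 + J" by simp
    then have "norm (F t) \<le> 2" using J n by argo
    then show ?thesis by (simp add: F_def)
  qed
  have "norm (loop_of \<xi> t) \<le> 2 * norm \<xi>" if t: "t \<in> {0..1}" for t
  proof (cases "\<xi> = 0")
    case False
    have "norm (loop_of ((1 / norm \<xi>) *\<^sub>R \<xi>) t) \<le> 2" using False t by (intro unit) auto
    then show ?thesis using False by (simp add: scaleR_h1.rep_eq divide_le_eq)
  qed (simp add: zero_h1.rep_eq)
  moreover have "loop_of \<xi> t = loop_of \<xi> (frac t)"
    using periodic1_int[OF periodic_loop_of, of \<xi> "frac t" "\<lfloor>t\<rfloor>"] by (simp add: frac_def)
  moreover have "frac t \<in> {0..1}" using frac_ge_0[of t] frac_lt_1[of t] by simp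
  ultimately show ?thesis by metis
qed

lemma bounded_linear_loop_of: "bounded_linear (\<lambda>\<xi>. loop_of \<xi> t)"
  by (rule bounded_linear_intro[where K = 2])
    (simp_all only: plus_h1.rep_eq scaleR_h1.rep_eq mult.commute[of _ "2::real"] loop_of_bound)

section \<open>Superposition operators and their differentials at constant loops\<close>

definition superpos :: "('a::euclidean_space \<Rightarrow> 'b::euclidean_space) \<Rightarrow> 'a h1 \<Rightarrow> 'b h1" where
  "superpos F \<xi> = Abs_h1 (\<lambda>x. F (loop_of \<xi> x))"

definition const_h1 :: "'a::euclidean_space \<Rightarrow> 'a h1" where
  "const_h1 u = Abs_h1 (\<lambda>_. u)"

lemma weak_deriv_const: "weak_deriv_on a b (\<lambda>_. u) (\<lambda>_. 0)"
  by (auto simp: weak_deriv_on_def set_integrable_def)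

lemma loop_of_const_h1 [simp]: "loop_of (const_h1 u) = (\<lambda>_. u)"
  unfolding const_h1_def
  by (rule loop_of_Abs_h1) (auto simp: periodic1_def h1_on_def intro: weak_deriv_const)

lemma loop_of_superpos:
  assumes "\<And>x. C1_at F (loop_of \<xi> x)"
  shows "loop_of (superpos F \<xi>) = (\<lambda>x. F (loop_of \<xi> x))"
  unfolding superpos_def
  using periodic_loop_of[of \<xi>] by (intro loop_of_Abs_h1 h1_on_compose[OF h1_on_loop_of] assms) (simp add: periodic1_def)

lemma bounded_linear_superpos:
  fixes A :: "'a::euclidean_space \<Rightarrow> 'b::euclidean_space"
  assumes A: "bounded_linear A"
  shows "bounded_linear (superpos A)"
proof -
  have l: "loop_of (superpos A \<xi>) = (\<lambda>x. A (loop_of \<xi> x))" for \<xi>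
    by (intro loop_of_superpos C1_at_bounded_linear A)
  have D: "frechet_derivative A (at y) = A" for y
    using frechet_derivative_at[OF bounded_linear_imp_has_derivative[OF A]] by simp
  have add: "superpos A (\<xi> + \<eta>) = superpos A \<xi> + superpos A \<eta>" for \<xi> \<eta>
    by (rule loop_of_eqI) (simp add: l plus_h1.rep_eq linear_add[OF bounded_linear.linear[OF A]])
  have scale: "superpos A (r *\<^sub>R \<xi>) = r *\<^sub>R superpos A \<xi>" for r \<xi>
    by (rule loop_of_eqI) (simp add: l scaleR_h1.rep_eq linear_scale[OF bounded_linear.linear[OF A]])
  show ?thesis
  proof (rule bounded_linear_intro[OF add scale])
    fix \<xi> :: "'a h1"
    have "norm (superpos A \<xi>) \<le> onorm A * norm \<xi>"
    proof (rule norm_h1_le[OF _ wderiv])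
      show "weak_deriv_on 0 1 (loop_of (superpos A \<xi>)) (\<lambda>t. indicator {0..1} t *\<^sub>R A (wderiv \<xi> t))"
        using weak_deriv_compose[OF wderiv[of \<xi>] C1_at_bounded_linear[OF A]] by (simp add: l D)
    qed (auto simp: l onorm[OF A] onorm_pos_le[OF A])
    then show "norm (superpos A \<xi>) \<le> norm \<xi> * onorm A" by (simp add: mult.commute)
  qed
qed

text \<open>At a constant loop the base point contributes no derivative, so the remainder has weak
  derivative (F'(Y) - A) Y'. Both the remainder and this derivative are bounded pointwise through
  \<open>C1_at_strict\<close>, and \<open>norm_h1_le\<close> turns the bounds into one for the H^1
  norm.\<close>

lemma superpos_has_derivative:
  fixes F :: "'a::euclidean_space \<Rightarrow> 'b::euclidean_space"
  assumes F: "C1_at F u"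
  shows "(superpos F has_derivative superpos (frechet_derivative F (at u))) (at (const_h1 u))"
proof -
  let ?A = "frechet_derivative F (at u)"
  have A: "bounded_linear ?A" using C1_at_has_derivative[OF F] has_derivative_bounded_linear by blast
  have lA: "loop_of (superpos ?A \<xi>) = (\<lambda>x. ?A (loop_of \<xi> x))" for \<xi>
    by (intro loop_of_superpos C1_at_bounded_linear A)
  have "\<exists>d>0. \<forall>Y. norm (Y - const_h1 u) < d \<longrightarrow>
      norm (superpos F Y - superpos F (const_h1 u) - superpos ?A (Y - const_h1 u)) \<le> e * norm (Y - const_h1 u)"
    if e: "e > 0" for e
  proof -
    obtain d where d: "d > 0" "\<And>y. y \<in> ball u d \<Longrightarrow> C1_at F y"
      "\<And>y. y \<in> ball u d \<Longrightarrow> onorm (\<lambda>h. frechet_derivative F (at y) h - ?A h) \<le> e"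
      "\<And>y z. \<lbrakk>y \<in> ball u d; z \<in> ball u d\<rbrakk> \<Longrightarrow> norm (F y - F z - ?A (y - z)) \<le> e * norm (y - z)"
      by (rule C1_at_strict[OF F e]) blast
    have "norm (superpos F Y - superpos F (const_h1 u) - superpos ?A (Y - const_h1 u)) \<le> e * norm (Y - const_h1 u)"
      if Y: "norm (Y - const_h1 u) < d / 2" for Y
    proof -
      \<comment> \<open>The radius d/2 absorbs the factor 2 of \<open>loop_of_bound\<close>.\<close>
      have inb: "loop_of Y x \<in> ball u d" for x
        using loop_of_bound[of "Y - const_h1 u" x] Y by (simp add: loop_of_diff dist_norm norm_minus_commute)
      have lF: "loop_of (superpos F Y) = (\<lambda>x. F (loop_of Y x))" by (intro loop_of_superpos d(2) inb)
      have lu: "loop_of (superpos F (const_h1 u)) = (\<lambda>x. F u)" using F by (subst loop_of_superpos) auto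
      let ?R = "superpos F Y - superpos F (const_h1 u) - superpos ?A (Y - const_h1 u)"
      let ?F = "\<lambda>y. F y - F u - ?A (y - u)"
      have lR: "loop_of ?R = (\<lambda>x. ?F (loop_of Y x))"
        by (simp add: fun_eq_iff loop_of_diff lF lu lA)
      \<comment> \<open>The remainder is an affine function of the pair (F y, y).\<close>
      have C1: "C1_at ?F (loop_of Y x)" for x
      proof -
        have "C1_at (\<lambda>y. (\<lambda>p. fst p - F u - ?A (snd p - u)) (F y, y)) (loop_of Y x)"
        proof (rule C1_at_compose[OF C1_at_Pair[OF d(2)[OF inb] C1_at_ident]])
          have "C1_at (\<lambda>p. (fst p - ?A (snd p)) + (?A u - F u)) z" for z :: "'b \<times> 'a"
          proof (rule C1_at_compose[of "\<lambda>p. fst p - ?A (snd p)" z "\<lambda>q. q + (?A u - F u)"])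
            show "C1_at (\<lambda>p. fst p - ?A (snd p)) z"
              by (intro C1_at_bounded_linear bounded_linear_sub bounded_linear_fst bounded_linear_compose[OF A] bounded_linear_snd)
            show "C1_at (\<lambda>q. q + (?A u - F u)) w" for w
              by (rule C1_atI[of UNIV _ _ "\<lambda>_. id_blinfun"]) (auto intro!: derivative_eq_intros)
          qed
          then show "C1_at (\<lambda>p. fst p - F u - ?A (snd p - u)) (F (loop_of Y x), loop_of Y x)"
            by (simp add: linear_diff[OF bounded_linear.linear[OF A]] algebra_simps)
        qed
        then show ?thesis by simp
      qed
      have DF: "frechet_derivative ?F (at (loop_of Y x)) = (\<lambda>h. frechet_derivative F (at (loop_of Y x)) h - ?A h)" for x
      proof (rule frechet_derivative_at[symmetric])
        have "((\<lambda>y. y - u) has_derivative (\<lambda>h. h)) (at (loop_of Y x))" by (auto intro!: derivative_eq_intros)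
        from has_derivative_compose[OF this bounded_linear_imp_has_derivative[OF A]]
        have "((\<lambda>y. ?A (y - u)) has_derivative ?A) (at (loop_of Y x))" .
        then show "(?F has_derivative (\<lambda>h. frechet_derivative F (at (loop_of Y x)) h - ?A h)) (at (loop_of Y x))"
          using has_derivative_diff[OF has_derivative_diff[OF C1_at_has_derivative[OF d(2)[OF inb]] has_derivative_const]]
          by simp
      qed
      \<comment> \<open>Subtracting a constant loop does not change the weak derivative.\<close>
      have wY: "weak_deriv_on 0 1 (loop_of (Y - const_h1 u)) (wderiv Y)"
        using weak_deriv_add[OF wderiv[of Y] weak_deriv_const[of 0 1 "- u"]] by (simp add: loop_of_diff[abs_def])
      show ?thesis
      proof (rule norm_h1_le[OF _ wY])
        show "weak_deriv_on 0 1 (loop_of ?R)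
           (\<lambda>t. indicator {0..1} t *\<^sub>R (frechet_derivative F (at (loop_of Y t)) (wderiv Y t) - ?A (wderiv Y t)))"
          using weak_deriv_compose[OF wderiv[of Y] C1] unfolding lR DF by simp
        show "norm (loop_of ?R t) \<le> e * norm (loop_of (Y - const_h1 u) t)" for t
          using d(4)[OF inb, of u t] d(1) unfolding lR by (simp add: loop_of_diff)
        show "norm (indicator {0..1} t *\<^sub>R (frechet_derivative F (at (loop_of Y t)) (wderiv Y t) - ?A (wderiv Y t)))
           \<le> e * norm (wderiv Y t)" if "t \<in> {0..1}" for t
        proof -
          have bF: "bounded_linear (frechet_derivative F (at (loop_of Y t)))"
            using C1_at_has_derivative[OF d(2)[OF inb]] has_derivative_bounded_linear by blast
          have "norm (frechet_derivative F (at (loop_of Y t)) (wderiv Y t) - ?A (wderiv Y t)) \<le>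
              onorm (\<lambda>h. frechet_derivative F (at (loop_of Y t)) h - ?A h) * norm (wderiv Y t)"
            by (rule onorm[OF bounded_linear_sub[OF bF A]])
          also have "\<dots> \<le> e * norm (wderiv Y t)" by (intro mult_right_mono d(3) inb) simp
          finally show ?thesis using that by simp
        qed
      qed (use e in simp)
    qed
    then show ?thesis using d(1) by (intro exI[of _ "d / 2"]) auto
  qed
  then show ?thesis
    unfolding has_derivative_at_alt using bounded_linear_superpos[OF A] by blast
qed

text \<open>The kernel contains $\cos(2\pi x)^k v$ for all \<open>k\<close>.\<close>

lemma superpos_not_fredholm:
  fixes A :: "'a::euclidean_space \<Rightarrow> 'b::euclidean_space"
  assumes A: "bounded_linear A" and v: "v \<noteq> 0" "A v = 0"
  shows "\<not> fredholm_operator (superpos A)"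
proof
  assume "fredholm_operator (superpos A)"
  then obtain K where K: "finite K" "span K = {\<xi>. superpos A \<xi> = 0}"
    unfolding fredholm_operator_def by blast
  define cs where "cs x = cos (2 * pi * x)" for x :: real
  define \<phi> where "\<phi> k = Abs_h1 (\<lambda>x. cs x ^ k *\<^sub>R v)" for k
  \<comment> \<open>The identity of the unit interval is H^1; powers of the cosine are C^1 functions
    of it.\<close>
  have h1: "h1_on 0 1 (\<lambda>x. x)"
    unfolding h1_on_def
  proof (intro exI[of _ "\<lambda>_. 1"] weak_deriv_onI)
    show "set_integrable lborel {0..1::real} (\<lambda>t::real. (norm (1::real))\<^sup>2)"
      by (intro borel_integrable_atLeastAtMost' continuous_intros)
  qed simp_all
  have l\<phi>: "loop_of (\<phi> k) = (\<lambda>x. cs x ^ k *\<^sub>R v)" for k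
    unfolding \<phi>_def
  proof (rule loop_of_Abs_h1)
    have "cs (x + 1) = cs x" for x
      using cos_periodic[of "2 * pi * x"] by (simp add: cs_def algebra_simps)
    then show "periodic1 (\<lambda>x. cs x ^ k *\<^sub>R v)" by (simp add: periodic1_def)
    show "h1_on 0 1 (\<lambda>x. cs x ^ k *\<^sub>R v)"
    proof (rule h1_on_compose[OF h1])
      let ?c' = "\<lambda>x. of_nat k * (- sin (2 * pi * x) * (2 * pi)) * cs x ^ (k - 1)"
      show "C1_at (\<lambda>x. cs x ^ k *\<^sub>R v) t" for t
      proof (rule C1_atI[of UNIV _ _ "\<lambda>x. blinfun_scaleR_left (?c' x *\<^sub>R v)"])
        show "((\<lambda>x. cs x ^ k *\<^sub>R v) has_derivative blinfun_apply (blinfun_scaleR_left (?c' y *\<^sub>R v))) (at y)" for y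
          unfolding cs_def by (auto intro!: derivative_eq_intros simp: mult_ac)
        show "continuous_on UNIV (\<lambda>x. blinfun_scaleR_left (?c' x *\<^sub>R v))"
          unfolding cs_def by (intro continuous_intros)
      qed auto
    qed
  qed
  have ker: "\<phi> k \<in> span K" for k
  proof -
    have "superpos A (\<phi> k) = 0"
    proof (rule loop_of_eqI)
      fix t
      have "loop_of (superpos A (\<phi> k)) = (\<lambda>x. A (loop_of (\<phi> k) x))" by (intro loop_of_superpos C1_at_bounded_linear A)
      then show "loop_of (superpos A (\<phi> k)) t = loop_of 0 t"
        using v(2) by (simp add: l\<phi> zero_h1.rep_eq linear_scale[OF bounded_linear.linear[OF A]])
    qed
    then show ?thesis using K by simp
  qed
  have lsum: "loop_of (\<Sum>k\<le>n. a k *\<^sub>R \<phi> k) x = (\<Sum>k\<le>n. a k * cs x ^ k) *\<^sub>R v" for a and n :: nat and x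
    by (induction n) (simp_all add: plus_h1.rep_eq scaleR_h1.rep_eq l\<phi> algebra_simps)
  \<comment> \<open>The cosine takes every value in [-1, 1], so a linear relation makes a polynomial
    vanish on an infinite set.\<close>
  have coeff0: "a k = 0" if s: "(\<Sum>k\<le>n. a k *\<^sub>R \<phi> k) = 0" and k: "k \<le> n" for a n k
  proof (rule ccontr)
    assume "a k \<noteq> 0"
    then have fin: "finite {z::real. (\<Sum>i\<le>n. a i * z ^ i) = 0}" using k by (auto simp: polyfun_finite_roots)
    have sub: "{-1..1} \<subseteq> {z. (\<Sum>i\<le>n. a i * z ^ i) = 0}"
    proof
      fix z :: real assume z: "z \<in> {-1..1}"
      have "cs (arccos z / (2 * pi)) = z" using z by (simp add: cs_def)
      then have "(\<Sum>i\<le>n. a i * z ^ i) *\<^sub>R v = 0"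
        using lsum[of a n "arccos z / (2 * pi)"] s by (simp add: zero_h1.rep_eq)
      then show "z \<in> {z. (\<Sum>i\<le>n. a i * z ^ i) = 0}" using v(1) by simp
    qed
    show False using finite_subset[OF sub fin] infinite_Icc[of "-1" "1::real"] by simp
  qed
  have inj: "inj \<phi>"
  proof (rule injI, rule ccontr)
    fix i j assume eq: "\<phi> i = \<phi> j" and ne: "i \<noteq> j"
    let ?a = "\<lambda>k. if k = i then 1 else if k = j then -1 else (0::real)"
    let ?n = "max i j"
    have "(\<Sum>k\<le>?n. ?a k *\<^sub>R \<phi> k) = (\<Sum>k\<in>{i, j}. ?a k *\<^sub>R \<phi> k)"
      by (rule sum.mono_neutral_right) auto
    also have "\<dots> = 0" using ne eq by simp
    finally show False using coeff0[of ?a ?n i] by simp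
  qed
  \<comment> \<open>The indices 0 to n give n + 1 independent kernel elements, one more than
    \<open>K\<close> can span.\<close>
  define n where "n = card K"
  have "independent (\<phi> ` {..n})"
  proof (rule independent_if_scalars_zero)
    fix f x assume s: "(\<Sum>x\<in>\<phi> ` {..n}. f x *\<^sub>R x) = 0" and x: "x \<in> \<phi> ` {..n}"
    have "(\<Sum>k\<le>n. f (\<phi> k) *\<^sub>R \<phi> k) = 0"
      using s by (simp add: sum.reindex[OF inj_on_subset[OF inj subset_UNIV]])
    from coeff0[OF this] show "f x = 0" using x by auto
  qed simp
  then have "card (\<phi> ` {..n}) \<le> card K"
    using independent_span_bound[OF K(1)] ker by blast
  then show False using card_image[OF inj_on_subset[OF inj subset_UNIV], of "{..n}"] by (simp add: n_def)
qed

section \<open>The exponential map of the $L^2$ metric\<close>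

lemma C1_at_bounded_bilinear:
  fixes B :: "'a::euclidean_space \<Rightarrow> 'b::euclidean_space \<Rightarrow> 'c::euclidean_space"
  assumes "bounded_bilinear B"
  shows "C1_at (\<lambda>p. B (fst p) (snd p)) z"
proof -
  interpret B: bounded_bilinear B by (rule assms)
  define D where "D p h = B (fst p) (snd h) + B (fst h) (snd p)" for p h
  have bl: "bounded_linear (D p)" for p
    unfolding D_def
    by (intro bounded_linear_add bounded_linear_compose[OF B.bounded_linear_right] bounded_linear_compose[OF B.bounded_linear_left]
        bounded_linear_fst bounded_linear_snd)
  show ?thesis
  proof (rule C1_atI[of UNIV z _ "\<lambda>p. Blinfun (D p)"])
    show "((\<lambda>p. B (fst p) (snd p)) has_derivative blinfun_apply (Blinfun (D p))) (at p)" for p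
      unfolding bounded_linear_Blinfun_apply[OF bl] D_def
      by (intro B.FDERIV bounded_linear_imp_has_derivative bounded_linear_fst bounded_linear_snd)
    show "continuous_on UNIV (\<lambda>p. Blinfun (D p))"
    proof (rule continuous_on_blinfun_componentwise)
      show "continuous_on UNIV (\<lambda>p. blinfun_apply (Blinfun (D p)) i)" for i
        unfolding bounded_linear_Blinfun_apply[OF bl] D_def
        by (intro continuous_intros B.continuous_on)
    qed
  qed auto
qed

context lie_group_chart
begin

lemma Exp_loop_H1: "(\<lambda>x. Exp (loop_of \<xi> x)) \<in> H1_loops G"
proof -
  have per: "periodic1 (\<lambda>x. Exp (loop_of \<xi> x))"
    using periodic_loop_of[of \<xi>] by (simp add: periodic1_def)
  have h1: "h1_on a b (loop_of \<xi>)" for a b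
    by (rule periodic_h1_on[OF periodic_loop_of h1_on_loop_of])
  have "isCont (loop_of \<xi>) x" for x
  proof -
    have "continuous_on {x - 1..x + 1} (loop_of \<xi>)"
      using h1[of "x - 1" "x + 1"] weak_deriv_continuous unfolding h1_on_def by blast
    then show ?thesis by (rule continuous_on_interior) simp
  qed
  then have "continuous_map euclidean euclidean (loop_of \<xi>)"
    by (simp add: continuous_at_imp_continuous_on)
  from continuous_map_compose[OF this gC1_continuous_map[OF Exp_C1]]
  have cont: "continuous_map euclidean (topol G) (\<lambda>x. Exp (loop_of \<xi> x))" by (simp add: o_def)
  have "h1_on a b (snd d \<circ> (\<lambda>x. Exp (loop_of \<xi> x)))"
    if "d \<in> atlas G" "(\<lambda>x. Exp (loop_of \<xi> x)) ` {a..b} \<subseteq> fst d" for d a b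
    unfolding o_def
    by (rule h1_on_compose[where F = "\<lambda>Y. snd d (Exp Y)", OF h1])
      (use that in \<open>auto intro!: gC1_chart(2)[OF Exp_C1]\<close>)
  then show ?thesis using per cont by (simp add: H1_loops_def)
qed

text \<open>\<open>Abs_h1\<close> is meaningful only on H^1 functions. Near each point of the circle
  both loops stay in single charts, where the coordinate is a C^1 function of the pair of their H^1
  coordinates.\<close>

lemma loop_chart_coordinate:
  assumes \<sigma>: "\<sigma> \<in> H1_loops G" and \<tau>: "\<tau> \<in> H1_loops G" and st: "\<And>x. inv (\<sigma> x) \<otimes> \<tau> x \<in> fst c"
  shows "loop_of (Abs_h1 (\<lambda>x. snd c (inv (\<sigma> x) \<otimes> \<tau> x))) = (\<lambda>x. snd c (inv (\<sigma> x) \<otimes> \<tau> x))"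
proof (rule loop_of_Abs_h1)
  show "periodic1 (\<lambda>x. snd c (inv (\<sigma> x) \<otimes> \<tau> x))"
    using \<sigma> \<tau> by (simp add: H1_loops_def periodic1_def)
  have open_pre: "open {x. \<rho> x \<in> fst d}" if "\<rho> \<in> H1_loops G" "d \<in> atlas G" for \<rho> d
  proof -
    have "continuous_map euclidean (topol G) \<rho>" using that by (simp add: H1_loops_def)
    from openin_continuous_map_preimage[OF this chart_openin[OF that(2)]] show ?thesis by simp
  qed
  show "h1_on 0 1 (\<lambda>x. snd c (inv (\<sigma> x) \<otimes> \<tau> x))"
  proof (rule h1_on_local)
    fix x :: real
    have car: "\<sigma> r \<in> carrier G" "\<tau> r \<in> carrier G" for r using \<sigma> \<tau> by (auto simp: H1_loops_def)
    obtain d1 d2 where d: "d1 \<in> atlas G" "\<sigma> x \<in> fst d1" "d2 \<in> atlas G" "\<tau> x \<in> fst d2"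
      using chart_at car by metis
    have "open ({x. \<sigma> x \<in> fst d1} \<inter> {x. \<tau> x \<in> fst d2})" by (intro open_Int open_pre \<sigma> \<tau> d)
    moreover have "x \<in> {x. \<sigma> x \<in> fst d1} \<inter> {x. \<tau> x \<in> fst d2}" using d by simp
    ultimately obtain \<delta> where \<delta>: "\<delta> > 0" "ball x \<delta> \<subseteq> {x. \<sigma> x \<in> fst d1} \<inter> {x. \<tau> x \<in> fst d2}"
      by (meson openE)
    have "h1_on s t (\<lambda>x. snd c (inv (\<sigma> x) \<otimes> \<tau> x))" if s: "s \<le> x" "x \<le> t" "t - s < \<delta>" for s t
    proof -
      have inb: "\<sigma> r \<in> fst d1" "\<tau> r \<in> fst d2" if r: "r \<in> {s..t}" for r
      proof -
        have "r \<in> ball x \<delta>" using r s by (auto simp: dist_real_def)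
        then show "\<sigma> r \<in> fst d1" "\<tau> r \<in> fst d2" using \<delta> by auto
      qed
      have "h1_on s t (snd d1 \<circ> \<sigma>)" "h1_on s t (snd d2 \<circ> \<tau>)"
        using \<sigma> \<tau> d inb unfolding H1_loops_def by (auto simp: image_subset_iff)
      then have p: "h1_on s t (\<lambda>r. (snd d1 (\<sigma> r), snd d2 (\<tau> r)))"
        unfolding o_def by (rule h1_on_Pair)
      let ?F = "\<lambda>z. snd c (inv (cinv d1 (fst z)) \<otimes> cinv d2 (snd z))"
      have "h1_on s t (\<lambda>r. ?F (snd d1 (\<sigma> r), snd d2 (\<tau> r)))"
      proof (rule h1_on_compose[OF p])
        fix r assume r: "r \<in> {s..t}"
        let ?z = "(snd d1 (\<sigma> r), snd d2 (\<tau> r))"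
        have "gC1 (\<lambda>z::'e \<times> 'e. cinv d1 (fst z)) ?z" "gC1 (\<lambda>z::'e \<times> 'e. cinv d2 (snd z)) ?z"
          using inb[OF r] d
          by (auto intro!: gC1_compose gC1_cinv C1_at_bounded_linear bounded_linear_intros)
        then have "gC1 (\<lambda>z::'e \<times> 'e. inv (cinv d1 (fst z)) \<otimes> cinv d2 (snd z)) ?z"
          by (intro gC1_mult gC1_inv)
        then show "C1_at ?F ?z"
          using st[of r] inb[OF r] d c by (intro gC1_chart(2)) (simp_all add: cinv_chart)
      qed
      then show ?thesis by (rule h1_on_cong) (use inb d in \<open>simp add: cinv_chart\<close>)
    qed
    then show "\<exists>d>0. \<forall>s t. 0 \<le> s \<and> s \<le> x \<and> x \<le> t \<and> t \<le> 1 \<and> t - s < d \<longrightarrow> h1_on s t (\<lambda>x. snd c (inv (\<sigma> x) \<otimes> \<tau> x))"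
      using \<delta>(1) by blast
  qed
qed

end

lemma const_h1_0: "const_h1 0 = 0"
  by (rule loop_of_eqI) (simp add: zero_h1.rep_eq)

lemma superpos_ident: "superpos (\<lambda>h. h) \<xi> = \<xi>"
  by (simp add: superpos_def loop_of_inverse)

lemma inv_into_UNIV_id: "inv_into UNIV id = id"
  by (rule ext) (metis inv_into_f_f inj_on_id UNIV_I id_apply)

section \<open>Levi-Civita connection, geodesics and exponential map of the L^2 metric\<close>

context lie_group_metric
begin

text \<open>The chart chosen in \<open>l2_metric\<close> need not be \<open>c\<close>;
  \<open>left_differential\<close> shows that the integrand does not depend on it.\<close>

lemma l2_metric_constant_loop:
  "l2_metric G g c (constant_loop G) \<xi> \<eta> = (LINT x:{0..1}|lborel. ge (loop_of \<xi> x) (loop_of \<eta> x))"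
proof -
  define d where "d = (SOME d. d \<in> atlas G \<and> \<one> \<in> fst d)"
  have d: "d \<in> atlas G \<and> \<one> \<in> fst d"
    unfolding d_def by (rule someI[of _ c]) (use c in simp)
  then show ?thesis
    unfolding l2_metric_def constant_loop_def Let_def d_def[symmetric]
    by (simp add: left_differential(2)[OF one_closed, of d])
qed

lemma loop_of_loop_bracket: "loop_of (loop_bracket G c \<xi> \<eta>) x = br (loop_of \<xi> x) (loop_of \<eta> x)"
proof -
  have "h1_on 0 1 (\<lambda>x. (\<lambda>p. br (fst p) (snd p)) (loop_of \<xi> x, loop_of \<eta> x))"
    by (rule h1_on_compose[OF h1_on_Pair[OF h1_on_loop_of h1_on_loop_of] C1_at_bounded_bilinear[OF bounded_bilinear_br]])
  moreover have "periodic1 (\<lambda>x. br (loop_of \<xi> x) (loop_of \<eta> x))"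
    using periodic_loop_of[of \<xi>] periodic_loop_of[of \<eta>] by (simp add: periodic1_def)
  ultimately show ?thesis by (simp add: loop_bracket_def loop_of_Abs_h1)
qed

lemma br_self: "br u u = 0"
  using lie_bracket_antisym[of u u] by (simp add: eq_neg_iff_add_eq_0 scaleR_2[symmetric])

text \<open>For equal arguments every bracket term of the Koszul formula is zero, by antisymmetry of
  the bracket or by skewness of ad. Uniqueness survives the weakness of the metric, since a
  continuous loop with vanishing L^2 norm is zero.\<close>

lemma l2_levi_civita_self: "l2_levi_civita G g c \<xi> \<xi> = 0"
  unfolding l2_levi_civita_def
proof (rule the_equality)
  have z: "l2_metric G g c (constant_loop G) (loop_bracket G c \<xi> \<xi>) \<theta> = 0"
    "l2_metric G g c (constant_loop G) (loop_bracket G c \<xi> \<theta>) \<xi> = 0"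
    "l2_metric G g c (constant_loop G) (loop_bracket G c \<theta> \<xi>) \<xi> = 0" for \<theta>
    by (simp_all add: l2_metric_constant_loop loop_of_loop_bracket br_self br_skew_self gb.zero_left
        br_skew[of "loop_of \<xi> _" _ "loop_of \<xi> _"] gb.zero_right set_lebesgue_integral_def)
  show "\<forall>\<theta>. 2 * l2_metric G g c (constant_loop G) 0 \<theta> =
         l2_metric G g c (constant_loop G) (loop_bracket G c \<xi> \<xi>) \<theta>
         - l2_metric G g c (constant_loop G) (loop_bracket G c \<xi> \<theta>) \<xi>
         + l2_metric G g c (constant_loop G) (loop_bracket G c \<theta> \<xi>) \<xi>"
    by (simp add: z) (simp add: l2_metric_constant_loop zero_h1.rep_eq gb.zero_left set_lebesgue_integral_def)
  fix \<nu>
  assume "\<forall>\<theta>. 2 * l2_metric G g c (constant_loop G) \<nu> \<theta> =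
         l2_metric G g c (constant_loop G) (loop_bracket G c \<xi> \<xi>) \<theta>
         - l2_metric G g c (constant_loop G) (loop_bracket G c \<xi> \<theta>) \<xi>
         + l2_metric G g c (constant_loop G) (loop_bracket G c \<theta> \<xi>) \<xi>"
  \<comment> \<open>The test vector \<open>\<theta>\<close> is \<open>\<nu>\<close> itself.\<close>
  then have 0: "(LINT x:{0..1}|lborel. ge (loop_of \<nu> x) (loop_of \<nu> x)) = 0"
    by (simp add: z) (simp add: l2_metric_constant_loop)
  have cont: "continuous_on {0..1} (\<lambda>x. ge (loop_of \<nu> x) (loop_of \<nu> x))"
    by (intro gb.continuous_on loop_of_continuous)
  have "integral {0..1} (\<lambda>x. ge (loop_of \<nu> x) (loop_of \<nu> x)) = 0"
    using 0 set_borel_integral_eq_integral(2)[OF borel_integrable_atLeastAtMost'[OF cont]] by simp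
  then have "\<forall>x\<in>{0..1}. ge (loop_of \<nu> x) (loop_of \<nu> x) = 0"
    using integral_eq_0_iff[OF cont] ge_nonneg by simp
  then show "\<nu> = 0" by (intro loop_of_eqI) (auto simp: ge_eq_0 zero_h1.rep_eq)
qed

lemma Exp_small:
  assumes "a \<in> carrier G" "a \<otimes> Exp u \<in> fst c"
  obtains r where "r > 0" "\<And>Y. norm (Y - u) < r \<Longrightarrow> a \<otimes> Exp Y \<in> fst c"
proof -
  have "gC1 (\<lambda>Y. a \<otimes> Exp Y) u" by (intro gC1_mult gC1_const Exp_C1 assms)
  from gC1_chart(1)[OF this c(1) assms(2)] obtain r where "r > 0" "\<And>Y. dist Y u < r \<Longrightarrow> a \<otimes> Exp Y \<in> fst c"
    unfolding eventually_nhds_metric by blast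
  then show thesis using that by (simp add: dist_norm)
qed

text \<open>In the chart centred at time t the curve is t' \<mapsto> superposition of Exp applied to
  (t' - t) X. This passes through the zero loop at t' = t, where the differential of Exp is the
  identity, so the velocity is X at all times.\<close>

lemma l2_geodesic_Exp: "l2_geodesic G g c (\<lambda>t x. Exp (t *\<^sub>R loop_of X x)) (\<lambda>_. X)"
  unfolding l2_geodesic_def
proof (intro allI conjI)
  fix t
  let ?\<gamma> = "\<lambda>t x. Exp (t *\<^sub>R loop_of X x)"
  have H1: "?\<gamma> t \<in> H1_loops G" for t
    using Exp_loop_H1[of "t *\<^sub>R X"] by (simp add: scaleR_h1.rep_eq)
  then show "?\<gamma> t \<in> H1_loops G" .
  show "((\<lambda>_. X) has_vector_derivative - l2_levi_civita G g c X X) (at t)"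
    by (simp add: l2_levi_civita_self)
  have diff: "inv (?\<gamma> t x) \<otimes> ?\<gamma> t' x = Exp ((t' - t) *\<^sub>R loop_of X x)" for t' x by (rule Exp_diff)
  show "has_mderivative (UNIV, id) (loop_chart G c (?\<gamma> t)) ?\<gamma> t (\<lambda>h. h *\<^sub>R X)"
    unfolding has_mderivative_def
  proof (intro conjI)
    show "t \<in> fst (UNIV, id)" by simp
    show "?\<gamma> t \<in> fst (loop_chart G c (?\<gamma> t))" using H1 c by (simp add: loop_chart_def)
    obtain r where r: "r > 0" "\<And>Y. norm (Y - 0) < r \<Longrightarrow> \<one> \<otimes> Exp Y \<in> fst c"
      using Exp_small[of \<one> 0] c by auto
    have "\<forall>\<^sub>F t' in nhds t. dist t' t < r / (2 * norm X + 1)"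
      using r(1) unfolding eventually_nhds_metric by (intro exI[of _ "r / (2 * norm X + 1)"]) (auto intro!: divide_pos_pos add_nonneg_pos)
    then show "\<forall>\<^sub>F t' in nhds (snd (UNIV, id) t). ?\<gamma> (inv_into (fst (UNIV, id)) (snd (UNIV, id)) t') \<in> fst (loop_chart G c (?\<gamma> t))"
      unfolding fst_conv snd_conv inv_into_UNIV_id id_apply
    proof eventually_elim
      case (elim t')
      have "Exp ((t' - t) *\<^sub>R loop_of X x) \<in> fst c" for x
      proof -
        \<comment> \<open>Pointwise, X is at most twice its H^1 norm; the summand 1 covers X =
          0.\<close>
        have p: "2 * norm X + 1 > 0" by (simp add: add_nonneg_pos)
        have "norm ((t' - t) *\<^sub>R loop_of X x) \<le> \<bar>t' - t\<bar> * (2 * norm X + 1)"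
          using loop_of_bound[of X x] by (simp add: mult_left_mono)
        also have "\<dots> < r" using elim p by (simp add: dist_real_def pos_less_divide_eq)
        finally show ?thesis using r(2)[of "(t' - t) *\<^sub>R loop_of X x"] by simp
      qed
      then show ?case using H1 by (simp add: loop_chart_def diff)
    qed
    let ?\<Phi> = "\<lambda>Y. snd c (Exp Y)"
    have C1: "C1_at ?\<Phi> 0" using c by (intro gC1_chart(2)[OF Exp_C1]) auto
    have "frechet_derivative ?\<Phi> (at 0) = (\<lambda>h. h)"
      using frechet_derivative_at[OF Exp_has_derivative_0] by simp
    with superpos_has_derivative[OF C1] have sd: "(superpos ?\<Phi> has_derivative (\<lambda>h. h)) (at ((t - t) *\<^sub>R X))"
      by (simp add: const_h1_0 superpos_ident[abs_def])
    have "((\<lambda>t'. (t' - t) *\<^sub>R X) has_derivative (\<lambda>h. h *\<^sub>R X)) (at t)" by (auto intro!: derivative_eq_intros)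
    from has_derivative_compose[OF this sd]
    have "((\<lambda>t'. superpos ?\<Phi> ((t' - t) *\<^sub>R X)) has_derivative (\<lambda>h. h *\<^sub>R X)) (at t)" .
    moreover have "in_charts (UNIV, id) (loop_chart G c (?\<gamma> t)) ?\<gamma> = (\<lambda>t'. superpos ?\<Phi> ((t' - t) *\<^sub>R X))"
      by (simp add: in_charts_def loop_chart_def inv_into_UNIV_id fun_eq_iff diff superpos_def scaleR_h1.rep_eq)
    ultimately show "(in_charts (UNIV, id) (loop_chart G c (?\<gamma> t)) ?\<gamma> has_derivative (\<lambda>h. h *\<^sub>R X)) (at (snd (UNIV, id) t))"
      by simp
  qed
qed

text \<open>The velocity is constant since the connection term vanishes. Evaluation at
  \<open>x\<close> is a bounded linear functional on H^1, so differentiability in the loop chart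
  gives a pointwise left velocity, and \<open>integral_curve_unique\<close> applies.\<close>

lemma l2_geodesic_unique:
  assumes geo: "l2_geodesic G g c \<gamma> \<xi>" and 0: "\<gamma> 0 = constant_loop G" "\<xi> 0 = X"
  shows "\<gamma> t x = Exp (t *\<^sub>R loop_of X x)"
proof -
  have H1: "\<gamma> t \<in> H1_loops G"
    and md: "has_mderivative (UNIV, id) (loop_chart G c (\<gamma> t)) \<gamma> t (\<lambda>h. h *\<^sub>R \<xi> t)"
    and vd: "(\<xi> has_vector_derivative 0) (at t)" for t
    using geo unfolding l2_geodesic_def by (auto simp: l2_levi_civita_self)
  have \<xi>: "\<xi> t = X" for t
  proof -
    have "\<xi> t = \<xi> 0"
      by (rule has_derivative_zero_unique[of UNIV \<xi>]) (use vd in \<open>auto simp: has_vector_derivative_def\<close>)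
    then show ?thesis using 0 by simp
  qed
  show ?thesis
  proof (rule integral_curve_unique[where \<beta> = "\<lambda>t. \<gamma> t x"])
    show "\<gamma> t x \<in> carrier G" for t using H1[of t] by (simp add: H1_loops_def)
    show "\<gamma> 0 x = \<one>" using 0 by (simp add: constant_loop_def)
    show "left_velocity (\<lambda>t. \<gamma> t x) t (loop_of X x)" for t
    proof -
      have ev: "\<forall>\<^sub>F t' in nhds t. \<gamma> t' \<in> fst (loop_chart G c (\<gamma> t))"
        and d: "(in_charts (UNIV, id) (loop_chart G c (\<gamma> t)) \<gamma> has_derivative (\<lambda>h. h *\<^sub>R X)) (at t)"
        using md[of t] unfolding has_mderivative_def by (simp_all add: inv_into_UNIV_id \<xi>)
      have e1: "\<forall>\<^sub>F t' in nhds t. \<forall>x. inv (\<gamma> t x) \<otimes> \<gamma> t' x \<in> fst c"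
        using ev by eventually_elim (simp add: loop_chart_def)
      have "((\<lambda>t'. loop_of (in_charts (UNIV, id) (loop_chart G c (\<gamma> t)) \<gamma> t') x) has_derivative (\<lambda>h. loop_of (h *\<^sub>R X) x)) (at t)"
        by (rule bounded_linear.has_derivative[OF bounded_linear_loop_of d])
      then have "((\<lambda>t'. loop_of (in_charts (UNIV, id) (loop_chart G c (\<gamma> t)) \<gamma> t') x) has_derivative (\<lambda>h. h *\<^sub>R loop_of X x)) (at t)"
        by (simp add: scaleR_h1.rep_eq)
      then have "((\<lambda>t'. snd c (inv (\<gamma> t x) \<otimes> \<gamma> t' x)) has_derivative (\<lambda>h. h *\<^sub>R loop_of X x)) (at t)"
      proof (rule has_derivative_eventually_cong)
        show "\<forall>\<^sub>F t' in nhds t. loop_of (in_charts (UNIV, id) (loop_chart G c (\<gamma> t)) \<gamma> t') x = snd c (inv (\<gamma> t x) \<otimes> \<gamma> t' x)"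
          using e1
        proof eventually_elim
          case (elim t')
          then show ?case
            using loop_chart_coordinate[OF H1[of t] H1[of t']]
            by (simp add: in_charts_def loop_chart_def inv_into_UNIV_id)
        qed
      qed
      moreover have "\<forall>\<^sub>F t' in nhds t. inv (\<gamma> t x) \<otimes> \<gamma> t' x \<in> fst c"
        using e1 by eventually_elim simp
      ultimately show ?thesis unfolding left_velocity_def by blast
    qed
  qed
qed

lemma l2_exp_eq: "l2_exp G g c X = (\<lambda>x. Exp (loop_of X x))"
  unfolding l2_exp_def
proof (rule the_equality)
  show "\<exists>\<gamma> \<xi>. l2_geodesic G g c \<gamma> \<xi> \<and> \<gamma> 0 = constant_loop G \<and> \<xi> 0 = X \<and> \<gamma> 1 = (\<lambda>x. Exp (loop_of X x))"
    by (intro exI[of _ "\<lambda>t x. Exp (t *\<^sub>R loop_of X x)"] exI[of _ "\<lambda>_. X"] conjI l2_geodesic_Exp)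
      (simp_all add: constant_loop_def)
  show "\<tau> = (\<lambda>x. Exp (loop_of X x))"
    if "\<exists>\<gamma> \<xi>. l2_geodesic G g c \<gamma> \<xi> \<and> \<gamma> 0 = constant_loop G \<and> \<xi> 0 = X \<and> \<gamma> 1 = \<tau>" for \<tau>
    using that
  proof (elim exE conjE)
    fix \<gamma> \<xi>
    assume "l2_geodesic G g c \<gamma> \<xi>" "\<gamma> 0 = constant_loop G" "\<xi> 0 = X" "\<gamma> 1 = \<tau>"
    then show ?thesis using l2_geodesic_unique[of \<gamma> \<xi> X 1] by (auto simp: fun_eq_iff)
  qed
qed

text \<open>In the chart centred at the constant loop Exp u the exponential map is itself a
  superposition operator, with kernel function \<open>F u\<close>.\<close>

lemma l2_exp_has_mderivative:
  defines "F \<equiv> (\<lambda>u Y. snd c (inv (Exp u) \<otimes> Exp Y))"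
  shows "has_mderivative (UNIV, id) (loop_chart G c (\<lambda>_. Exp u)) (l2_exp G g c) (const_h1 u)
    (superpos (frechet_derivative (F u) (at u)))"
  unfolding has_mderivative_def
proof (intro conjI)
  show "const_h1 u \<in> fst (UNIV, id)" by simp
  show "l2_exp G g c (const_h1 u) \<in> fst (loop_chart G c (\<lambda>_. Exp u))"
    using Exp_loop_H1[of "const_h1 u"] c by (simp add: l2_exp_eq loop_chart_def)
  obtain r where r: "r > 0" "\<And>Y. norm (Y - u) < r \<Longrightarrow> inv (Exp u) \<otimes> Exp Y \<in> fst c"
    using Exp_small[of "inv (Exp u)" u] c by auto
  have "\<forall>\<^sub>F Y in nhds (const_h1 u). dist Y (const_h1 u) < r / 2"
    using r(1) unfolding eventually_nhds_metric by (intro exI[of _ "r / 2"]) auto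
  then show "\<forall>\<^sub>F Y in nhds (snd (UNIV, id) (const_h1 u)).
      l2_exp G g c (inv_into (fst (UNIV, id)) (snd (UNIV, id)) Y) \<in> fst (loop_chart G c (\<lambda>_. Exp u))"
    unfolding fst_conv snd_conv inv_into_UNIV_id id_apply
  proof eventually_elim
    case (elim Y)
    have "inv (Exp u) \<otimes> Exp (loop_of Y x) \<in> fst c" for x
      using loop_of_bound[of "Y - const_h1 u" x] elim by (intro r(2)) (simp add: loop_of_diff dist_norm)
    then show ?case using Exp_loop_H1[of Y] by (simp add: l2_exp_eq loop_chart_def)
  qed
  have "gC1 (\<lambda>Y. inv (Exp u) \<otimes> Exp Y) u" by (intro gC1_mult gC1_const Exp_C1 inv_closed Exp_carrier)
  then have "C1_at (F u) u" unfolding F_def using c by (intro gC1_chart(2)) simp_all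
  moreover have "in_charts (UNIV, id) (loop_chart G c (\<lambda>_. Exp u)) (l2_exp G g c) = superpos (F u)"
    by (simp add: in_charts_def loop_chart_def inv_into_UNIV_id fun_eq_iff l2_exp_eq superpos_def F_def)
  ultimately show "(in_charts (UNIV, id) (loop_chart G c (\<lambda>_. Exp u)) (l2_exp G g c) has_derivative
      superpos (frechet_derivative (F u) (at u))) (at (snd (UNIV, id) (const_h1 u)))"
    using superpos_has_derivative by simp
qed

theorem l2_exp_not_fredholm:
  assumes "a \<in> connected_component_of_set (topol G) \<one>" "b \<in> connected_component_of_set (topol G) \<one>"
    and "a \<otimes> b \<noteq> b \<otimes> a"
  shows "\<not> fredholm_map {(UNIV, id)} (loop_atlas G) (l2_exp G g c)"
proof
  assume fr: "fredholm_map {(UNIV, id)} (loop_atlas G) (l2_exp G g c)"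
  obtain u v A where v: "v \<noteq> 0" "A v = 0"
    and A: "((\<lambda>Y. snd c (inv (Exp u) \<otimes> Exp Y)) has_derivative A) (at u)"
    by (rule conjugate_point[OF assms])
  have "has_mderivative (UNIV, id) (loop_chart G c (\<lambda>_. Exp u)) (l2_exp G g c) (const_h1 u) (superpos A)"
    using l2_exp_has_mderivative[of u] unfolding frechet_derivative_at[OF A, symmetric] .
  moreover have "loop_chart G c (\<lambda>_. Exp u) \<in> loop_atlas G"
  proof -
    have "(\<lambda>_. Exp u) \<in> H1_loops G" using Exp_loop_H1[of "const_h1 u"] by simp
    with c show ?thesis
      unfolding loop_atlas_def by (intro CollectI exI[of _ c] exI[of _ "\<lambda>_. Exp u"] conjI refl)
  qed
  ultimately have "fredholm_operator (superpos A)" using fr unfolding fredholm_map_def by blast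
  then show False using superpos_not_fredholm[OF has_derivative_bounded_linear[OF A] v] by blast
qed

end

text \<open>The global chart \<open>(UNIV, id)\<close> describes the tangent space at the constant
  loop. Non-commutativity is asked of the identity component, which is what the Lie algebra sees:
  O(2) is non-abelian, yet its bracket vanishes, its exponential map is a local diffeomorphism, and
  the conclusion fails for it.\<close>

theorem mainTheorem4:
  fixes G :: "('g, 'e::euclidean_space) lie_group"
    and g :: "('g, 'e) metric"
    and c :: "('g, 'e) chart"
  assumes "is_lie_group G"
    and "compact_space (topol G)"
    and "\<exists>a \<in> connected_component_of_set (topol G) \<one>\<^bsub>G\<^esub>.
         \<exists>b \<in> connected_component_of_set (topol G) \<one>\<^bsub>G\<^esub>. a \<otimes>\<^bsub>G\<^esub> b \<noteq> b \<otimes>\<^bsub>G\<^esub> a"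
    and "bi_invariant_metric G g"
    and "c \<in> atlas G" and "\<one>\<^bsub>G\<^esub> \<in> fst c"
  shows "\<not> fredholm_map {(UNIV, id)} (loop_atlas G) (l2_exp G g c)"
proof -
  interpret lie_group_metric G c g
    using assms
    by (simp add: lie_group_metric_def lie_group_metric_axioms_def lie_group_chart_def
        lie_group_chart_axioms_def lie_group_on_def lie_group_on_axioms_def is_lie_group_def)
  from assms(3) show ?thesis using l2_exp_not_fredholm by blast
qed

end
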